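(* Let $\delta>0$ and let $\beta$ be a fixed Diophantine number. Then the maps $D\mapsto L(\beta,D)$ and $D\mapsto L'(\beta,D)$ are continuous on the set of all $D\in\mathcal{C}_\delta^\omega(\mathbb{T},M_2(\mathbb{C}))$ whose determinant $\det D$ does not vanish identically, with respect to the topology induced by the norm $\|\cdot\|_\delta$.
   Context: $\mathbb{T}=\mathbb{R}/\mathbb{Z}$ carries its Haar probability measure $\mu$. For a Banach space $X$ and $\delta>0$, $\mathcal{C}_\delta^\omega(\mathbb{T},X)$ denotes the analytic $X$-valued functions on $\mathbb{T}$ (1-periodic) that extend analytically to a neighborhood of the strip $\mathbb{T}_\delta=\{|\mathrm{Im}\, z|\le\delta\}$. On $\mathcal{C}_\delta^\omega(\mathbb{T},M_2(\mathbb{C}))$ one uses the norm $\|D\|_\delta:=\sup_{|\mathrm{Im}\, z|\le\delta}\|D(z)\|$, where $\|\cdot\|$ on the right is the usual matrix norm. For $\beta$ irrational and measurable $D:\mathbb{T}\to M_2(\mathbb{C})$ with $\log|\det D|\in L^1(\mathbb{T},d\mu)$, the Lyapunov exponent is $$L(\beta,D)=\lim_{n\to\infty}\frac1n\int_{\mathbb{T}}\log\|D(x+(n-1)\beta)\cdots D(x)\|\,d\mu(x),$$ which for $\mu$-a.e. $x$ also equals $\lim_{n\to\infty}\frac1n\log\|D(x+(n-1)\beta)\cdots D(x)\|$. For $D\in\mathcal{C}_\delta^\omega(\mathbb{T},M_2(\mathbb{C}))$ with $d(x):=\det D(x)$ not identically zero, put $D'(x):=\frac{1}{\sqrt{|d(x)|}}D(x)$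 (defined off the finitely many zeros of $d$ on $\mathbb{T}$), and $L'(\beta,D):=L(\beta,D')$. $\beta$ is Diophantine if there exist $b(\beta)>0$ and $1<r(\beta)<\infty$ such that $|\sin(2\pi j\beta)|>\dfrac{b(\beta)}{|j|^{r(\beta)}}$ for all $j\in\mathbb{Z}\setminus\{0\}$. *)

theory Defs
  imports "HOL-Complex_Analysis.Complex_Analysis"
begin

no_notation fps_nth (infixl "$" 75)

text \<open>Functions on \<open>\<real>/\<int>\<close> are 1-periodic functions on \<open>real\<close>; the Haar probability measure
  is Lebesgue measure on \<open>{0..1}\<close>.\<close>

type_synonym mat2 = "complex^2^2"

text \<open>The library norm on \<open>complex^2^2\<close> is the Frobenius norm; this is the operator norm with
  respect to the Euclidean norm on \<open>complex^2\<close>.\<close>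

definition mat_norm :: "mat2 \<Rightarrow> real" where
  "mat_norm A = onorm (\<lambda>v. A *v v)"

definition strip :: "real \<Rightarrow> complex set" where
  "strip \<delta> = {z. \<bar>Im z\<bar> \<le> \<delta>}"

text \<open>Analyticity of a matrix-valued map is analyticity of its entries; \<open>analytic_on\<close> a closed set
  means holomorphic on an open neighbourhood of it. Periodicity of the extension is a consequence
  (\<open>strip_extension_periodic\<close> below).\<close>

definition is_strip_extension :: "real \<Rightarrow> (real \<Rightarrow> mat2) \<Rightarrow> (complex \<Rightarrow> mat2) \<Rightarrow> bool" where
  "is_strip_extension \<delta> D F \<longleftrightarrow>
     (\<forall>i j. (\<lambda>z. F z $ i $ j) analytic_on strip \<delta>) \<and> (\<forall>x. F (of_real x) = D x)"

definition C_omega :: "real \<Rightarrow> (real \<Rightarrow> mat2) set" where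
  "C_omega \<delta> = {D. (\<forall>x. D (x + 1) = D x) \<and> (\<exists>F. is_strip_extension \<delta> D F)}"

text \<open>On the strip the chosen extension is the only one (\<open>strip_extension_eq\<close> below).\<close>

definition strip_extension :: "real \<Rightarrow> (real \<Rightarrow> mat2) \<Rightarrow> complex \<Rightarrow> mat2" where
  "strip_extension \<delta> D = (SOME F. is_strip_extension \<delta> D F)"

definition strip_norm :: "real \<Rightarrow> (real \<Rightarrow> mat2) \<Rightarrow> real" where
  "strip_norm \<delta> D = (SUP z\<in>strip \<delta>. mat_norm (strip_extension \<delta> D z))"

text \<open>The value off \<open>C_omega \<delta>\<close> is irrelevant; \<open>Metric_space\<close> asks for a nonnegative symmetric
  function on the whole type.\<close>

definition strip_dist :: "real \<Rightarrow> (real \<Rightarrow> mat2) \<Rightarrow> (real \<Rightarrow> mat2) \<Rightarrow> real" where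
  "strip_dist \<delta> D E =
     (if D \<in> C_omega \<delta> \<and> E \<in> C_omega \<delta> then strip_norm \<delta> (\<lambda>x. D x - E x) else 0)"

definition strip_topology :: "real \<Rightarrow> (real \<Rightarrow> mat2) topology" where
  "strip_topology \<delta> = Metric_space.mtopology (C_omega \<delta>) (strip_dist \<delta>)"

text \<open>\<open>cocycle \<beta> D n x\<close> is \<open>D (x + (n-1) \<beta>) ** \<dots> ** D x\<close>.\<close>

primrec cocycle :: "real \<Rightarrow> (real \<Rightarrow> mat2) \<Rightarrow> nat \<Rightarrow> real \<Rightarrow> mat2" where
  "cocycle \<beta> D 0 x = mat 1"
| "cocycle \<beta> D (Suc n) x = D (x + real n * \<beta>) ** cocycle \<beta> D n x"

text \<open>Since \<open>ln 0 = 0\<close> here, this is the Lyapunov exponent only for \<open>D\<close> whose determinant is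
  nonzero almost everywhere, as it is for the functions considered below.\<close>

definition lyapunov :: "real \<Rightarrow> (real \<Rightarrow> mat2) \<Rightarrow> real" where
  "lyapunov \<beta> D =
     lim (\<lambda>n. (1 / real n) * (LINT x:{0..1}|lborel. ln (mat_norm (cocycle \<beta> D n x))))"

text \<open>At the finitely many zeros of the determinant modulo 1, the value is \<open>0\<close>.\<close>

definition normalized :: "(real \<Rightarrow> mat2) \<Rightarrow> real \<Rightarrow> mat2" where
  "normalized D x = (1 / sqrt (cmod (det (D x)))) *\<^sub>R D x"

definition lyapunov' :: "real \<Rightarrow> (real \<Rightarrow> mat2) \<Rightarrow> real" where
  "lyapunov' \<beta> D = lyapunov \<beta> (normalized D)"

definition diophantine :: "real \<Rightarrow> bool" where
  "diophantine \<beta> \<longleftrightarrow>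
     (\<exists>b>0. \<exists>r>1. \<forall>j::int. j \<noteq> 0 \<longrightarrow>
        \<bar>sin (2 * pi * real_of_int j * \<beta>)\<bar> > b / \<bar>real_of_int j\<bar> powr r)"


subsection \<open>The operator norm and the strip metric are well defined\<close>

lemma bounded_linear_matrix_vector_mult: "bounded_linear (\<lambda>v. (A::mat2) *v v)"
proof -
  have "linear (\<lambda>v. A *v v)"
    by (intro linearI)
      (simp_all add: matrix_vector_mult_def vec_eq_iff sum.distrib algebra_simps scaleR_sum_right)
  then show ?thesis by (simp add: linear_conv_bounded_linear)
qed

lemma mat_norm_nonneg: "0 \<le> mat_norm A"
  unfolding mat_norm_def by (rule onorm_pos_le[OF bounded_linear_matrix_vector_mult])

lemma mat_norm_eq_0_iff: "mat_norm A = 0 \<longleftrightarrow> A = 0"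
  unfolding mat_norm_def onorm_eq_0[OF bounded_linear_matrix_vector_mult]
  by (simp add: matrix_eq[of A 0])

lemma mat_norm_minus: "mat_norm (- A) = mat_norm A"
proof -
  have "(\<lambda>v. (- A) *v v) = (\<lambda>v. - (A *v v))"
    by (auto simp: matrix_vector_mult_def vec_eq_iff sum_negf)
  then show ?thesis by (simp add: mat_norm_def onorm_neg)
qed

lemma mat_norm_triangle: "mat_norm (A + B) \<le> mat_norm A + mat_norm B"
  unfolding mat_norm_def matrix_vector_mult_add_rdistrib
  by (intro onorm_triangle bounded_linear_matrix_vector_mult)

lemma mat_norm_le_sum: "mat_norm A \<le> (\<Sum>i\<in>UNIV. \<Sum>j\<in>UNIV. norm (A $ i $ j))"
  unfolding mat_norm_def
proof (rule onorm_bound)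
  fix v :: "complex^2"
  have "norm (A *v v) \<le> (\<Sum>i\<in>UNIV. norm ((A *v v) $ i))"
    unfolding norm_vec_def by (rule L2_set_le_sum) simp
  also have "\<dots> \<le> (\<Sum>i\<in>UNIV. \<Sum>j\<in>UNIV. norm (A $ i $ j) * norm v)"
  proof (intro sum_mono)
    fix i :: 2
    have "norm ((A *v v) $ i) \<le> (\<Sum>j\<in>UNIV. norm (A $ i $ j * v $ j))"
      unfolding matrix_vector_mult_def by (simp add: norm_sum)
    also have "\<dots> \<le> (\<Sum>j\<in>UNIV. norm (A $ i $ j) * norm v)"
      by (intro sum_mono) (simp add: norm_mult mult_left_mono Finite_Cartesian_Product.norm_nth_le)
    finally show "norm ((A *v v) $ i) \<le> (\<Sum>j\<in>UNIV. norm (A $ i $ j) * norm v)" .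
  qed
  finally show "norm (A *v v) \<le> (\<Sum>i\<in>UNIV. \<Sum>j\<in>UNIV. norm (A $ i $ j)) * norm v"
    by (simp add: sum_distrib_right)
qed (intro sum_nonneg norm_ge_zero)

lemma of_real_in_strip: "0 < \<delta> \<Longrightarrow> of_real x \<in> strip \<delta>"
  by (simp add: strip_def)

lemma connected_strip: "connected (strip \<delta>)"
proof -
  have "strip \<delta> = {z. Im z \<le> \<delta>} \<inter> {z. Im z \<ge> - \<delta>}" by (auto simp: strip_def)
  then show ?thesis
    by (simp add: convex_connected convex_Int convex_halfspace_Im_le convex_halfspace_Im_ge)
qed

lemma analytic_on_strip_eq_0:
  assumes "0 < \<delta>" "f analytic_on strip \<delta>" "\<And>x. f (of_real x) = 0" "z \<in> strip \<delta>"
  shows "f z = 0"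
proof -
  obtain U where U: "open U" "strip \<delta> \<subseteq> U" "f holomorphic_on U"
    using assms(2) by (auto simp: analytic_on_holomorphic)
  let ?V = "connected_component_set U 0"
  have 0: "0 \<in> strip \<delta>" using assms(1) by (simp add: strip_def)
  have V: "strip \<delta> \<subseteq> ?V"
    using U 0 by (intro connected_component_maximal connected_strip) auto
  have lim: "(0::complex) islimpt range of_real"
    unfolding islimpt_approachable
  proof (intro allI impI)
    fix e :: real assume "e > 0"
    then show "\<exists>x'\<in>range of_real. x' \<noteq> (0::complex) \<and> dist x' 0 < e"
      by (intro bexI[of _ "of_real (e/2)"] rangeI) auto
  qed
  show ?thesis
  proof (rule analytic_continuation[where f = f and w = z and S = ?V and U = "range of_real" and \<xi> = 0])
    show "f holomorphic_on ?V"
      by (rule holomorphic_on_subset[OF U(3) connected_component_subset])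
    show "open ?V" using U(1) by (rule open_connected_component)
    show "range of_real \<subseteq> ?V" using V of_real_in_strip[OF assms(1)] by auto
    show "0 \<in> ?V" using V 0 by auto
    show "z \<in> ?V" using V assms(4) by auto
  qed (use lim assms(3) in auto)
qed

lemma is_strip_extension_unique:
  assumes "0 < \<delta>" "is_strip_extension \<delta> D F" "is_strip_extension \<delta> D G" "z \<in> strip \<delta>"
  shows "F z = G z"
proof -
  have "F z $ i $ j - G z $ i $ j = 0" for i j
    by (rule analytic_on_strip_eq_0[of \<delta> "\<lambda>z. F z $ i $ j - G z $ i $ j"])
      (use assms in \<open>auto simp: is_strip_extension_def intro!: analytic_on_diff\<close>)
  then show ?thesis by (simp add: vec_eq_iff)
qed

lemma strip_extension_eq:
  assumes "0 < \<delta>" "is_strip_extension \<delta> D F" "z \<in> strip \<delta>"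
  shows "strip_extension \<delta> D z = F z"
  using is_strip_extension_unique[OF assms(1) _ assms(2,3)]
    someI[of "is_strip_extension \<delta> D", OF assms(2)]
  unfolding strip_extension_def by blast

lemma strip_extension_periodic:
  assumes "0 < \<delta>" "is_strip_extension \<delta> D F" "\<And>x. D (x + 1) = D x" "z \<in> strip \<delta>"
  shows "F (z + 1) = F z"
proof (rule is_strip_extension_unique[of \<delta> D "\<lambda>z. F (z + 1)" F z, OF assms(1) _ assms(2,4)])
  have "(\<lambda>z. F (z + 1) $ i $ j) analytic_on strip \<delta>" for i j
  proof -
    have "((\<lambda>z. F z $ i $ j) \<circ> (\<lambda>z. z + 1)) analytic_on strip \<delta>"
    proof (rule analytic_on_compose)
      show "(\<lambda>z. F z $ i $ j) analytic_on (\<lambda>z. z + 1) ` strip \<delta>"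
        by (rule analytic_on_subset[of _ "strip \<delta>"])
          (use assms(2) in \<open>auto simp: is_strip_extension_def strip_def\<close>)
    qed (intro analytic_intros)
    then show ?thesis by (simp add: o_def)
  qed
  moreover have "F (of_real x + 1) = D x" for x
    using assms(2) assms(3)[of x] unfolding is_strip_extension_def
    by (metis of_real_1 of_real_add)
  ultimately show "is_strip_extension \<delta> D (\<lambda>z. F (z + 1))"
    by (simp add: is_strip_extension_def)
qed

lemma mat_norm_extension_bounded:
  assumes "0 < \<delta>" "is_strip_extension \<delta> D F" "\<And>x. D (x + 1) = D x"
  shows "bdd_above ((\<lambda>z. mat_norm (F z)) ` strip \<delta>)"
proof -
  let ?K = "cbox (Complex 0 (-\<delta>)) (Complex 1 \<delta>)"
  let ?g = "\<lambda>z. \<Sum>i\<in>UNIV. \<Sum>j\<in>UNIV. norm (F z $ i $ j)"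
  have K: "?K \<subseteq> strip \<delta>" by (auto simp: strip_def in_cbox_complex_iff)
  have "continuous_on (strip \<delta>) (\<lambda>z. F z $ i $ j)" for i j
    using assms(2) unfolding is_strip_extension_def
    by (intro holomorphic_on_imp_continuous_on analytic_imp_holomorphic) simp
  then have "continuous_on ?K (\<lambda>z. F z $ i $ j)" for i j
    by (rule continuous_on_subset[OF _ K])
  then have "continuous_on ?K ?g"
    by (intro continuous_on_sum continuous_on_norm)
  then have "compact (?g ` ?K)" by (intro compact_continuous_image compact_cbox)
  then have "bdd_above (?g ` ?K)" by (intro bounded_imp_bdd_above compact_imp_bounded)
  then obtain B where B: "\<And>z. z \<in> ?K \<Longrightarrow> ?g z \<le> B" by (auto simp: bdd_above_def)
  have nat: "F (z + of_nat n) = F z" if "z \<in> strip \<delta>" for z n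
  proof (induction n)
    case (Suc n)
    have "z + of_nat n \<in> strip \<delta>" using that by (simp add: strip_def)
    then have "F (z + of_nat n + 1) = F (z + of_nat n)"
      by (rule strip_extension_periodic[of \<delta> D F, OF assms])
    moreover have "z + of_nat (Suc n) = z + of_nat n + 1" by simp
    ultimately show ?case using Suc by (simp only:)
  qed simp
  have int: "F (z + of_int k) = F z" if "z \<in> strip \<delta>" for z k
  proof (cases "k \<ge> 0")
    case True
    then show ?thesis using nat[OF that, of "nat k"] by simp
  next
    case False
    have "z + of_int k \<in> strip \<delta>" using that by (simp add: strip_def)
    from nat[OF this, of "nat (- k)"] False show ?thesis by simp
  qed
  have "mat_norm (F z) \<le> B" if z: "z \<in> strip \<delta>" for z
  proof -
    let ?w = "z + of_int (- \<lfloor>Re z\<rfloor>)"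
    have "?w \<in> ?K"
      using z by (simp add: in_cbox_complex_iff strip_def abs_le_iff) linarith
    then have "mat_norm (F ?w) \<le> B" by (rule order_trans[OF mat_norm_le_sum B])
    then show ?thesis using int[OF z, of "- \<lfloor>Re z\<rfloor>"] by simp
  qed
  then show ?thesis by (rule bdd_aboveI2)
qed

lemma is_strip_extension_diff:
  "is_strip_extension \<delta> D F \<Longrightarrow> is_strip_extension \<delta> E G \<Longrightarrow>
     is_strip_extension \<delta> (\<lambda>x. D x - E x) (\<lambda>z. F z - G z)"
  by (auto simp: is_strip_extension_def intro!: analytic_on_diff)

lemma C_omega_diff:
  assumes "D \<in> C_omega \<delta>" "E \<in> C_omega \<delta>"
  shows "(\<lambda>x. D x - E x) \<in> C_omega \<delta>"
proof -
  obtain F G where "is_strip_extension \<delta> D F" "is_strip_extension \<delta> E G"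
    using assms by (auto simp: C_omega_def)
  from is_strip_extension_diff[OF this] show ?thesis
    using assms by (auto simp: C_omega_def)
qed

lemma is_strip_extension_strip_extension:
  assumes "D \<in> C_omega \<delta>"
  shows "is_strip_extension \<delta> D (strip_extension \<delta> D)"
proof -
  have "\<exists>F. is_strip_extension \<delta> D F" using assms by (simp add: C_omega_def)
  then show ?thesis unfolding strip_extension_def by (rule someI_ex)
qed

lemma strip_extension_diff:
  assumes "0 < \<delta>" "D \<in> C_omega \<delta>" "E \<in> C_omega \<delta>" "z \<in> strip \<delta>"
  shows "strip_extension \<delta> (\<lambda>x. D x - E x) z = strip_extension \<delta> D z - strip_extension \<delta> E z"
  by (intro strip_extension_eq is_strip_extension_diff is_strip_extension_strip_extension assms)

lemma mat_norm_le_strip_norm: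
  assumes "0 < \<delta>" "D \<in> C_omega \<delta>" "z \<in> strip \<delta>"
  shows "mat_norm (strip_extension \<delta> D z) \<le> strip_norm \<delta> D"
  unfolding strip_norm_def
proof (rule cSUP_upper[OF assms(3)])
  show "bdd_above ((\<lambda>z. mat_norm (strip_extension \<delta> D z)) ` strip \<delta>)"
    by (rule mat_norm_extension_bounded[OF assms(1) is_strip_extension_strip_extension[OF assms(2)]])
      (use assms(2) in \<open>simp add: C_omega_def\<close>)
qed

lemma strip_norm_le:
  assumes "0 < \<delta>" "\<And>z. z \<in> strip \<delta> \<Longrightarrow> mat_norm (strip_extension \<delta> D z) \<le> B"
  shows "strip_norm \<delta> D \<le> B"
  unfolding strip_norm_def
  using of_real_in_strip[OF assms(1)] assms(2) by (intro cSUP_least) auto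

lemma Metric_space_C_omega:
  assumes \<delta>: "0 < \<delta>"
  shows "Metric_space (C_omega \<delta>) (strip_dist \<delta>)"
proof
  fix D E G :: "real \<Rightarrow> mat2"
  have nonneg: "0 \<le> strip_norm \<delta> H" if "H \<in> C_omega \<delta>" for H
    by (rule order_trans[OF mat_norm_nonneg
          mat_norm_le_strip_norm[OF \<delta> that of_real_in_strip[OF \<delta>, of 0]]])
  show "0 \<le> strip_dist \<delta> D E"
    by (simp add: strip_dist_def nonneg C_omega_diff)
  have "strip_norm \<delta> (\<lambda>x. D x - E x) = strip_norm \<delta> (\<lambda>x. E x - D x)"
    if "D \<in> C_omega \<delta>" "E \<in> C_omega \<delta>"
    unfolding strip_norm_def
  proof (rule SUP_cong[OF refl])
    fix z assume "z \<in> strip \<delta>"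
    then show "mat_norm (strip_extension \<delta> (\<lambda>x. D x - E x) z) =
               mat_norm (strip_extension \<delta> (\<lambda>x. E x - D x) z)"
      using that \<delta> mat_norm_minus[of "strip_extension \<delta> D z - strip_extension \<delta> E z"]
      by (simp add: strip_extension_diff)
  qed
  then show "strip_dist \<delta> D E = strip_dist \<delta> E D" by (simp add: strip_dist_def)
  assume D: "D \<in> C_omega \<delta>" and E: "E \<in> C_omega \<delta>"
  note DE = C_omega_diff[OF D E]
  show "strip_dist \<delta> D E = 0 \<longleftrightarrow> D = E"
  proof
    assume "strip_dist \<delta> D E = 0"
    then have 0: "strip_norm \<delta> (\<lambda>x. D x - E x) = 0" using D E by (simp add: strip_dist_def)
    show "D = E"
    proof
      fix x
      have "mat_norm (strip_extension \<delta> (\<lambda>x. D x - E x) (of_real x)) \<le> 0"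
        using mat_norm_le_strip_norm[OF \<delta> DE of_real_in_strip[OF \<delta>]] 0 by metis
      then have "strip_extension \<delta> (\<lambda>x. D x - E x) (of_real x) = 0"
        by (metis mat_norm_eq_0_iff mat_norm_nonneg order_antisym)
      then show "D x = E x"
        using is_strip_extension_strip_extension[OF DE] unfolding is_strip_extension_def by simp
    qed
  next
    assume "D = E"
    have "strip_norm \<delta> (\<lambda>x. D x - E x) \<le> 0"
      by (rule strip_norm_le[OF \<delta>])
        (use \<open>D = E\<close> D \<delta> strip_extension_diff[OF \<delta> D D] mat_norm_eq_0_iff[of 0] in auto)
    then show "strip_dist \<delta> D E = 0"
      using nonneg[OF DE] D E by (simp add: strip_dist_def)
  qed
  assume G: "G \<in> C_omega \<delta>"
  have "strip_norm \<delta> (\<lambda>x. D x - G x) \<le>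
        strip_norm \<delta> (\<lambda>x. D x - E x) + strip_norm \<delta> (\<lambda>x. E x - G x)"
  proof (rule strip_norm_le[OF \<delta>])
    fix z assume z: "z \<in> strip \<delta>"
    have eq: "strip_extension \<delta> (\<lambda>x. D x - G x) z =
          strip_extension \<delta> (\<lambda>x. D x - E x) z + strip_extension \<delta> (\<lambda>x. E x - G x) z"
      by (simp add: strip_extension_diff \<delta> D E G z)
    show "mat_norm (strip_extension \<delta> (\<lambda>x. D x - G x) z) \<le>
        strip_norm \<delta> (\<lambda>x. D x - E x) + strip_norm \<delta> (\<lambda>x. E x - G x)"
      using mat_norm_triangle[of "strip_extension \<delta> (\<lambda>x. D x - E x) z"
          "strip_extension \<delta> (\<lambda>x. E x - G x) z"]
        mat_norm_le_strip_norm[OF \<delta> DE z]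
        mat_norm_le_strip_norm[OF \<delta> C_omega_diff[OF E G] z]
      unfolding eq by linarith
  qed
  then show "strip_dist \<delta> D G \<le> strip_dist \<delta> D E + strip_dist \<delta> E G"
    using D E G by (simp add: strip_dist_def)
qed

end

theory Submission
  imports Defs
begin

text \<open>
  Let \<open>F\<close> be the extension of \<open>D\<close> to the strip, \<open>L\<^sub>n(y)\<close> the mean of
  \<open>(1/n) log \<parallel>F(z + (n-1)\<beta>) \<dots> F(z)\<parallel>\<close> over the line \<open>Im z = y\<close>, \<open>L(y) = lim L\<^sub>n(y) = inf L\<^sub>n(y)\<close>, and \<open>I(y)\<close>
  the mean of \<open>log \<bar>det F\<bar>\<close>. The two exponents of the theorem are \<open>L(0)\<close> and
  \<open>L(0) - I(0)/2\<close>. Upper semicontinuity in \<open>D\<close> is clear, and since \<open>L\<close> and \<open>I\<close> are convex in \<open>y\<close>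
  with uniform upper bounds, lower semicontinuity at \<open>y = 0\<close> follows from lower semicontinuity at
  arbitrarily small \<open>y > 0\<close>. So one may move to a line \<open>y\<^sub>0\<close> around which \<open>det F\<close> has no zeros.

  There \<open>u\<^sub>n = (1/n) log \<parallel>F(z + (n-1)\<beta>) \<dots> F(z)\<parallel>\<close> is subharmonic and bounded uniformly in \<open>n\<close>, so the energy
  \<open>\<integral> (\<partial>u\<^sub>n/\<partial>x)\<^sup>2 dx\<close> is bounded, independently of \<open>n\<close>, on some line \<open>y\<close> close to \<open>y\<^sub>0\<close>; hence \<open>u\<^sub>n\<close> is
  equicontinuous there. As \<open>u\<^sub>n(z + \<beta>) - u\<^sub>n(z) = O(1/n)\<close> and the orbits of the rotation are dense,
  \<open>u\<^sub>n\<close> is nearly constant on that line. The same holds for \<open>u\<^bsub>2n\<^esub>\<close>, so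
  \<open>\<parallel>A(z + n\<beta>) A(z)\<parallel>\<close>, where \<open>A(z) = F(z + (n-1)\<beta>) \<dots> F(z)\<close>, is almost \<open>\<parallel>A(z + n\<beta>)\<parallel> \<parallel>A(z)\<parallel>\<close> for
  every \<open>z\<close> on the line. If \<open>\<bar>det A\<bar>\<close> is much smaller than \<open>\<parallel>A\<parallel>\<^sup>2\<close>, this forces the norms of all longer
  products to be almost multiplicative, and the condition is stable under perturbation of \<open>F\<close>;
  otherwise \<open>L(y)\<close> is close to its lower bound \<open>I(y)/2\<close>, which is continuous in \<open>F\<close>.
\<close>

subsection \<open>Norms of products of \<open>2 \<times> 2\<close> matrices\<close>

text \<open>On the real line \<open>det F\<close> may vanish. There \<open>u_n\<close> has no lower
  bound uniform in \<open>n\<close>, and the comparison of products over \<open>z\<close> and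
  \<open>z + \<beta>\<close>, which undoes one factor \<open>F\<close>, breaks down. This is why the
  quantitative work happens on lines free of zeros, with convexity in the height as the bridge back.
  The energy estimate selects a line that depends on \<open>n\<close>, whereas \<open>n\<close> must
  be chosen from the convergence at the fixed height \<open>y0\<close>. Convexity closes this gap as
  well: the means of \<open>u_n\<close> are Lipschitz in the height with a constant independent of
  \<open>n\<close>, so \<open>L_n\<close> and \<open>L_2n\<close> differ little on the selected line
  too. Matrices are measured in the Frobenius norm: its square is a sum of squared moduli of
  holomorphic functions, so that \<open>ln\<close> of this sum plus \<open>s > 0\<close> is smooth
  with an explicit nonnegative Laplacian. Letting \<open>s\<close> tend to 0 gives integrability and
  convexity across the zeros without factoring them out.\<close>

lemma norm_mat2_sq: "(norm (A::mat2))\<^sup>2 = (\<Sum>i\<in>UNIV. \<Sum>j\<in>UNIV. (cmod (A $ i $ j))\<^sup>2)"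
  by (simp add: norm_vec_def L2_set_def sum_nonneg)

lemma norm_matrix_mult_le: "norm ((A::mat2) ** (B::mat2)) \<le> norm A * norm B"
proof (rule power2_le_imp_le)
  have *: "(cmod ((A ** B) $ i $ j))\<^sup>2 \<le>
      (\<Sum>k\<in>UNIV. (cmod (A $ i $ k))\<^sup>2) * (\<Sum>k\<in>UNIV. (cmod (B $ k $ j))\<^sup>2)" for i j
  proof -
    have "cmod ((A ** B) $ i $ j) \<le> (\<Sum>k\<in>UNIV. cmod (A $ i $ k) * cmod (B $ k $ j))"
      unfolding matrix_matrix_mult_def by (simp add: norm_sum flip: norm_mult)
    then have "(cmod ((A ** B) $ i $ j))\<^sup>2 \<le> (\<Sum>k\<in>UNIV. cmod (A $ i $ k) * cmod (B $ k $ j))\<^sup>2"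
      by (intro power_mono) auto
    also have "\<dots> \<le> (\<Sum>k\<in>UNIV. (cmod (A $ i $ k))\<^sup>2) * (\<Sum>k\<in>UNIV. (cmod (B $ k $ j))\<^sup>2)"
      by (rule Cauchy_Schwarz_ineq_sum)
    finally show ?thesis .
  qed
  have "(norm (A ** B))\<^sup>2 \<le> (\<Sum>i\<in>UNIV. \<Sum>j\<in>UNIV.
      (\<Sum>k\<in>UNIV. (cmod (A $ i $ k))\<^sup>2) * (\<Sum>k\<in>UNIV. (cmod (B $ k $ j))\<^sup>2))"
    unfolding norm_mat2_sq by (intro sum_mono *)
  also have "\<dots> = (norm A)\<^sup>2 * (norm B)\<^sup>2"
    unfolding norm_mat2_sq by (simp add: sum_2 algebra_simps)
  finally show "(norm (A ** B))\<^sup>2 \<le> (norm A * norm B)\<^sup>2" by (simp add: power_mult_distrib)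
qed simp

lemma norm_mat_1: "norm (mat 1 :: mat2) = sqrt 2"
proof -
  have "(norm (mat 1 :: mat2))\<^sup>2 = 2"
    unfolding norm_mat2_sq by (simp add: sum_2 mat_def)
  then show ?thesis by (metis norm_ge_zero real_sqrt_unique)
qed

lemma det_le_norm_sq: "2 * cmod (det (A::mat2)) \<le> (norm A)\<^sup>2"
proof -
  have "cmod (det A) \<le> cmod (A$1$1) * cmod (A$2$2) + cmod (A$1$2) * cmod (A$2$1)"
    unfolding det_2 using norm_triangle_ineq4[of "A$1$1 * A$2$2" "A$1$2 * A$2$1"] by (simp add: norm_mult)
  moreover have "2 * (cmod (A$1$1) * cmod (A$2$2)) \<le> (cmod (A$1$1))\<^sup>2 + (cmod (A$2$2))\<^sup>2"
    using sum_squares_bound[of "cmod (A$1$1)" "cmod (A$2$2)"] by simp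
  moreover have "2 * (cmod (A$1$2) * cmod (A$2$1)) \<le> (cmod (A$1$2))\<^sup>2 + (cmod (A$2$1))\<^sup>2"
    using sum_squares_bound[of "cmod (A$1$2)" "cmod (A$2$1)"] by simp
  ultimately show ?thesis unfolding norm_mat2_sq by (simp add: sum_2)
qed

text \<open>\<open>C\<close> is the adjugate of \<open>B\<close>: \<open>A ** B ** C\<close> is
  \<open>det B\<close> times \<open>A\<close>, and for 2 by 2 matrices the adjugate has the same
  Frobenius norm as \<open>B\<close>.\<close>

lemma norm_mult_det_right_le: "norm (A::mat2) * cmod (det B) \<le> norm (A ** B) * norm B"
proof -
  define C :: mat2 where "C = (\<chi> i j. if i = j then (if i = 1 then B$2$2 else B$1$1) else - B$i$j)"
  have C: "C$1$1 = B$2$2" "C$2$2 = B$1$1" "C$1$2 = - B$1$2" "C$2$1 = - B$2$1"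
    by (auto simp: C_def)
  have "(A ** B) ** C = (\<chi> i j. A $ i $ j * det B)"
    by (simp add: vec_eq_iff forall_2 matrix_matrix_mult_def sum_2 C det_2 algebra_simps)
  moreover have "norm (\<chi> i j. A $ i $ j * det B) = norm A * cmod (det B)"
  proof -
    have "(norm (\<chi> i j. A $ i $ j * det B))\<^sup>2 = (norm A * cmod (det B))\<^sup>2"
      unfolding power_mult_distrib norm_mat2_sq by (simp add: sum_2 norm_mult power_mult_distrib algebra_simps)
    then show ?thesis by (simp add: power2_eq_iff_nonneg)
  qed
  moreover have "norm C = norm B"
  proof -
    have "(norm C)\<^sup>2 = (norm B)\<^sup>2" unfolding norm_mat2_sq by (simp add: sum_2 C)
    then show ?thesis by (simp add: power2_eq_iff_nonneg)
  qed
  ultimately show ?thesis using norm_matrix_mult_le[of "A ** B" C] by simp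
qed

lemma norm_transpose_mat2: "norm (transpose (A::mat2)) = norm A"
proof -
  have "(norm (transpose A))\<^sup>2 = (norm A)\<^sup>2" unfolding norm_mat2_sq by (simp add: sum_2 transpose_def)
  then show ?thesis by (simp add: power2_eq_iff_nonneg)
qed

lemma norm_mult_det_left_le: "cmod (det A) * norm (B::mat2) \<le> norm A * norm (A ** B)"
  using norm_mult_det_right_le[of "transpose B" "transpose A"]
  by (simp add: norm_transpose_mat2 mult.commute flip: matrix_transpose_mul)

lemma L2_set_UNIV_4:
  "(L2_set f (UNIV :: (2 \<times> 2 \<times> 2 \<times> 2) set))\<^sup>2 =
    (\<Sum>i\<in>UNIV. \<Sum>k\<in>UNIV. \<Sum>l\<in>UNIV. \<Sum>j\<in>UNIV. (f (i, k, l, j))\<^sup>2)"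
proof -
  have "(L2_set f (UNIV :: (2 \<times> 2 \<times> 2 \<times> 2) set))\<^sup>2 = (\<Sum>x\<in>UNIV. (f x)\<^sup>2)"
    by (simp add: L2_set_def sum_nonneg)
  then show ?thesis
    unfolding UNIV_Times_UNIV[symmetric] sum.cartesian_product by (simp add: case_prod_unfold)
qed

text \<open>The Frobenius norm is multiplicative on tensor products, however the four indices are
  distributed over the two factors. The three distributions are those of the three terms in
  \<open>norm_mult_mult_ge\<close>.\<close>

lemma L2_set_mat2_tensor:
  fixes X Y :: mat2
  shows "L2_set (\<lambda>(i, k, l, j). cmod (X $ i $ k) * cmod (Y $ l $ j)) UNIV = norm X * norm Y"
    and "L2_set (\<lambda>(i, k, l, j). cmod (X $ i $ j) * cmod (Y $ l $ k)) UNIV = norm X * norm Y"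
    and "L2_set (\<lambda>(i, k, l, j). cmod (X $ i $ l) * cmod (Y $ k $ j)) UNIV = norm X * norm Y"
  by (rule power2_eq_imp_eq; simp add: L2_set_UNIV_4 power_mult_distrib norm_mat2_sq sum_2 algebra_simps)+

text \<open>The \<open>2 \<times> 2\<close> minors of \<open>B\<close> measure how far \<open>(A B) \<otimes> (B C)\<close> is from \<open>(A B C) \<otimes> B\<close>;
  for \<open>B\<close> of rank one the two tensors agree.\<close>

lemma norm_mult_mult_ge:
  fixes A B C :: mat2
  shows "norm (A ** B) * norm (B ** C) \<le>
    norm (A ** B ** C) * norm B + cmod (det B) * (norm A * norm C)"
proof -
  \<comment> \<open>\<open>s\<close> swaps the two indices: \<open>A'\<close> is \<open>A\<close>
    with its columns exchanged, \<open>C'\<close> is \<open>C\<close> with its rows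
    exchanged.\<close>
  define s :: "2 \<Rightarrow> 2" where "s l = (if l = 1 then 2 else 1)" for l
  have s: "s 1 = 2" "s 2 = 1" by (auto simp: s_def)
  define A' C' :: mat2 where "A' = (\<chi> i l. A $ i $ s l)" and "C' = (\<chi> k j. C $ s k $ j)"
  have n: "norm A' = norm A" "norm C' = norm C"
    by (rule power2_eq_imp_eq, unfold norm_mat2_sq, simp_all add: sum_2 A'_def C'_def s)+
  have le: "cmod ((A ** B) $ i $ k * (B ** C) $ l $ j) \<le>
      cmod ((A ** B ** C) $ i $ j * B $ l $ k) + cmod (det B) * (cmod (A' $ i $ l) * cmod (C' $ k $ j))"
    for i k l j
  proof -
    \<comment> \<open>The left side minus \<open>(A ** B ** C) $ i $ j * B $ l $ k\<close> is the
      sum over \<open>p\<close>, \<open>q\<close> of \<open>A $ i $ p * C $ q $ j\<close> times the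
      minor of \<open>B\<close> with rows \<open>p\<close>, \<open>l\<close> and columns
      \<open>k\<close>, \<open>q\<close>. The minor vanishes unless \<open>p = s l\<close> and
      \<open>q = s k\<close>.\<close>
    have "(A ** B) $ i $ k * (B ** C) $ l $ j = (A ** B ** C) $ i $ j * B $ l $ k
        + (if l = k then -1 else 1) * (det B * (A' $ i $ l * C' $ k $ j))"
      using exhaust_2[of l] exhaust_2[of k]
      by (elim disjE; simp add: matrix_matrix_mult_def sum_2 det_2 A'_def C'_def s algebra_simps)
    moreover have "cmod ((if l = k then -1 else 1) * (det B * (A' $ i $ l * C' $ k $ j)))
        = cmod (det B) * (cmod (A' $ i $ l) * cmod (C' $ k $ j))" by (simp add: norm_mult)
    ultimately show ?thesis by (metis norm_triangle_ineq)
  qed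
  have "norm (A ** B) * norm (B ** C) =
      L2_set (\<lambda>(i, k, l, j). cmod ((A ** B) $ i $ k) * cmod ((B ** C) $ l $ j)) UNIV"
    by (simp add: L2_set_mat2_tensor)
  also have "\<dots> \<le> L2_set (\<lambda>x. (case x of (i, k, l, j) \<Rightarrow> cmod ((A ** B ** C) $ i $ j) * cmod (B $ l $ k))
      + (case x of (i, k, l, j) \<Rightarrow> cmod (det B) * (cmod (A' $ i $ l) * cmod (C' $ k $ j)))) UNIV"
    using le by (intro L2_set_mono) (auto simp: norm_mult)
  also have "\<dots> \<le> L2_set (\<lambda>(i, k, l, j). cmod ((A ** B ** C) $ i $ j) * cmod (B $ l $ k)) UNIV
      + L2_set (\<lambda>(i, k, l, j). cmod (det B) * (cmod (A' $ i $ l) * cmod (C' $ k $ j))) UNIV"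
    by (rule L2_set_triangle_ineq)
  also have "L2_set (\<lambda>(i, k, l, j). cmod ((A ** B ** C) $ i $ j) * cmod (B $ l $ k)) UNIV
      = norm (A ** B ** C) * norm B" by (rule L2_set_mat2_tensor)
  also have "L2_set (\<lambda>(i, k, l, j). cmod (det B) * (cmod (A' $ i $ l) * cmod (C' $ k $ j))) UNIV
      = cmod (det B) * (norm A * norm C)"
  proof -
    have "L2_set (\<lambda>(i, k, l, j). cmod (det B) * (cmod (A' $ i $ l) * cmod (C' $ k $ j))) UNIV
        = cmod (det B) * L2_set (\<lambda>(i, k, l, j). cmod (A' $ i $ l) * cmod (C' $ k $ j)) UNIV"
      by (subst L2_set_right_distrib) (auto simp: case_prod_unfold)
    also have "L2_set (\<lambda>(i, k, l, j). cmod (A' $ i $ l) * cmod (C' $ k $ j)) UNIV = norm A' * norm C'"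
      by (rule L2_set_mat2_tensor)
    finally show ?thesis by (simp add: n)
  qed
  finally show ?thesis .
qed

text \<open>An avalanche principle. In the inductive step the determinant term of
  \<open>norm_mult_mult_ge\<close> costs at most half of \<open>\<sigma>\<close>: by
  \<open>gap\<close> it carries the factor \<open>(\<sigma> / 2)\<^sup>2\<close>, and the induction
  hypothesis spends one \<open>\<sigma> / 2\<close> on replacing
  \<open>norm (B (Suc j)) * norm (M j)\<close> by \<open>norm (M (Suc j))\<close>. So the loss per
  factor stays \<open>\<sigma> / 2\<close>, however long the product.\<close>

lemma norm_product_ge:
  fixes B M :: "nat \<Rightarrow> mat2"
  assumes M0: "M 0 = B 0" and MSuc: "\<And>j. M (Suc j) = B (Suc j) ** M j"
    and \<sigma>: "0 < \<sigma>"
    and pos: "\<And>j. B j \<noteq> 0"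
    and pair: "\<And>j. \<sigma> * (norm (B (Suc j)) * norm (B j)) \<le> norm (B (Suc j) ** B j)"
    and gap: "\<And>j. 4 * cmod (det (B j)) \<le> \<sigma>\<^sup>2 * (norm (B j))\<^sup>2"
  shows "(\<sigma> / 2) ^ m * (\<Prod>j\<le>m. norm (B j)) \<le> norm (M m)"
proof -
  have step: "\<sigma> / 2 * (norm (B (Suc j)) * norm (M j)) \<le> norm (M (Suc j))" for j
  proof (induction j)
    case 0
    have "\<sigma> / 2 * (norm (B (Suc 0)) * norm (B 0)) \<le> \<sigma> * (norm (B (Suc 0)) * norm (B 0))"
      using \<sigma> by (intro mult_right_mono) auto
    also note pair[of 0]
    finally show ?case by (simp only: M0 MSuc)
  next
    case (Suc j)
    let ?b = "norm (B (Suc j))" and ?b' = "norm (B (Suc (Suc j)))" and ?m = "norm (M (Suc j))"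
    have b: "?b > 0" using pos by simp
    have "\<sigma> * (?b' * ?b) * ?m \<le> norm (B (Suc (Suc j)) ** B (Suc j)) * ?m"
      by (intro mult_right_mono pair) auto
    also have "\<dots> \<le> norm (M (Suc (Suc j))) * ?b + cmod (det (B (Suc j))) * (?b' * norm (M j))"
      using norm_mult_mult_ge[of "B (Suc (Suc j))" "B (Suc j)" "M j"]
      by (simp add: MSuc matrix_mul_assoc)
    also have "cmod (det (B (Suc j))) * (?b' * norm (M j)) \<le> \<sigma>\<^sup>2 / 4 * ?b\<^sup>2 * (?b' * norm (M j))"
      using gap[of "Suc j"] by (intro mult_right_mono) auto
    also have "\<dots> = \<sigma> / 2 * ?b * ?b' * (\<sigma> / 2 * (?b * norm (M j)))"
      by (simp add: power2_eq_square)
    also have "\<dots> \<le> \<sigma> / 2 * ?b * ?b' * ?m"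
      using Suc \<sigma> by (intro mult_left_mono) auto
    finally have "?b * (\<sigma> / 2 * (?b' * ?m)) \<le> ?b * norm (M (Suc (Suc j)))"
      by (simp add: algebra_simps)
    with b show ?case by simp
  qed
  show ?thesis
  proof (induction m)
    case 0
    then show ?case by (simp add: M0)
  next
    case (Suc m)
    have "(\<sigma> / 2) ^ Suc m * (\<Prod>j\<le>Suc m. norm (B j))
        = \<sigma> / 2 * (norm (B (Suc m)) * ((\<sigma> / 2) ^ m * (\<Prod>j\<le>m. norm (B j))))"
      by (simp add: prod.atMost_Suc)
    also have "\<dots> \<le> \<sigma> / 2 * (norm (B (Suc m)) * norm (M m))"
      using Suc \<sigma> by (intro mult_left_mono) auto
    also have "\<dots> \<le> norm (M (Suc m))" by (rule step)
    finally show ?case .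
  qed
qed

section \<open>Comparison of the operator norm with the Frobenius norm\<close>

lemma mat_norm_le_norm: "mat_norm A \<le> norm A"
  unfolding mat_norm_def
proof (rule onorm_bound)
  fix v :: "complex^2"
  have "(norm (A *v v))\<^sup>2 = (\<Sum>i\<in>UNIV. (cmod (\<Sum>j\<in>UNIV. A $ i $ j * v $ j))\<^sup>2)"
    by (simp add: norm_vec_def L2_set_def sum_nonneg matrix_vector_mult_def)
  also have "\<dots> \<le> (\<Sum>i\<in>UNIV. (\<Sum>j\<in>UNIV. (cmod (A $ i $ j))\<^sup>2) * (norm v)\<^sup>2)"
  proof (intro sum_mono)
    fix i :: 2
    have "(cmod (\<Sum>j\<in>UNIV. A $ i $ j * v $ j))\<^sup>2 \<le> (\<Sum>j\<in>UNIV. cmod (A $ i $ j) * cmod (v $ j))\<^sup>2"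
      by (intro power_mono) (auto simp: norm_sum simp flip: norm_mult)
    also have "\<dots> \<le> (\<Sum>j\<in>UNIV. (cmod (A $ i $ j))\<^sup>2) * (\<Sum>j\<in>UNIV. (cmod (v $ j))\<^sup>2)"
      by (rule Cauchy_Schwarz_ineq_sum)
    also have "(\<Sum>j\<in>UNIV. (cmod (v $ j))\<^sup>2) = (norm v)\<^sup>2"
      by (simp add: norm_vec_def L2_set_def sum_nonneg)
    finally show "(cmod (\<Sum>j\<in>UNIV. A $ i $ j * v $ j))\<^sup>2 \<le> (\<Sum>j\<in>UNIV. (cmod (A $ i $ j))\<^sup>2) * (norm v)\<^sup>2" .
  qed
  also have "\<dots> = (norm A * norm v)\<^sup>2"
    by (simp add: power_mult_distrib norm_mat2_sq sum_distrib_right)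
  finally show "norm (A *v v) \<le> norm A * norm v" by (rule power2_le_imp_le) simp
qed simp

text \<open>Each of the two columns of \<open>A\<close> is the image of a unit vector, so its length
  is at most \<open>mat_norm A\<close>.\<close>

lemma norm_le_mat_norm: "norm A \<le> sqrt 2 * mat_norm A"
proof (rule power2_le_imp_le)
  have col: "(\<Sum>i\<in>UNIV. (cmod (A $ i $ j))\<^sup>2) \<le> (mat_norm A)\<^sup>2" for j
  proof -
    have "(\<Sum>i\<in>UNIV. (cmod (A $ i $ j))\<^sup>2) = (norm (A *v axis j 1))\<^sup>2"
      unfolding norm_vec_def L2_set_def
      by (subst real_sqrt_pow2) (auto simp: sum_nonneg matrix_vector_mult_def axis_def if_distrib cong: if_cong)
    also have "\<dots> \<le> (mat_norm A * norm (axis j 1 :: complex^2))\<^sup>2"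
      unfolding mat_norm_def
      by (intro power_mono onorm bounded_linear_matrix_vector_mult) auto
    finally show ?thesis by simp
  qed
  have "(norm A)\<^sup>2 = (\<Sum>j\<in>UNIV. \<Sum>i\<in>UNIV. (cmod (A $ i $ j))\<^sup>2)"
    unfolding norm_mat2_sq by (rule sum.swap)
  also have "\<dots> \<le> (\<Sum>j\<in>(UNIV::2 set). (mat_norm A)\<^sup>2)" by (intro sum_mono col)
  finally show "(norm A)\<^sup>2 \<le> (sqrt 2 * mat_norm A)\<^sup>2" by (simp add: power_mult_distrib)
qed (simp add: mat_norm_nonneg)

lemma cmod_entry_le_norm: "cmod ((A::mat2) $ i $ j) \<le> norm A"
  by (meson Finite_Cartesian_Product.norm_nth_le order_trans)

lemma norm_det_diff_le:
  "cmod (det (A::mat2) - det B) \<le> 2 * (norm A + norm B) * norm (A - B)"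
proof -
  have *: "cmod (a * b - c * d) \<le> (p + q) * e"
    if "cmod a \<le> p" "cmod d \<le> q" "cmod (b - d) \<le> e" "cmod (a - c) \<le> e" for a b c d :: complex and p q e
  proof -
    have "a * b - c * d = a * (b - d) + (a - c) * d" by (simp add: algebra_simps)
    then have "cmod (a * b - c * d) \<le> cmod a * cmod (b - d) + cmod (a - c) * cmod d"
      by (metis norm_mult norm_triangle_ineq)
    also have "\<dots> \<le> p * e + e * q"
      using that by (intro add_mono mult_mono) (auto intro: order_trans[OF norm_ge_zero])
    finally show ?thesis by (simp add: algebra_simps)
  qed
  have e: "cmod (A $ i $ j - B $ i $ j) \<le> norm (A - B)" for i j
    using cmod_entry_le_norm[of "A - B" i j] by simp
  have "det A - det B = (A$1$1 * A$2$2 - B$1$1 * B$2$2) - (A$1$2 * A$2$1 - B$1$2 * B$2$1)"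
    by (simp add: det_2)
  then have "cmod (det A - det B) \<le> cmod (A$1$1 * A$2$2 - B$1$1 * B$2$2) + cmod (A$1$2 * A$2$1 - B$1$2 * B$2$1)"
    by (metis norm_triangle_ineq4)
  also have "\<dots> \<le> (norm A + norm B) * norm (A - B) + (norm A + norm B) * norm (A - B)"
    by (intro add_mono * cmod_entry_le_norm e)
  finally show ?thesis by (simp add: algebra_simps)
qed

subsection \<open>Convexity, subadditivity and irrational rotations\<close>

text \<open>Chord slopes of a convex function increase. For the upper bound \<open>y\<close> lies
  between \<open>c\<close> and the end point on its side, for the lower bound \<open>c\<close> lies
  between \<open>y\<close> and the opposite end point. The constant depends on \<open>g\<close> only
  through \<open>M\<close>, so one constant serves a whole sequence of means.\<close>

lemma convex_bound_lipschitz: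
  fixes g :: "real \<Rightarrow> real"
  assumes conv: "convex_on {c - R..c + R} g" and R: "R > 0" and M: "\<And>y. y \<in> {c - R..c + R} \<Longrightarrow> \<bar>g y\<bar> \<le> M"
    and y: "\<bar>y - c\<bar> \<le> R"
  shows "\<bar>g y - g c\<bar> \<le> 2 * M / R * \<bar>y - c\<bar>"
proof -
  have main: "\<bar>g (c + s * u) - g c\<bar> \<le> 2 * M / R * u" if s: "s = 1 \<or> s = -1" and u: "0 \<le> u" "u \<le> R" for s u :: real
  proof -
    let ?t = "u / R"
    have t: "0 \<le> ?t" "?t \<le> 1" using u R by auto
    have mem: "c \<in> {c - R..c + R}" "c + s * R \<in> {c - R..c + R}" "c + s * u \<in> {c - R..c + R}" "c - s * R \<in> {c - R..c + R}"
      using s u R by auto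
    have e1: "c + s * u = (1 - ?t) * c + ?t * (c + s * R)" using R by (simp add: field_simps)
    have "g (c + s * u) \<le> (1 - ?t) * g c + ?t * g (c + s * R)"
      unfolding e1 using convex_onD[OF conv, of ?t c "c + s * R"] t mem by simp
    then have "g (c + s * u) - g c \<le> ?t * (g (c + s * R) - g c)" by (simp add: algebra_simps)
    also have "\<dots> \<le> ?t * (2 * M)"
      using M[OF mem(1)] M[OF mem(2)] t by (intro mult_left_mono) auto
    finally have up: "g (c + s * u) - g c \<le> 2 * M / R * u" by (simp add: field_simps)
    \<comment> \<open>The weight that represents \<open>c\<close> as a convex combination of
      \<open>c + s * u\<close> and the opposite end point \<open>c - s * R\<close>.\<close>
    let ?q = "u / (R + u)"
    have q: "0 \<le> ?q" "?q \<le> 1" using u R by auto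
    have e2: "c = (1 - ?q) * (c + s * u) + ?q * (c - s * R)"
    proof -
      define q where "q = ?q"
      have "q * (R + u) = u" using R u by (simp add: q_def)
      moreover have "(1 - q) * (c + s * u) + q * (c - s * R) = c + s * (u - q * (R + u))"
        by (simp add: algebra_simps)
      ultimately show ?thesis by (simp add: q_def)
    qed
    have "g ((1 - ?q) * (c + s * u) + ?q * (c - s * R)) \<le> (1 - ?q) * g (c + s * u) + ?q * g (c - s * R)"
      using convex_onD[OF conv, of ?q "c + s * u" "c - s * R"] q mem by simp
    then have "g c \<le> (1 - ?q) * g (c + s * u) + ?q * g (c - s * R)" using e2 by simp
    then have "g c - g (c + s * u) \<le> ?q * (g (c - s * R) - g (c + s * u))" by (simp add: algebra_simps)
    also have "\<dots> \<le> ?q * (2 * M)"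
      using M[OF mem(3)] M[OF mem(4)] q by (intro mult_left_mono) auto
    also have "\<dots> \<le> ?t * (2 * M)"
      using M[OF mem(1)] u R by (intro mult_right_mono) (auto simp: field_simps)
    finally have "g c - g (c + s * u) \<le> 2 * M / R * u" by (simp add: field_simps)
    with up show ?thesis by (simp add: abs_le_iff)
  qed
  show ?thesis
  proof (cases "y \<ge> c")
    case True
    then show ?thesis using main[of 1 "y - c"] y by simp
  next
    case False
    then show ?thesis using main[of "-1" "c - y"] y by simp
  qed
qed

text \<open>Two applications of convexity, along \<open>0 < y < b\<close> for the perturbed function and along
  \<open>- b < 0 < y\<close> for the original one, move lower semicontinuity at small \<open>y > 0\<close> to \<open>0\<close>.\<close>

lemma convex_lower_bound_at_0:
  fixes g :: "real \<Rightarrow> real"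
  assumes g: "convex_on {-b..b} g" and b: "b > 0" and gM: "\<And>y. y \<in> {-b..b} \<Longrightarrow> g y \<le> M"
    and e: "e > 0"
  shows "\<exists>\<rho>>0. \<rho> < b \<and> (\<forall>y h. 0 < y \<longrightarrow> y < \<rho> \<longrightarrow> convex_on {-b..b} h \<longrightarrow> h b \<le> M \<longrightarrow>
      g y - e \<le> h y \<longrightarrow> g 0 - 2 * e \<le> h 0)"
proof -
  \<comment> \<open>Convexity of \<open>g\<close> on \<open>- b < 0 < y\<close> gives the inner
    quotient as a lower bound of \<open>g y\<close>; subtracting \<open>e\<close> passes to
    \<open>h y\<close>, and convexity of \<open>h\<close> on \<open>0 < y < b\<close>, solved for
    \<open>h 0\<close>, gives the outer quotient. As \<open>y\<close> tends to 0 the losses at both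
    ends disappear and \<open>\<Phi> y\<close> tends to \<open>g 0 - e\<close>.\<close>
  define \<Phi> where "\<Phi> y = ((g 0 - y / (y + b) * M) / (1 - y / (y + b)) - e - y / b * M) / (1 - y / b)" for y
  have "(\<Phi> \<longlongrightarrow> ((g 0 - 0 / (0 + b) * M) / (1 - 0 / (0 + b)) - e - 0 / b * M) / (1 - 0 / b)) (at 0)"
    unfolding \<Phi>_def using b by (intro tendsto_intros) auto
  then have "(\<Phi> \<longlongrightarrow> g 0 - e) (at 0)" by simp
  then have "eventually (\<lambda>y. \<Phi> y > g 0 - 2 * e) (at 0)"
    by (rule order_tendstoD) (use e in simp)
  then obtain r where r: "r > 0" "\<And>y. y \<noteq> 0 \<Longrightarrow> \<bar>y\<bar> < r \<Longrightarrow> \<Phi> y > g 0 - 2 * e"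
    unfolding eventually_at by (auto simp: dist_real_def)
  show ?thesis
  proof (intro exI[of _ "min r (b/2)"] conjI allI impI)
    fix y h assume y: "0 < y" "y < min r (b/2)" and h: "convex_on {-b..b} h" "h b \<le> M" "g y - e \<le> h y"
    let ?s = "y / (y + b)" and ?t = "y / b"
    have s: "0 < ?s" "?s < 1" and t: "0 < ?t" "?t < 1" using y b by auto
    have "g ((1 - ?s) * y + ?s * (- b)) \<le> (1 - ?s) * g y + ?s * g (- b)"
      using convex_onD[OF g, of ?s y "-b"] s y b by simp
    moreover have "(1 - ?s) * y + ?s * (- b) = 0" using y b by (simp add: field_simps)
    moreover have "?s * g (- b) \<le> ?s * M" using s b gM[of "-b"] by (intro mult_left_mono) auto
    ultimately have "g 0 - ?s * M \<le> (1 - ?s) * g y" by simp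
    then have gy: "(g 0 - ?s * M) / (1 - ?s) \<le> g y" using s by (simp add: pos_divide_le_eq mult.commute)
    have "h ((1 - ?t) * 0 + ?t * b) \<le> (1 - ?t) * h 0 + ?t * h b"
      using convex_onD[OF h(1), of ?t 0 b] t b by simp
    moreover have "(1 - ?t) * 0 + ?t * b = y" using b by simp
    moreover have "?t * h b \<le> ?t * M" using t h(2) by (intro mult_left_mono) auto
    ultimately have "h y - ?t * M \<le> (1 - ?t) * h 0" by simp
    then have "(g 0 - ?s * M) / (1 - ?s) - e - ?t * M \<le> (1 - ?t) * h 0" using gy h(3) by linarith
    then have "\<Phi> y \<le> h 0" unfolding \<Phi>_def using t by (simp add: pos_divide_le_eq mult.commute)
    then show "g 0 - 2 * e \<le> h 0" using r(2)[of y] y by simp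
  qed (use r b in auto)
qed

text \<open>Fekete's lemma by division of \<open>n\<close> by a good \<open>k\<close> with
  remainder. \<open>a 0\<close> is not constrained (for the means below it is
  \<open>ln (sqrt 2)\<close>), so a zero remainder contributes 0 rather than
  \<open>a 0\<close>.\<close>

lemma Fekete_subadditive:
  fixes a :: "nat \<Rightarrow> real"
  assumes sub: "\<And>m n. 1 \<le> m \<Longrightarrow> 1 \<le> n \<Longrightarrow> a (m + n) \<le> a m + a n"
    and lower: "\<And>n. 1 \<le> n \<Longrightarrow> c * real n \<le> a n"
  shows "\<exists>l. (\<lambda>n. a n / real n) \<longlonglongrightarrow> l \<and> (\<forall>n\<ge>1. l \<le> a n / real n)"
proof -
  define l where "l = Inf ((\<lambda>n. a n / real n) ` {1..})"
  have bdd: "bdd_below ((\<lambda>n. a n / real n) ` {1..})"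
    by (rule bdd_belowI2[of _ c]) (use lower in \<open>auto simp: field_simps\<close>)
  have l: "l \<le> a n / real n" if "1 \<le> n" for n
    unfolding l_def using that by (intro cInf_lower bdd) auto
  have mult: "a (q * k + r) \<le> real q * a k + (if r = 0 then 0 else a r)" if k: "1 \<le> k" and "1 \<le> q * k + r" for q k r
    using that(2)
  proof (induction q)
    case (Suc q)
    show ?case
    proof (cases "q * k + r = 0")
      case True
      then show ?thesis using k by auto
    next
      case False
      then have "a (Suc q * k + r) \<le> a k + a (q * k + r)" using sub[of k "q * k + r"] k by (simp add: add.assoc Suc_le_eq)
      moreover have "a (q * k + r) \<le> real q * a k + (if r = 0 then 0 else a r)"
        using Suc.IH False by simp
      ultimately show ?thesis by (simp add: algebra_simps split del: if_split)
    qed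
  qed auto
  have "(\<lambda>n. a n / real n) \<longlonglongrightarrow> l"
  proof (rule LIMSEQ_I)
    fix e :: real assume e: "e > 0"
    have "l < l + e/2" using e by simp
    then obtain k where k: "1 \<le> k" "a k / real k < l + e/2"
      unfolding l_def using cInf_lessD[of "(\<lambda>n. a n / real n) ` {1..}" "l + e/2"] by (auto simp: l_def)
    \<comment> \<open>A bound for the contribution of every remainder \<open>r < k\<close>,
      independent of \<open>n\<close>; it disappears after division by \<open>n\<close>.\<close>
    define B where "B = (\<Sum>r<k. \<bar>a r\<bar>) + k * \<bar>a k / real k\<bar>"
    have B: "(if r = 0 then 0 else a r) - real r * (a k / real k) \<le> B" if "r < k" for r
    proof -
      have "\<bar>a r\<bar> \<le> (\<Sum>r<k. \<bar>a r\<bar>)" using that by (intro member_le_sum) auto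
      moreover have "\<bar>real r * (a k / real k)\<bar> \<le> k * \<bar>a k / real k\<bar>"
        unfolding abs_mult using that by (intro mult_right_mono) auto
      ultimately show ?thesis unfolding B_def by (cases "r = 0"; simp only: if_True if_False refl; linarith)
    qed
    obtain N :: nat where N: "real N > 2 * \<bar>B\<bar> / e" using reals_Archimedean2 by blast
    show "\<exists>no. \<forall>n\<ge>no. norm (a n / real n - l) < e"
    proof (intro exI[of _ "Suc N"] allI impI)
      fix n assume n: "Suc N \<le> n"
      have "a n \<le> real (n div k) * a k + (if n mod k = 0 then 0 else a (n mod k))"
        using mult[of k "n div k" "n mod k"] k n by simp
      also have "real (n div k) * a k = (real n - real (n mod k)) * (a k / real k)"
      proof -
        have "real n = real (n div k) * real k + real (n mod k)"
          by (metis div_mult_mod_eq of_nat_add of_nat_mult)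
        then show ?thesis using k by simp
      qed
      finally have "a n \<le> real n * (a k / real k) + B"
        using B[of "n mod k"] k by (simp add: algebra_simps)
      also have "real n * (a k / real k) \<le> real n * (l + e/2)"
        using k by (intro mult_left_mono) auto
      finally have "a n / real n \<le> l + e/2 + B / real n" using n by (simp add: field_simps)
      moreover have "B / real n < e/2"
      proof -
        have "2 * \<bar>B\<bar> < e * real N" using N e by (simp add: field_simps)
        also have "\<dots> \<le> e * real n" using n e by (intro mult_left_mono) auto
        finally show ?thesis using n by (simp add: field_simps)
      qed
      moreover have "l \<le> a n / real n" using l n by simp
      ultimately show "norm (a n / real n - l) < e" unfolding real_norm_def by linarith
    qed
  qed
  with l show ?thesis by blast
qed

section \<open>Irrational rotations and periodic functions\<close>

lemma diophantine_irrational: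
  assumes "diophantine \<beta>"
  shows "\<beta> \<notin> \<rat>"
proof
  assume "\<beta> \<in> \<rat>"
  then obtain p q where pq: "q \<noteq> 0" "\<beta> = real_of_int p / real_of_int q"
    by (auto elim!: Rats_cases' simp: Rats_eq_int_div_int)
  obtain b r where b: "b > 0" and *: "\<And>j::int. j \<noteq> 0 \<Longrightarrow> \<bar>sin (2 * pi * real_of_int j * \<beta>)\<bar> > b / \<bar>real_of_int j\<bar> powr r"
    using assms unfolding diophantine_def by blast
  \<comment> \<open>At \<open>j = q\<close> the sine vanishes, against its positive lower
    bound.\<close>
  have "2 * pi * real_of_int q * \<beta> = real_of_int (2 * p) * pi" using pq by simp
  then have "sin (2 * pi * real_of_int q * \<beta>) = 0" by (metis sin_npi_int mult.commute)
  moreover have "b / \<bar>real_of_int q\<bar> powr r > 0" using b pq by simp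
  ultimately show False using *[OF pq(1)] by simp
qed

lemma periodic_add_of_int:
  assumes "\<And>x::real. g (x + 1) = g x"
  shows "g (x + real_of_int k) = g x"
proof (induction k rule: int_induct[of _ 0])
  case (step1 i) then show ?case using assms[of "x + real_of_int i"] by (simp add: algebra_simps)
next
  case (step2 i) then show ?case using assms[of "x + real_of_int (i - 1)"] by (simp add: algebra_simps)
qed simp

lemma has_integral_periodic_shift:
  fixes g :: "real \<Rightarrow> real"
  assumes per: "\<And>x. g (x + 1) = g x" and int: "g integrable_on {0..1}"
  shows "((\<lambda>x. g (x + c)) has_integral integral {0..1} g) {0..1}"
proof -
  define f where "f = frac c"
  have f: "0 \<le> f" "f \<le> 1" unfolding f_def using frac_lt_1[of c] by (auto intro: less_imp_le)
  have c: "g (x + c) = g (f + x)" for x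
    using periodic_add_of_int[of g "f + x" "\<lfloor>c\<rfloor>"] per unfolding f_def frac_def by (simp add: add.commute)
  have sub: "g integrable_on {0..f}" "g integrable_on {f..1}"
    using int f by (auto elim!: integrable_on_subinterval)
  have "(g \<circ> (+) 1) = g" using per by (auto simp: add.commute)
  with has_integral_shift_Icc_real[of g 1 "integral {0..f} g" 0 f] sub(1)
  have "(g has_integral integral {0..f} g) {1..f + 1}" by (simp add: has_integral_integral)
  moreover have "(g has_integral integral {f..1} g) {f..1}" using sub(2) by (simp add: has_integral_integral)
  ultimately have "(g has_integral (integral {f..1} g + integral {0..f} g)) {f..f + 1}"
    using f by (intro has_integral_combine[of f 1]) auto
  moreover have "integral {f..1} g + integral {0..f} g = integral {0..1} g"
    using Henstock_Kurzweil_Integration.integral_combine[of 0 f 1 g] f int by simp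
  ultimately have "((g \<circ> (+) f) has_integral integral {0..1} g) {0..1}"
    using has_integral_shift_Icc_real[of g f _ 0 1] by (simp add: add.commute)
  then show ?thesis by (simp add: c o_def)
qed

text \<open>Cauchy-Schwarz in linearized form: \<open>\<bar>w'\<bar>\<close> is at most
  \<open>\<theta> * (w')\<^sup>2 + 1 / \<theta>\<close>, integrated over \<open>{a..b}\<close>. An
  interval of length at most 1 lies in two consecutive periods, whence \<open>2 * C\<close>. The
  free \<open>\<theta>\<close> is later made small against \<open>C\<close>, and
  \<open>b - a\<close> small against \<open>\<theta>\<close>.\<close>

lemma integral_bounded_energy_diff_le:
  fixes w w' :: "real \<Rightarrow> real"
  assumes deriv: "\<And>x. (w has_real_derivative w' x) (at x)" and cont: "continuous_on UNIV w'"
    and per: "\<And>x. w' (x + 1) = w' x"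
    and V: "integral {0..1} (\<lambda>x. (w' x)\<^sup>2) \<le> C" and ab: "a \<le> b" "b \<le> a + 1" and \<theta>: "\<theta> > 0"
  shows "\<bar>w b - w a\<bar> \<le> \<theta> * (2 * C) + (b - a) / \<theta>"
proof -
  have int: "(\<lambda>x. (w' x)\<^sup>2) integrable_on {u..v}" "w' integrable_on {u..v}" for u v
    using cont by (intro integrable_continuous_interval continuous_intros; auto intro: continuous_on_subset)+
  have int': "(\<lambda>x. \<theta> * (w' x)\<^sup>2) integrable_on {u..v}" for u v
    using cont by (intro integrable_continuous_interval continuous_intros; auto intro: continuous_on_subset)+
  have shift: "integral {u + real_of_int k..v + real_of_int k} (\<lambda>x. (w' x)\<^sup>2) = integral {u..v} (\<lambda>x. (w' x)\<^sup>2)" for u v k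
    using integral_shift_Icc_real[of u v "\<lambda>x. (w' x)\<^sup>2" "real_of_int k"]
    by (simp add: o_def add.commute[of "real_of_int k"] periodic_add_of_int[of w', OF per])
  have sub: "integral {a..b} (\<lambda>x. (w' x)\<^sup>2) \<le> 2 * C"
  proof -
    define k where "k = \<lfloor>a\<rfloor>"
    have k: "real_of_int k \<le> a" "a < real_of_int k + 1" unfolding k_def by linarith+
    have "integral {a..b} (\<lambda>x. (w' x)\<^sup>2) \<le> integral {real_of_int k..real_of_int k + 2} (\<lambda>x. (w' x)\<^sup>2)"
      using k ab by (intro integral_subset_le int) auto
    also have "\<dots> = integral {real_of_int k..real_of_int k + 1} (\<lambda>x. (w' x)\<^sup>2) + integral {real_of_int k + 1..real_of_int k + 2} (\<lambda>x. (w' x)\<^sup>2)"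
      by (rule Henstock_Kurzweil_Integration.integral_combine[symmetric]) (auto simp: int)
    also have "\<dots> = 2 * integral {0..1} (\<lambda>x. (w' x)\<^sup>2)"
      using shift[of 0 k 1] shift[of 0 "k + 1" 1] by (simp add: algebra_simps)
    finally show ?thesis using V by simp
  qed
  have "(w' has_integral (w b - w a)) {a..b}"
    using ab deriv by (intro fundamental_theorem_of_calculus)
      (auto simp: has_real_derivative_iff_has_vector_derivative[symmetric] intro: has_field_derivative_at_within)
  then have "w b - w a = integral {a..b} w'" by (simp add: integral_unique)
  then have "\<bar>w b - w a\<bar> \<le> integral {a..b} (\<lambda>x. \<theta> * (w' x)\<^sup>2 + 1 / \<theta>)"
  proof -
    have "norm (integral {a..b} w') \<le> integral {a..b} (\<lambda>x. \<theta> * (w' x)\<^sup>2 + 1 / \<theta>)"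
    proof (rule integral_norm_bound_integral)
      show "(\<lambda>x. \<theta> * (w' x)\<^sup>2 + 1 / \<theta>) integrable_on {a..b}"
        using int' by (intro integrable_add) auto
      fix x
      have "0 \<le> (sqrt \<theta> * \<bar>w' x\<bar> - 1 / sqrt \<theta>)\<^sup>2" by simp
      also have "\<dots> = \<theta> * (w' x)\<^sup>2 + 1 / \<theta> - 2 * \<bar>w' x\<bar>"
        using \<theta> by (simp add: power2_diff power_mult_distrib power_divide)
      finally show "norm (w' x) \<le> \<theta> * (w' x)\<^sup>2 + 1 / \<theta>" by simp
    qed (rule int)
    with \<open>w b - w a = integral {a..b} w'\<close> show ?thesis by simp
  qed
  also have "\<dots> = \<theta> * integral {a..b} (\<lambda>x. (w' x)\<^sup>2) + (b - a) / \<theta>"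
    using ab int' by (subst integral_add) auto
  also have "\<dots> \<le> \<theta> * (2 * C) + (b - a) / \<theta>" using sub \<theta> by simp
  finally show ?thesis .
qed

text \<open>The point is that \<open>K\<close> is common to all targets \<open>t\<close>: the
  finitely many grid points of spacing \<open>r / 2\<close> in the unit interval are each hit up to
  \<open>r / 2\<close>, and \<open>K\<close> is the largest of these hitting times.\<close>

lemma irrational_orbit_dense:
  fixes \<beta> :: real
  assumes \<beta>: "\<beta> \<notin> \<rat>" and r: "r > 0"
  shows "\<exists>K::nat. \<forall>t. \<exists>k\<le>K. \<exists>h::int. \<bar>real k * \<beta> - real_of_int h - t\<bar> \<le> r"
proof -
  have "\<exists>k::nat. \<exists>h::int. \<bar>real k * \<beta> - real_of_int h - t\<bar> \<le> r / 2" for t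
  proof -
    obtain h k where "k > 0" "\<bar>of_int k * \<beta> - of_int h - t\<bar> < r / 2"
      using sequence_of_fractional_parts_is_dense[OF \<beta> half_gt_zero[OF r]] by metis
    then show ?thesis by (intro exI[of _ "nat k"] exI[of _ h]) auto
  qed
  then obtain k h where kh: "\<And>t. \<bar>real (k t :: nat) * \<beta> - real_of_int (h t :: int) - t\<bar> \<le> r / 2" by metis
  obtain m :: nat where m: "real m > 2 / r" using reals_Archimedean2 by blast
  define K where "K = Max ((\<lambda>i. k (real i * (r / 2))) ` {..m})"
  show ?thesis
  proof (rule exI[of _ K], rule allI)
    fix t
    define i where "i = nat \<lfloor>frac t / (r / 2)\<rfloor>"
    have i: "real i \<le> frac t / (r / 2)" "frac t / (r / 2) < real i + 1"
      unfolding i_def using r frac_ge_0[of t] by (auto simp: of_nat_nat) 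
    have "frac t / (r / 2) < 2 / r" using frac_lt_1[of t] r by (simp add: field_simps)
    with i m have "i \<le> m" by linarith
    then have K: "k (real i * (r / 2)) \<le> K" unfolding K_def by (intro Max_ge) auto
    have "\<bar>real i * (r / 2) - frac t\<bar> \<le> r / 2" using i r by (simp add: field_simps abs_le_iff)
    moreover have "frac t = t - real_of_int \<lfloor>t\<rfloor>" by (simp add: frac_def)
    ultimately have "\<bar>real (k (real i * (r / 2))) * \<beta> - real_of_int (h (real i * (r / 2)) - \<lfloor>t\<rfloor>) - t\<bar> \<le> r"
      using kh[of "real i * (r / 2)"] unfolding of_int_diff by linarith
    with K show "\<exists>k\<le>K. \<exists>h::int. \<bar>real k * \<beta> - real_of_int h - t\<bar> \<le> r" by blast
  qed
qed

text \<open>Walk from \<open>x\<close> along the orbit for at most \<open>K\<close> steps, each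
  costing \<open>\<tau>\<close>, until the point is within \<open>r\<close> of \<open>y\<close>
  modulo 1; the energy bound covers the remaining distance.\<close>

lemma oscillation_le:
  fixes w w' :: "real \<Rightarrow> real"
  assumes deriv: "\<And>x. (w has_real_derivative w' x) (at x)" and cont: "continuous_on UNIV w'"
    and per: "\<And>x. w (x + 1) = w x" "\<And>x. w' (x + 1) = w' x"
    and V: "integral {0..1} (\<lambda>x. (w' x)\<^sup>2) \<le> C" and \<theta>: "\<theta> > 0"
    and inv: "\<And>x. \<bar>w (x + \<beta>) - w x\<bar> \<le> \<tau>"
    and r: "r \<le> 1" and K: "\<And>t. \<exists>k\<le>K. \<exists>h::int. \<bar>real k * \<beta> - real_of_int h - t\<bar> \<le> r"
  shows "\<bar>w x - w y\<bar> \<le> real K * \<tau> + (\<theta> * (2 * C) + r / \<theta>)"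
proof -
  obtain k h where kh: "k \<le> K" "\<bar>real k * \<beta> - real_of_int h - (y - x)\<bar> \<le> r" using K by blast
  have \<tau>: "0 \<le> \<tau>" using inv[of 0] by simp
  have "\<bar>w (x + real k * \<beta>) - w x\<bar> \<le> real k * \<tau>" for k
  proof (induction k)
    case (Suc k)
    then show ?case using inv[of "x + real k * \<beta>"] by (simp add: algebra_simps)
  qed simp
  from this[of k] have 1: "\<bar>w (x + real k * \<beta>) - w x\<bar> \<le> real K * \<tau>"
    using kh(1) \<tau> by (meson mult_right_mono of_nat_le_iff order_trans)
  let ?z = "x + real k * \<beta> - real_of_int h"
  have 2: "w (x + real k * \<beta>) = w ?z"
    using periodic_add_of_int[of w ?z h] per by simp
  have zy: "\<bar>?z - y\<bar> \<le> r" using kh(2) by (simp add: algebra_simps)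
  have "\<bar>w ?z - w y\<bar> \<le> \<theta> * (2 * C) + \<bar>?z - y\<bar> / \<theta>"
  proof (cases "?z \<le> y")
    case True
    then show ?thesis
      using integral_bounded_energy_diff_le[OF deriv cont per(2) V, of ?z y \<theta>] zy r \<theta> by simp
  next
    case False
    then show ?thesis
      using integral_bounded_energy_diff_le[OF deriv cont per(2) V, of y ?z \<theta>] zy r \<theta> by simp
  qed
  moreover have "\<bar>?z - y\<bar> / \<theta> \<le> r / \<theta>" using zy \<theta> by (simp add: divide_right_mono)
  ultimately show ?thesis using 1 2 by linarith
qed

subsection \<open>Smooth subharmonic functions on a strip\<close>

text \<open>\<open>w x y\<close> stands for the value at \<open>x + i y\<close>, for \<open>a < y < b\<close>.\<close>

definition smooth_strip ::
  "real \<Rightarrow> real \<Rightarrow> (real \<Rightarrow> real \<Rightarrow> real) \<Rightarrow> (real \<Rightarrow> real \<Rightarrow> real) \<Rightarrow> (real \<Rightarrow> real \<Rightarrow> real) \<Rightarrow>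
    (real \<Rightarrow> real \<Rightarrow> real) \<Rightarrow> (real \<Rightarrow> real \<Rightarrow> real) \<Rightarrow> bool" where
  "smooth_strip a b w wx wxx wy wyy \<longleftrightarrow>
     (\<forall>x. \<forall>y\<in>{a<..<b}.
        ((\<lambda>t. w t y) has_real_derivative wx x y) (at x) \<and>
        ((\<lambda>t. wx t y) has_real_derivative wxx x y) (at x) \<and>
        ((\<lambda>t. w x t) has_real_derivative wy x y) (at y) \<and>
        ((\<lambda>t. wy x t) has_real_derivative wyy x y) (at y) \<and>
        w (x + 1) y = w x y \<and> wx (x + 1) y = wx x y) \<and>
     (\<forall>f\<in>{w, wx, wxx, wy, wyy}. continuous_on (UNIV \<times> {a<..<b}) (\<lambda>p. f (fst p) (snd p)))"

lemma smooth_stripI: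
  assumes "\<And>x y. a < y \<Longrightarrow> y < b \<Longrightarrow> ((\<lambda>t. w t y) has_real_derivative wx x y) (at x)"
    and "\<And>x y. a < y \<Longrightarrow> y < b \<Longrightarrow> ((\<lambda>t. wx t y) has_real_derivative wxx x y) (at x)"
    and "\<And>x y. a < y \<Longrightarrow> y < b \<Longrightarrow> ((\<lambda>t. w x t) has_real_derivative wy x y) (at y)"
    and "\<And>x y. a < y \<Longrightarrow> y < b \<Longrightarrow> ((\<lambda>t. wy x t) has_real_derivative wyy x y) (at y)"
    and "\<And>x y. a < y \<Longrightarrow> y < b \<Longrightarrow> w (x + 1) y = w x y"
    and "\<And>x y. a < y \<Longrightarrow> y < b \<Longrightarrow> wx (x + 1) y = wx x y"
    and "continuous_on (UNIV \<times> {a<..<b}) (\<lambda>p. w (fst p) (snd p))"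
    and "continuous_on (UNIV \<times> {a<..<b}) (\<lambda>p. wx (fst p) (snd p))"
    and "continuous_on (UNIV \<times> {a<..<b}) (\<lambda>p. wxx (fst p) (snd p))"
    and "continuous_on (UNIV \<times> {a<..<b}) (\<lambda>p. wy (fst p) (snd p))"
    and "continuous_on (UNIV \<times> {a<..<b}) (\<lambda>p. wyy (fst p) (snd p))"
  shows "smooth_strip a b w wx wxx wy wyy"
  using assms unfolding smooth_strip_def by auto

lemma smooth_stripD:
  assumes "smooth_strip a b w wx wxx wy wyy"
  shows "\<And>x y. a < y \<Longrightarrow> y < b \<Longrightarrow> ((\<lambda>t. w t y) has_real_derivative wx x y) (at x)"
    and "\<And>x y. a < y \<Longrightarrow> y < b \<Longrightarrow> ((\<lambda>t. wx t y) has_real_derivative wxx x y) (at x)"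
    and "\<And>x y. a < y \<Longrightarrow> y < b \<Longrightarrow> ((\<lambda>t. w x t) has_real_derivative wy x y) (at y)"
    and "\<And>x y. a < y \<Longrightarrow> y < b \<Longrightarrow> ((\<lambda>t. wy x t) has_real_derivative wyy x y) (at y)"
    and "\<And>x y. a < y \<Longrightarrow> y < b \<Longrightarrow> w (x + 1) y = w x y"
    and "\<And>x y. a < y \<Longrightarrow> y < b \<Longrightarrow> wx (x + 1) y = wx x y"
    and "continuous_on (UNIV \<times> {a<..<b}) (\<lambda>p. w (fst p) (snd p))"
    and "continuous_on (UNIV \<times> {a<..<b}) (\<lambda>p. wx (fst p) (snd p))"
    and "continuous_on (UNIV \<times> {a<..<b}) (\<lambda>p. wxx (fst p) (snd p))"
    and "continuous_on (UNIV \<times> {a<..<b}) (\<lambda>p. wy (fst p) (snd p))"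
    and "continuous_on (UNIV \<times> {a<..<b}) (\<lambda>p. wyy (fst p) (snd p))"
  using assms unfolding smooth_strip_def by auto

lemma smooth_strip_ln:
  assumes "smooth_strip a b w wx wxx wy wyy" and pos: "\<And>x y. a < y \<Longrightarrow> y < b \<Longrightarrow> w x y > 0"
  shows "smooth_strip a b (\<lambda>x y. ln (w x y)) (\<lambda>x y. wx x y / w x y)
    (\<lambda>x y. (wxx x y * w x y - wx x y * wx x y) / (w x y * w x y)) (\<lambda>x y. wy x y / w x y)
    (\<lambda>x y. (wyy x y * w x y - wy x y * wy x y) / (w x y * w x y))"
proof -
  have pos': "w (fst p) (snd p) \<noteq> 0" "w (fst p) (snd p) > 0" if "p \<in> UNIV \<times> {a<..<b}" for p
    using pos[of "snd p" "fst p"] that by auto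
  note d = smooth_stripD[OF assms(1)]
  show ?thesis
    by (intro smooth_stripI continuous_intros d)
      (use pos pos' in \<open>auto intro!: derivative_eq_intros d simp: d(5,6) less_imp_neq[symmetric]\<close>)
qed

lemma smooth_strip_square:
  assumes "smooth_strip a b w wx wxx wy wyy"
  shows "smooth_strip a b (\<lambda>x y. (w x y)\<^sup>2) (\<lambda>x y. 2 * w x y * wx x y)
    (\<lambda>x y. 2 * wx x y * wx x y + 2 * w x y * wxx x y) (\<lambda>x y. 2 * w x y * wy x y)
    (\<lambda>x y. 2 * wy x y * wy x y + 2 * w x y * wyy x y)"
proof -
  note d = smooth_stripD[OF assms(1)]
  show ?thesis
    by (intro smooth_stripI continuous_intros d)
      (auto intro!: derivative_eq_intros d simp: d(5,6))
qed

lemma smooth_strip_affine: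
  assumes "smooth_strip a b w wx wxx wy wyy"
  shows "smooth_strip a b (\<lambda>x y. c * w x y + e) (\<lambda>x y. c * wx x y) (\<lambda>x y. c * wxx x y)
    (\<lambda>x y. c * wy x y) (\<lambda>x y. c * wyy x y)"
proof -
  note d = smooth_stripD[OF assms(1)]
  show ?thesis
    by (intro smooth_stripI continuous_intros d)
      (auto intro!: derivative_eq_intros d simp: d(5,6))
qed

lemma smooth_strip_sum:
  assumes "finite I" and "\<And>i. i \<in> I \<Longrightarrow> smooth_strip a b (w i) (wx i) (wxx i) (wy i) (wyy i)"
  shows "smooth_strip a b (\<lambda>x y. \<Sum>i\<in>I. w i x y) (\<lambda>x y. \<Sum>i\<in>I. wx i x y) (\<lambda>x y. \<Sum>i\<in>I. wxx i x y)
    (\<lambda>x y. \<Sum>i\<in>I. wy i x y) (\<lambda>x y. \<Sum>i\<in>I. wyy i x y)"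
proof -
  note d = smooth_stripD[OF assms(2)]
  show ?thesis
    by (intro smooth_stripI continuous_on_sum DERIV_sum sum.cong refl d)
qed

section \<open>Means over horizontal lines\<close>

lemma smooth_strip_slice_continuous:
  assumes "continuous_on (UNIV \<times> {a<..<b}) (\<lambda>p. f (fst p) (snd p))" "a < y" "y < b"
  shows "continuous_on S (\<lambda>x. f x y)"
  by (rule continuous_on_compose2[OF assms(1), of _ "\<lambda>t. (t, y)", simplified])
    (use assms(2,3) in \<open>auto intro!: continuous_intros\<close>)

text \<open>Differentiation under the integral gives the mean of \<open>wyy\<close>. As
  \<open>wx\<close> is periodic, \<open>wxx\<close> integrates to 0 over a period and may be added,
  so the second derivative of the mean is the mean of the Laplacian.\<close>

lemma smooth_strip_mean:
  assumes "smooth_strip a b w wx wxx wy wyy"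
  defines "h \<equiv> \<lambda>y. integral {0..1} (\<lambda>x. w x y)"
  shows "\<exists>h'. \<forall>y. a < y \<longrightarrow> y < b \<longrightarrow> (h has_real_derivative h' y) (at y) \<and>
    (h' has_real_derivative integral {0..1} (\<lambda>x. wxx x y + wyy x y)) (at y)"
proof -
  note d = smooth_stripD[OF assms(1)]
  have *: "((\<lambda>y. integral {0..1} (\<lambda>x. f x y)) has_real_derivative integral {0..1} (\<lambda>x. f' x y)) (at y)"
    if f: "\<And>x y. a < y \<Longrightarrow> y < b \<Longrightarrow> ((\<lambda>t. f x t) has_real_derivative f' x y) (at y)"
      and c: "continuous_on (UNIV \<times> {a<..<b}) (\<lambda>p. f (fst p) (snd p))"
        "continuous_on (UNIV \<times> {a<..<b}) (\<lambda>p. f' (fst p) (snd p))"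
      and y: "a < y" "y < b" for f f' :: "real \<Rightarrow> real \<Rightarrow> real" and y
  proof -
    have "((\<lambda>y. integral (cbox 0 1) (\<lambda>x. f x y)) has_real_derivative integral (cbox 0 1) (\<lambda>x. f' x y)) (at y within {a<..<b})"
    proof (rule leibniz_rule_field_derivative[where U = "{a<..<b}"])
      fix x t :: real assume "x \<in> {a<..<b}" "t \<in> cbox 0 1"
      then show "((\<lambda>x. f t x) has_real_derivative f' t x) (at x within {a<..<b})"
        by (intro has_field_derivative_at_within[OF f]) auto
    next
      fix x assume x: "x \<in> {a<..<b}"
      have "continuous_on (cbox 0 1) (\<lambda>t. f t x)"
        by (rule smooth_strip_slice_continuous[OF c(1)]) (use x in auto)
      then show "(\<lambda>t. f t x) integrable_on cbox 0 1" by (rule integrable_continuous)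
    next
      show "continuous_on ({a<..<b} \<times> cbox 0 1) (\<lambda>(x, t). f' t x)"
        unfolding case_prod_unfold
      proof -
        have "continuous_on ({a<..<b} \<times> cbox 0 1) (\<lambda>p. (snd p :: real, fst p :: real))"
          by (intro continuous_intros)
        from continuous_on_compose2[OF c(2) this] show "continuous_on ({a<..<b} \<times> cbox 0 1) (\<lambda>p. f' (snd p) (fst p))"
          by fastforce
      qed
    qed (use y in auto)
    moreover have "at y within {a<..<b} = at y" using y by (intro at_within_open) auto
    ultimately show ?thesis by (simp only: cbox_interval)
  qed
  show ?thesis
  proof (intro exI[of _ "\<lambda>y. integral {0..1} (\<lambda>x. wy x y)"] allI impI conjI)
    fix y assume y: "a < y" "y < b"
    show "(h has_real_derivative integral {0..1} (\<lambda>x. wy x y)) (at y)"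
      unfolding h_def by (rule *) (use y d in auto)
    have "((\<lambda>x. wxx x y) has_integral (wx 1 y - wx 0 y)) {0..1}"
      by (rule fundamental_theorem_of_calculus)
        (use d(2) y in \<open>auto simp: has_real_derivative_iff_has_vector_derivative[symmetric] intro: has_field_derivative_at_within\<close>)
    moreover have "wx 1 y = wx 0 y" using d(6)[OF y, of 0] by simp
    ultimately have "((\<lambda>x. wxx x y) has_integral 0) {0..1}" by simp
    moreover have "(\<lambda>x. wyy x y) integrable_on {0..1}"
      by (intro integrable_continuous_interval smooth_strip_slice_continuous[OF d(11)] y)
    ultimately have "integral {0..1} (\<lambda>x. wxx x y + wyy x y) = integral {0..1} (\<lambda>x. wyy x y)"
      by (subst integral_add) (auto simp: integral_unique)
    moreover have "((\<lambda>y. integral {0..1} (\<lambda>x. wy x y)) has_real_derivative integral {0..1} (\<lambda>x. wyy x y)) (at y)"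
      by (rule *) (use y d in auto)
    ultimately show "((\<lambda>y. integral {0..1} (\<lambda>x. wy x y)) has_real_derivative
        integral {0..1} (\<lambda>x. wxx x y + wyy x y)) (at y)" by simp
  qed
qed

lemma smooth_strip_mean_convex:
  assumes "smooth_strip a b w wx wxx wy wyy"
    and lap: "\<And>x y. a < y \<Longrightarrow> y < b \<Longrightarrow> wxx x y + wyy x y \<ge> 0"
  shows "convex_on {a<..<b} (\<lambda>y. integral {0..1} (\<lambda>x. w x y))"
proof -
  obtain h' where h': "\<And>y. a < y \<Longrightarrow> y < b \<Longrightarrow> ((\<lambda>y. integral {0..1} (\<lambda>x. w x y)) has_real_derivative h' y) (at y)"
    "\<And>y. a < y \<Longrightarrow> y < b \<Longrightarrow> (h' has_real_derivative integral {0..1} (\<lambda>x. wxx x y + wyy x y)) (at y)"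
    using smooth_strip_mean[OF assms(1)] by blast
  note c = smooth_strip_slice_continuous
  note d = smooth_stripD[OF assms(1)]
  show ?thesis
    by (rule f''_ge0_imp_convex[OF _ h'(1) h'(2)])
      (auto intro!: integral_nonneg lap integrable_continuous_interval continuous_intros c[OF d(9)] c[OF d(11)])
qed

text \<open>The energy estimate: for bounded \<open>w \<ge> 0\<close>, the mean of \<open>w\<^sup>2\<close> over a line is a bounded function of
  the height whose second derivative dominates twice the energy on that line.\<close>

lemma exists_line_bounded_energy:
  fixes I :: "'i set"
  assumes I: "finite I" and ab: "a < b"
    and sm: "\<And>i. i \<in> I \<Longrightarrow> smooth_strip a b (w i) (wx i) (wxx i) (wy i) (wyy i)"
    and lap: "\<And>i x y. i \<in> I \<Longrightarrow> a < y \<Longrightarrow> y < b \<Longrightarrow> wxx i x y + wyy i x y \<ge> 0"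
    and bnd: "\<And>i x y. i \<in> I \<Longrightarrow> a < y \<Longrightarrow> y < b \<Longrightarrow> 0 \<le> w i x y \<and> w i x y \<le> H"
  shows "\<exists>y. a < y \<and> y < b \<and>
    (\<forall>i\<in>I. integral {0..1} (\<lambda>x. (wx i x y)\<^sup>2) \<le> 16 * (real (card I) * H\<^sup>2) / (b - a)\<^sup>2 + 1)"
proof (rule ccontr)
  define C where "C = 16 * (real (card I) * H\<^sup>2) / (b - a)\<^sup>2 + 1"
  assume neg: "\<not> ?thesis"
  note d = smooth_stripD[OF sm]
  note c = smooth_strip_slice_continuous
  note sq = smooth_strip_sum[OF I smooth_strip_square[OF sm]]
  \<comment> \<open>Summing over \<open>I\<close> lets one line serve all members of the family.
    \<open>L\<close> is the Laplacian of the sum of squares: each member contributes twice its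
    squared gradient plus \<open>2 * w\<close> times its Laplacian, hence at least
    \<open>2 * wx\<^sup>2\<close>.\<close>
  define h where "h = (\<lambda>y. integral {0..1} (\<lambda>x. \<Sum>i\<in>I. (w i x y)\<^sup>2))"
  define L where "L x y = (\<Sum>i\<in>I. 2 * wx i x y * wx i x y + 2 * w i x y * wxx i x y)
    + (\<Sum>i\<in>I. 2 * wy i x y * wy i x y + 2 * w i x y * wyy i x y)" for x y
  obtain h' where h': "\<And>y. a < y \<Longrightarrow> y < b \<Longrightarrow> (h has_real_derivative h' y) (at y)"
    "\<And>y. a < y \<Longrightarrow> y < b \<Longrightarrow> (h' has_real_derivative integral {0..1} (\<lambda>x. L x y)) (at y)"
    using smooth_strip_mean[OF sq[of "\<lambda>i. i"]] unfolding h_def L_def by blast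
  have big: "2 * C \<le> integral {0..1} (\<lambda>x. L x y)" if y: "a < y" "y < b" for y
  proof -
    obtain i where i: "i \<in> I" "C < integral {0..1} (\<lambda>x. (wx i x y)\<^sup>2)"
      using neg y unfolding C_def by force
    have "2 * C \<le> integral {0..1} (\<lambda>x. 2 * (wx i x y)\<^sup>2)" using i by simp
    also have "\<dots> \<le> integral {0..1} (\<lambda>x. L x y)"
    proof (rule integral_le)
      show "(\<lambda>x. L x y) integrable_on {0..1}" unfolding L_def
        by (intro integrable_continuous_interval continuous_intros c[OF d(7)] c[OF d(8)] c[OF d(9)] c[OF d(10)] c[OF d(11)] y)
      show "(\<lambda>x. 2 * (wx i x y)\<^sup>2) integrable_on {0..1}"
        by (intro integrable_continuous_interval continuous_intros c[OF d(8)] i y)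
      fix x :: real
      have eq: "L x y = (\<Sum>i\<in>I. 2 * (wx i x y)\<^sup>2 + 2 * (wy i x y)\<^sup>2 + 2 * (w i x y * (wxx i x y + wyy i x y)))"
        unfolding L_def sum.distrib[symmetric] by (intro sum.cong) (auto simp: power2_eq_square algebra_simps)
      have term0: "0 \<le> w k x y * (wxx k x y + wyy k x y)" if "k \<in> I" for k
        using bnd[OF that y] lap[OF that y] by simp
      have "2 * (wx i x y)\<^sup>2 \<le> 2 * (wx i x y)\<^sup>2 + 2 * (wy i x y)\<^sup>2 + 2 * (w i x y * (wxx i x y + wyy i x y))"
        using term0[OF i(1)] by simp
      also have "\<dots> \<le> L x y" unfolding eq
        using term0 by (intro member_le_sum[OF i(1) _ I]) auto
      finally show "2 * (wx i x y)\<^sup>2 \<le> L x y" .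
    qed
    finally show ?thesis .
  qed
  \<comment> \<open>If every line fails for some index, the second derivative of \<open>h\<close> is
    at least \<open>2 * C\<close> everywhere. Convexity at the midpoint \<open>m\<close> of
    \<open>m - r\<close> and \<open>m + r\<close> then makes \<open>h\<close> exceed its upper
    bound.\<close>
  have conv: "convex_on {a<..<b} (\<lambda>y. h y - C * y\<^sup>2)"
  proof (rule f''_ge0_imp_convex[of _ _ "\<lambda>y. h' y - 2 * C * y" "\<lambda>y. integral {0..1} (\<lambda>x. L x y) - 2 * C"])
    fix y assume "y \<in> {a<..<b}"
    then have y: "a < y" "y < b" by auto
    show "((\<lambda>y. h y - C * y\<^sup>2) has_real_derivative h' y - 2 * C * y) (at y)"
      by (auto intro!: derivative_eq_intros h'(1) y)
    show "((\<lambda>y. h' y - 2 * C * y) has_real_derivative integral {0..1} (\<lambda>x. L x y) - 2 * C) (at y)"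
      by (auto intro!: derivative_eq_intros h'(2) y)
    show "0 \<le> integral {0..1} (\<lambda>x. L x y) - 2 * C" using big[OF y] by simp
  qed auto
  have hb: "0 \<le> h y \<and> h y \<le> real (card I) * H\<^sup>2" if y: "a < y" "y < b" for y
  proof -
    have i: "(\<lambda>x. \<Sum>i\<in>I. (w i x y)\<^sup>2) integrable_on {0..1}"
      by (intro integrable_continuous_interval continuous_intros c[OF d(7)] y)
    have "h y \<le> integral {0..1} (\<lambda>x::real. real (card I) * H\<^sup>2)"
      unfolding h_def
      by (intro integral_le i) (auto intro!: sum_bounded_above power_mono simp: bnd[OF _ y])
    then show ?thesis unfolding h_def by (auto intro!: integral_nonneg i sum_nonneg)
  qed
  \<comment> \<open>With this \<open>r\<close> the points \<open>m - r\<close> and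
    \<open>m + r\<close> are interior and \<open>(b - a)\<^sup>2 = 16 * (r * r)\<close>, which
    explains the 16 in \<open>C\<close>; the summand 1 in \<open>C\<close> makes the contradiction
    strict.\<close>
  define r where "r = (b - a) / 4"
  define m where "m = (a + b) / 2"
  have r: "r > 0" and mem: "a < m - r" "m - r < b" "a < m + r" "m + r < b" "a < m" "m < b"
    using ab unfolding r_def m_def by (auto simp: field_simps)
  have "(1 - 1/2) * (m - r) + 1/2 * (m + r) = m" by (simp add: field_simps)
  then have "h m - C * m\<^sup>2 \<le> (1 - 1/2) * (h (m - r) - C * (m - r)\<^sup>2) + 1/2 * (h (m + r) - C * (m + r)\<^sup>2)"
    using convex_onD[OF conv, of "1/2" "m - r" "m + r"] mem by simp
  moreover have "C * (r * r) = (1 - 1/2) * (C * (m - r)\<^sup>2) + 1/2 * (C * (m + r)\<^sup>2) - C * m\<^sup>2"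
    by algebra
  ultimately have "C * (r * r) + h m \<le> h (m - r) / 2 + h (m + r) / 2"
    by (simp add: right_diff_distrib)
  then have "C * (r * r) \<le> real (card I) * H\<^sup>2" using hb[of m] hb[of "m - r"] hb[of "m + r"] mem by linarith
  moreover have "C * (r * r) = real (card I) * H\<^sup>2 + r * r"
  proof -
    have "(b - a)\<^sup>2 = 16 * (r * r)" unfolding r_def by (simp add: power2_eq_square)
    then show ?thesis unfolding C_def using r by (simp add: field_simps)
  qed
  ultimately show False using mult_pos_pos[OF r r] by linarith
qed

subsection \<open>Logarithmic means of holomorphic functions\<close>

lemma smooth_strip_add:
  assumes "smooth_strip a b w wx wxx wy wyy" "smooth_strip a b v vx vxx vy vyy"
  shows "smooth_strip a b (\<lambda>x y. w x y + v x y) (\<lambda>x y. wx x y + vx x y) (\<lambda>x y. wxx x y + vxx x y)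
    (\<lambda>x y. wy x y + vy x y) (\<lambda>x y. wyy x y + vyy x y)"
proof -
  note d = smooth_stripD[OF assms(1)] and d' = smooth_stripD[OF assms(2)]
  show ?thesis
    by (intro smooth_stripI continuous_intros d d') (auto intro!: derivative_eq_intros d d' simp: d(5,6) d'(5,6))
qed

lemma countable_avoid_height:
  assumes "countable Z" and "(a::real) < b"
  shows "\<exists>y. a < y \<and> y < b \<and> (\<forall>x. Complex x y \<notin> Z)"
proof -
  have "uncountable ({a<..<b} - Im ` Z)"
    using assms by (intro uncountable_minus_countable) (auto simp: uncountable_open_interval)
  then have "{a<..<b} - Im ` Z \<noteq> {}" by force
  then obtain y where y: "y \<in> {a<..<b}" "y \<notin> Im ` Z" by blast
  have "Complex x y \<notin> Z" for x using y(2) by (metis complex.sel(2) imageI)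
  with y(1) show ?thesis by auto
qed

lemma countable_imp_negligible:
  fixes S :: "'a::euclidean_space set"
  assumes "countable S"
  shows "negligible S"
proof -
  have "negligible (\<Union>x\<in>S. {x})"
    by (rule negligible_countable_Union) (use assms in auto)
  then show ?thesis by simp
qed

text \<open>Used for the four entries of a matrix product, where \<open>normsq\<close> is the
  squared Frobenius norm, and for a determinant as a family with one member, so that norms and
  determinants share the theory of logarithmic means.\<close>

locale hol_family =
  fixes \<delta> :: real and J :: "'j set" and f :: "'j \<Rightarrow> complex \<Rightarrow> complex"
  assumes \<delta>: "\<delta> > 0" and finite_J: "finite J"
    and hol: "\<And>j. j \<in> J \<Longrightarrow> f j holomorphic_on {z. \<bar>Im z\<bar> < \<delta>}"
    and per: "\<And>j z. j \<in> J \<Longrightarrow> \<bar>Im z\<bar> < \<delta> \<Longrightarrow> f j (z + 1) = f j z"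
begin

definition normsq :: "complex \<Rightarrow> real" where
  "normsq z = (\<Sum>j\<in>J. (cmod (f j z))\<^sup>2)"

text \<open>Where \<open>normsq + s\<close> vanishes the integrand is \<open>ln 0 = 0\<close> instead of \<open>-\<infinity>\<close>; for \<open>s = 0\<close> this only
  matters on a countable subset of each line.\<close>

definition logm :: "real \<Rightarrow> real \<Rightarrow> real" where
  "logm s y = integral {0..1} (\<lambda>x. ln (normsq (Complex x y) + s))"

lemma normsq_nonneg: "0 \<le> normsq z"
  unfolding normsq_def by (intro sum_nonneg) auto

lemma Complex_add_1: "Complex (x + 1) y = Complex x y + 1"
  by (simp add: complex_eq_iff)

lemma open_strip: "open {z. \<bar>Im z\<bar> < \<delta>}"
  by (intro open_Collect_less continuous_intros)

lemma continuous_on_normsq: "continuous_on {z. \<bar>Im z\<bar> < \<delta>} normsq"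
  unfolding normsq_def
  by (intro continuous_intros holomorphic_on_imp_continuous_on hol)

lemma continuous_on_line:
  assumes "\<bar>y\<bar> < \<delta>"
  shows "continuous_on S (\<lambda>x. normsq (Complex x y))"
  by (rule continuous_on_compose2[OF continuous_on_normsq])
    (use assms in \<open>auto simp: Complex_eq intro!: continuous_intros\<close>)

text \<open>Cauchy-Riemann: differentiating in \<open>y\<close> multiplies the complex derivative by
  \<open>\<i>\<close>. The two claims are the cases \<open>c = 1\<close> and
  \<open>c = - \<i>\<close> of one statement about \<open>Re (c * g)\<close>.\<close>

lemma smooth_strip_components:
  assumes g: "g holomorphic_on {z. \<bar>Im z\<bar> < \<delta>}" and per: "\<And>z. \<bar>Im z\<bar> < \<delta> \<Longrightarrow> g (z + 1) = g z"
    and ab: "- \<delta> \<le> a" "b \<le> \<delta>"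
  shows "smooth_strip a b (\<lambda>x y. Re (g (Complex x y))) (\<lambda>x y. Re (deriv g (Complex x y)))
      (\<lambda>x y. Re (deriv (deriv g) (Complex x y))) (\<lambda>x y. - Im (deriv g (Complex x y)))
      (\<lambda>x y. - Re (deriv (deriv g) (Complex x y)))"
    and "smooth_strip a b (\<lambda>x y. Im (g (Complex x y))) (\<lambda>x y. Im (deriv g (Complex x y)))
      (\<lambda>x y. Im (deriv (deriv g) (Complex x y))) (\<lambda>x y. Re (deriv g (Complex x y)))
      (\<lambda>x y. - Im (deriv (deriv g) (Complex x y)))"
proof -
  have g': "deriv g holomorphic_on {z. \<bar>Im z\<bar> < \<delta>}"
    by (rule holomorphic_deriv[OF g open_strip])
  have g'': "deriv (deriv g) holomorphic_on {z. \<bar>Im z\<bar> < \<delta>}"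
    by (rule holomorphic_deriv[OF g' open_strip])
  have strip: "Complex x y \<in> {z. \<bar>Im z\<bar> < \<delta>}" if "a < y" "y < b" for x y
    using that ab by auto
  have vx: "((\<lambda>t. h (Complex t y)) has_vector_derivative deriv h (Complex x y)) (at x)"
    and vy: "((\<lambda>t. h (Complex x t)) has_vector_derivative \<i> * deriv h (Complex x y)) (at y)"
    if h: "h holomorphic_on {z. \<bar>Im z\<bar> < \<delta>}" and y: "a < y" "y < b" for h x y
  proof -
    have d: "(h has_field_derivative deriv h (Complex x y)) (at (Complex x y))"
      by (rule holomorphic_derivI[OF h open_strip strip[OF y]])
    have "((\<lambda>t. Complex t y) has_vector_derivative 1) (at x)"
      unfolding Complex_eq by (auto intro!: derivative_eq_intros)
    from field_vector_diff_chain_at[OF this d]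
    show "((\<lambda>t. h (Complex t y)) has_vector_derivative deriv h (Complex x y)) (at x)"
      by (simp add: o_def)
    have "((\<lambda>t. Complex x t) has_vector_derivative \<i>) (at y)"
      unfolding Complex_eq by (auto intro!: derivative_eq_intros)
    from field_vector_diff_chain_at[OF this d]
    show "((\<lambda>t. h (Complex x t)) has_vector_derivative \<i> * deriv h (Complex x y)) (at y)"
      by (simp add: o_def)
  qed
  have cont: "continuous_on (UNIV \<times> {a<..<b}) (\<lambda>p. h (Complex (fst p) (snd p)))"
    if h: "h holomorphic_on {z. \<bar>Im z\<bar> < \<delta>}" for h
    by (rule continuous_on_compose2[OF holomorphic_on_imp_continuous_on[OF h]])
      (use ab in \<open>auto simp: Complex_eq intro!: continuous_intros\<close>)
  have per': "deriv g (z + 1) = deriv g z" if z: "\<bar>Im z\<bar> < \<delta>" for z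
  proof -
    have "((\<lambda>z. g (z + 1)) has_field_derivative deriv g (z + 1)) (at z)"
      using DERIV_shift[of g "deriv g (z + 1)" z 1] holomorphic_derivI[OF g open_strip, of "z + 1"] z
      by simp
    then have "(g has_field_derivative deriv g (z + 1)) (at z)"
      by (rule has_field_derivative_transform_within_open[OF _ open_strip]) (use z per in auto)
    then show ?thesis by (simp add: DERIV_imp_deriv)
  qed
  have y: "\<bar>y\<bar> < \<delta>" if "a < y" "y < b" for y using that ab by auto
  have *: "smooth_strip a b (\<lambda>x y. Re (c * g (Complex x y))) (\<lambda>x y. Re (c * deriv g (Complex x y)))
      (\<lambda>x y. Re (c * deriv (deriv g) (Complex x y))) (\<lambda>x y. Re (c * (\<i> * deriv g (Complex x y))))
      (\<lambda>x y. - Re (c * deriv (deriv g) (Complex x y)))" for c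
  proof (rule smooth_stripI)
    note R = bounded_linear.has_vector_derivative[OF bounded_linear_Re has_vector_derivative_mult_right]
    fix x y assume y': "a < y" "y < b"
    show "((\<lambda>t. Re (c * g (Complex t y))) has_real_derivative Re (c * deriv g (Complex x y))) (at x)"
      unfolding has_real_derivative_iff_has_vector_derivative by (rule R[OF vx[OF g y']])
    show "((\<lambda>t. Re (c * deriv g (Complex t y))) has_real_derivative Re (c * deriv (deriv g) (Complex x y))) (at x)"
      unfolding has_real_derivative_iff_has_vector_derivative by (rule R[OF vx[OF g' y']])
    show "((\<lambda>t. Re (c * g (Complex x t))) has_real_derivative Re (c * (\<i> * deriv g (Complex x y)))) (at y)"
      unfolding has_real_derivative_iff_has_vector_derivative by (rule R[OF vy[OF g y']])
    show "((\<lambda>t. Re (c * (\<i> * deriv g (Complex x t)))) has_real_derivative - Re (c * deriv (deriv g) (Complex x y))) (at y)"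
      unfolding has_real_derivative_iff_has_vector_derivative
      using R[OF vy[OF g' y', of x], of "c * \<i>"] by (simp add: algebra_simps)
  qed (auto simp: Complex_add_1 per per' y simp del: times_complex.sel intro!: continuous_intros holomorphic_intros cont g g' g'')
  show "smooth_strip a b (\<lambda>x y. Re (g (Complex x y))) (\<lambda>x y. Re (deriv g (Complex x y)))
      (\<lambda>x y. Re (deriv (deriv g) (Complex x y))) (\<lambda>x y. - Im (deriv g (Complex x y)))
      (\<lambda>x y. - Re (deriv (deriv g) (Complex x y)))"
    using *[of 1] by simp
  show "smooth_strip a b (\<lambda>x y. Im (g (Complex x y))) (\<lambda>x y. Im (deriv g (Complex x y)))
      (\<lambda>x y. Im (deriv (deriv g) (Complex x y))) (\<lambda>x y. Re (deriv g (Complex x y)))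
      (\<lambda>x y. - Im (deriv (deriv g) (Complex x y)))"
    using *[of "- \<i>"] by simp
qed

text \<open>Let \<open>Q\<close> be \<open>normsq + s\<close>, and \<open>S\<close> the sum of
  \<open>f_j'\<close> times the conjugate of \<open>f_j\<close>. The Laplacian of \<open>Q\<close>
  is four times the sum of the \<open>\<bar>f_j'\<bar>^2\<close>, and its squared gradient is
  \<open>4 * \<bar>S\<bar>^2\<close>. By Cauchy-Schwarz \<open>Q\<close> times its Laplacian
  dominates the squared gradient, which says that \<open>ln Q\<close> is subharmonic.\<close>

lemma smooth_strip_ln_normsq:
  assumes ab: "- \<delta> \<le> a" "b \<le> \<delta>" and s: "0 \<le> s"
    and pos: "\<And>x y. a < y \<Longrightarrow> y < b \<Longrightarrow> normsq (Complex x y) + s > 0"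
  shows "\<exists>wx wxx wy wyy. smooth_strip a b (\<lambda>x y. ln (normsq (Complex x y) + s)) wx wxx wy wyy \<and>
    (\<forall>x y. a < y \<longrightarrow> y < b \<longrightarrow> wxx x y + wyy x y \<ge> 0)"
proof -
  let ?u = "\<lambda>j x y. Re (f j (Complex x y))" and ?v = "\<lambda>j x y. Im (f j (Complex x y))"
  let ?u1 = "\<lambda>j x y. Re (deriv (f j) (Complex x y))" and ?v1 = "\<lambda>j x y. Im (deriv (f j) (Complex x y))"
  let ?u2 = "\<lambda>j x y. Re (deriv (deriv (f j)) (Complex x y))" and ?v2 = "\<lambda>j x y. Im (deriv (deriv (f j)) (Complex x y))"
  have A: "smooth_strip a b (\<lambda>x y. (?u j x y)\<^sup>2 + (?v j x y)\<^sup>2)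
      (\<lambda>x y. 2 * ?u j x y * ?u1 j x y + 2 * ?v j x y * ?v1 j x y)
      (\<lambda>x y. (2 * ?u1 j x y * ?u1 j x y + 2 * ?u j x y * ?u2 j x y) + (2 * ?v1 j x y * ?v1 j x y + 2 * ?v j x y * ?v2 j x y))
      (\<lambda>x y. 2 * ?u j x y * - ?v1 j x y + 2 * ?v j x y * ?u1 j x y)
      (\<lambda>x y. (2 * - ?v1 j x y * - ?v1 j x y + 2 * ?u j x y * - ?u2 j x y) + (2 * ?u1 j x y * ?u1 j x y + 2 * ?v j x y * - ?v2 j x y))"
    if "j \<in> J" for j
    by (intro smooth_strip_add smooth_strip_square smooth_strip_components hol[OF that] per[OF that] ab)
  \<comment> \<open>The factor 1 is the coefficient in \<open>smooth_strip_affine\<close>, by which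
    the constant \<open>s\<close> is added.\<close>
  define Wx Wxx Wy Wyy where
    "Wx x y = 1 * (\<Sum>j\<in>J. 2 * ?u j x y * ?u1 j x y + 2 * ?v j x y * ?v1 j x y)" and
    "Wxx x y = 1 * (\<Sum>j\<in>J. (2 * ?u1 j x y * ?u1 j x y + 2 * ?u j x y * ?u2 j x y) + (2 * ?v1 j x y * ?v1 j x y + 2 * ?v j x y * ?v2 j x y))" and
    "Wy x y = 1 * (\<Sum>j\<in>J. 2 * ?u j x y * - ?v1 j x y + 2 * ?v j x y * ?u1 j x y)" and
    "Wyy x y = 1 * (\<Sum>j\<in>J. (2 * - ?v1 j x y * - ?v1 j x y + 2 * ?u j x y * - ?u2 j x y) + (2 * ?u1 j x y * ?u1 j x y + 2 * ?v j x y * - ?v2 j x y))"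
    for x y
  have eq: "normsq (Complex x y) + s = 1 * (\<Sum>j\<in>J. (?u j x y)\<^sup>2 + (?v j x y)\<^sup>2) + s" for x y
    unfolding normsq_def by (simp add: cmod_power2)
  have W: "smooth_strip a b (\<lambda>x y. normsq (Complex x y) + s) Wx Wxx Wy Wyy"
    unfolding eq Wx_def Wxx_def Wy_def Wyy_def
    by (intro smooth_strip_affine smooth_strip_sum finite_J A)
  note L = smooth_strip_ln[OF W pos]
  have lap: "(Wxx x y * Q - Wx x y * Wx x y) / (Q * Q) + (Wyy x y * Q - Wy x y * Wy x y) / (Q * Q) \<ge> 0"
    if Q: "Q = normsq (Complex x y) + s" for x y Q
  proof -
    define g g' where "g j = f j (Complex x y)" and "g' j = deriv (f j) (Complex x y)" for j
    define S where "S = (\<Sum>j\<in>J. g' j * cnj (g j))"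
    have Wsum: "Wxx x y + Wyy x y = 4 * (\<Sum>j\<in>J. (cmod (g' j))\<^sup>2)"
      unfolding Wxx_def Wyy_def g'_def cmod_power2 mult_1 sum.distrib[symmetric] sum_distrib_left
      by (intro sum.cong refl) (simp add: power2_eq_square algebra_simps)
    have Wxe: "Wx x y = 2 * Re S" and Wye: "Wy x y = - 2 * Im S"
      unfolding Wx_def Wy_def S_def g_def g'_def
      by (simp_all add: sum_distrib_left sum_negf[symmetric] algebra_simps)
    have "cmod S \<le> (\<Sum>j\<in>J. cmod (g' j) * cmod (g j))"
      unfolding S_def using norm_sum[of "\<lambda>j. g' j * cnj (g j)" J] by (simp add: norm_mult)
    then have "(cmod S)\<^sup>2 \<le> (\<Sum>j\<in>J. cmod (g' j) * cmod (g j))\<^sup>2" by (intro power_mono) auto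
    also have "\<dots> \<le> (\<Sum>j\<in>J. (cmod (g' j))\<^sup>2) * (\<Sum>j\<in>J. (cmod (g j))\<^sup>2)" by (rule Cauchy_Schwarz_ineq_sum)
    also have "\<dots> \<le> (\<Sum>j\<in>J. (cmod (g' j))\<^sup>2) * Q"
      unfolding Q normsq_def g_def using s by (intro mult_left_mono sum_nonneg) auto
    finally have "4 * (cmod S)\<^sup>2 \<le> (Wxx x y + Wyy x y) * Q" unfolding Wsum by simp
    moreover have "Wx x y * Wx x y + Wy x y * Wy x y = 4 * (cmod S)\<^sup>2"
      unfolding Wxe Wye cmod_power2 by (simp add: power2_eq_square)
    ultimately have "0 \<le> (Wxx x y * Q - Wx x y * Wx x y) + (Wyy x y * Q - Wy x y * Wy x y)"
      by (simp add: algebra_simps)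
    then show ?thesis unfolding add_divide_distrib[symmetric] by (rule divide_nonneg_nonneg) simp
  qed
  show ?thesis
    by (intro exI conjI, rule L) (use lap in auto)
qed

lemma smooth_strip_scaled_ln_normsq:
  assumes ab: "- \<delta> \<le> a" "b \<le> \<delta>" and k: "0 \<le> k"
    and pos: "\<And>x y. a < y \<Longrightarrow> y < b \<Longrightarrow> normsq (Complex x y) > 0"
  shows "\<exists>wx wxx wy wyy. smooth_strip a b (\<lambda>x y. k * ln (normsq (Complex x y)) + e) wx wxx wy wyy \<and>
    (\<forall>x y. a < y \<longrightarrow> y < b \<longrightarrow> wxx x y + wyy x y \<ge> 0)"
proof -
  obtain wx wxx wy wyy where w: "smooth_strip a b (\<lambda>x y. ln (normsq (Complex x y))) wx wxx wy wyy"
    and l: "\<And>x y. a < y \<Longrightarrow> y < b \<Longrightarrow> wxx x y + wyy x y \<ge> 0"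
    using smooth_strip_ln_normsq[OF ab, of 0] pos by auto
  have "0 \<le> k * wxx x y + k * wyy x y" if "a < y" "y < b" for x y
    using l[OF that, of x] k by (simp flip: distrib_left)
  with smooth_strip_affine[OF w, of k e] show ?thesis by blast
qed

lemma logm_convex_pos:
  assumes "s > 0"
  shows "convex_on {-\<delta><..<\<delta>} (logm s)"
proof -
  obtain wx wxx wy wyy where w: "smooth_strip (-\<delta>) \<delta> (\<lambda>x y. ln (normsq (Complex x y) + s)) wx wxx wy wyy"
    and lap: "\<And>x y. -\<delta> < y \<Longrightarrow> y < \<delta> \<Longrightarrow> wxx x y + wyy x y \<ge> 0"
    using smooth_strip_ln_normsq[of "-\<delta>" \<delta> s] assms normsq_nonneg by (auto simp: add_nonneg_pos)
  show ?thesis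
    using smooth_strip_mean_convex[OF w lap] unfolding logm_def[abs_def] by simp
qed

lemma ln_normsq_integrable_pos:
  assumes "\<bar>y\<bar> < \<delta>" and "\<And>x. normsq (Complex x y) + s > 0"
  shows "(\<lambda>x. ln (normsq (Complex x y) + s)) integrable_on {0..1}"
  by (intro integrable_continuous_interval continuous_intros continuous_on_line assms)
    (use assms(2) in \<open>auto simp: less_imp_neq[symmetric]\<close>)

lemma logm_mono:
  assumes "\<bar>y\<bar> < \<delta>" "\<And>x. normsq (Complex x y) + s > 0" "s \<le> s'"
  shows "logm s y \<le> logm s' y"
proof -
  have "normsq (Complex x y) + s' > 0" for x using assms(2)[of x] assms(3) by linarith
  then show ?thesis
    unfolding logm_def using assms by (intro integral_le ln_normsq_integrable_pos) auto
qed

end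

section \<open>Passing to the limit across zeros\<close>

locale nondeg_hol_family = hol_family +
  assumes countable_zeros: "countable {z. \<bar>Im z\<bar> < \<delta> \<and> normsq z = 0}"
begin

lemma negligible_zeros_line:
  assumes "\<bar>y\<bar> < \<delta>"
  shows "negligible {x. normsq (Complex x y) = 0}"
proof -
  have "{x. normsq (Complex x y) = 0} \<subseteq> Re ` {z. \<bar>Im z\<bar> < \<delta> \<and> normsq z = 0}"
    using assms by (force simp: image_iff)
  then have "countable {x. normsq (Complex x y) = 0}"
    by (rule countable_subset[OF _ countable_image[OF countable_zeros]])
  then show ?thesis by (rule countable_imp_negligible)
qed

text \<open>On a line \<open>y1 > y\<close> without zeros, \<open>logm s y1\<close> is at least the
  finite \<open>logm 0 y1\<close>. Since \<open>y1\<close> lies between \<open>y\<close> and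
  \<open>y2\<close>, convexity of \<open>logm s\<close> and the bound \<open>logm 1 y2\<close> at
  the far end force \<open>logm s y\<close> to stay above a constant.\<close>

lemma logm_bounded_below:
  assumes y: "\<bar>y\<bar> < \<delta>"
  shows "\<exists>B. \<forall>s. 0 < s \<longrightarrow> s \<le> 1 \<longrightarrow> B \<le> logm s y"
proof -
  obtain y1 where y1: "y < y1" "y1 < \<delta>" "\<forall>x. Complex x y1 \<notin> {z. \<bar>Im z\<bar> < \<delta> \<and> normsq z = 0}"
    using countable_avoid_height[OF countable_zeros, of y \<delta>] y unfolding abs_less_iff by blast
  define y2 where "y2 = (y1 + \<delta>) / 2"
  have y2: "y1 < y2" "y2 < \<delta>" using y1 unfolding y2_def by auto
  have y': "\<bar>y1\<bar> < \<delta>" "\<bar>y2\<bar> < \<delta>" using y y1 y2 by auto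
  have pos1: "normsq (Complex x y1) + 0 > 0" for x
    using y1(3) y'(1) normsq_nonneg[of "Complex x y1"] by (auto simp: less_le)
  define t where "t = (y1 - y) / (y2 - y)"
  have t: "0 < t" "t < 1" unfolding t_def using y1 y2 by auto
  have comb: "(1 - t) * y + t * y2 = y1"
  proof -
    have "t * (y2 - y) = y1 - y" unfolding t_def using y1 y2 by simp
    then show ?thesis by (simp add: algebra_simps)
  qed
  show ?thesis
  proof (intro exI[of _ "(logm 0 y1 - t * logm 1 y2) / (1 - t)"] allI impI)
    fix s :: real assume s: "0 < s" "s \<le> 1"
    have p: "normsq z + s > 0" for z using normsq_nonneg[of z] s by linarith
    have "logm s ((1 - t) * y + t * y2) \<le> (1 - t) * logm s y + t * logm s y2"
      using convex_onD[OF logm_convex_pos[OF s(1)], of t y y2] t y y' by (auto simp: abs_less_iff)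
    moreover have "logm 0 y1 \<le> logm s y1" by (rule logm_mono[OF y'(1) pos1]) (use s in auto)
    moreover have "t * logm s y2 \<le> t * logm 1 y2"
      using t by (intro mult_left_mono logm_mono[OF y'(2)] p) (use s in auto)
    ultimately have "logm 0 y1 - t * logm 1 y2 \<le> (1 - t) * logm s y" unfolding comb by linarith
    then show "(logm 0 y1 - t * logm 1 y2) / (1 - t) \<le> logm s y"
      using t by (simp add: pos_divide_le_eq mult.commute)
  qed
qed

text \<open>Monotone convergence for \<open>s = 1 / Suc n\<close>. The lower bound uniform in
  \<open>s\<close> is what makes the logarithm integrable over lines that contain zeros.\<close>

lemma logm_limit:
  assumes y: "\<bar>y\<bar> < \<delta>"
  shows "(\<lambda>x. ln (normsq (Complex x y))) integrable_on {0..1}"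
    and "(\<lambda>n. logm (1 / Suc n) y) \<longlonglongrightarrow> logm 0 y"
proof -
  define Z where "Z = {x. normsq (Complex x y) = 0}"
  have Z: "negligible Z" unfolding Z_def by (rule negligible_zeros_line[OF y])
  \<comment> \<open>On \<open>Z\<close> the regularized logarithms decrease to minus infinity, not
    to \<open>ln 0 = 0\<close>. Setting all values there to 0 restores pointwise convergence and
    changes no integral, as \<open>Z\<close> is negligible.\<close>
  define g where "g n x = (if x \<in> Z then 0 else ln (normsq (Complex x y) + 1 / Suc n))" for n :: nat and x
  define g0 where "g0 x = (if x \<in> Z then 0 else ln (normsq (Complex x y)))" for x
  have p: "normsq z + 1 / Suc n > 0" for z and n :: nat using normsq_nonneg[of z] by (simp add: add_nonneg_pos)
  have int: "(\<lambda>x. ln (normsq (Complex x y) + 1 / Suc n)) integrable_on {0..1}" for n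
    by (rule ln_normsq_integrable_pos[OF y p])
  have eqg: "integral {0..1} (g n) = logm (1 / Suc n) y" for n
    unfolding logm_def by (rule integral_spike[OF Z]) (auto simp: g_def)
  obtain B where B: "\<And>s. 0 < s \<Longrightarrow> s \<le> 1 \<Longrightarrow> B \<le> logm s y" using logm_bounded_below[OF y] by blast
  have mc: "g0 integrable_on {0..1} \<and> (\<lambda>n. integral {0..1} (g n)) \<longlonglongrightarrow> integral {0..1} g0"
  proof (rule monotone_convergence_decreasing)
    show "g n integrable_on {0..1}" for n
      by (rule integrable_spike[OF int[of n] Z]) (auto simp: g_def)
    show "g (Suc n) x \<le> g n x" for n x
    proof (cases "x \<in> Z")
      case False
      have "1 / real (Suc (Suc n)) \<le> 1 / real (Suc n)" by (intro divide_left_mono) auto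
      then have "ln (normsq (Complex x y) + 1 / Suc (Suc n)) \<le> ln (normsq (Complex x y) + 1 / Suc n)"
        using p[of "Complex x y" "Suc n"] by (intro ln_mono) auto
      then show ?thesis using False by (simp add: g_def)
    qed (simp add: g_def)
    show "(\<lambda>n. g n x) \<longlonglongrightarrow> g0 x" for x
    proof (cases "x \<in> Z")
      case False
      have "(\<lambda>n. normsq (Complex x y) + 1 / real (Suc n)) \<longlonglongrightarrow> normsq (Complex x y) + 0"
        by (intro tendsto_add tendsto_const LIMSEQ_Suc[OF lim_1_over_n])
      then have "(\<lambda>n. ln (normsq (Complex x y) + 1 / real (Suc n))) \<longlonglongrightarrow> ln (normsq (Complex x y))"
        using False by (intro tendsto_ln) (auto simp: Z_def)
      then show ?thesis using False by (simp add: g_def g0_def)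
    qed (simp add: g_def g0_def)
    have "logm (1 / Suc n) y \<le> logm 1 y" for n
      by (rule logm_mono[OF y p]) simp
    then have "range (\<lambda>n. integral {0..1} (g n)) \<subseteq> {B..logm 1 y}" unfolding eqg using B by auto
    then show "bounded (range (\<lambda>n. integral {0..1} (g n)))" using bounded_closed_interval bounded_subset by blast
  qed
  show "(\<lambda>x. ln (normsq (Complex x y))) integrable_on {0..1}"
    by (intro integrable_spike[OF conjunct1[OF mc] Z]) (auto simp: g0_def)
  have "integral {0..1} g0 = logm 0 y"
    unfolding logm_def by (rule integral_spike[OF Z]) (auto simp: g0_def)
  with mc eqg show "(\<lambda>n. logm (1 / Suc n) y) \<longlonglongrightarrow> logm 0 y" by simp
qed

lemma logm_convex: "convex_on {-\<delta><..<\<delta>} (logm 0)"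
proof (rule convex_onI)
  fix t x y :: real assume t: "0 < t" "t < 1" and xy: "x \<in> {-\<delta><..<\<delta>}" "y \<in> {-\<delta><..<\<delta>}"
  have mem: "(1 - t) * x + t * y \<in> {-\<delta><..<\<delta>}"
    using convexD_alt[OF convex_real_interval(8) xy, of t] t by simp
  have "(\<lambda>n. logm (1 / Suc n) ((1 - t) * x + t * y)) \<longlonglongrightarrow> logm 0 ((1 - t) * x + t * y)"
    by (rule logm_limit(2)) (use mem in auto)
  moreover have "(\<lambda>n. (1 - t) * logm (1 / Suc n) x + t * logm (1 / Suc n) y) \<longlonglongrightarrow> (1 - t) * logm 0 x + t * logm 0 y"
    by (intro tendsto_intros logm_limit(2)) (use xy in auto)
  ultimately have "logm 0 ((1 - t) * x + t * y) \<le> (1 - t) * logm 0 x + t * logm 0 y"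
  proof (rule LIMSEQ_le)
    show "\<exists>N. \<forall>n\<ge>N. logm (1 / Suc n) ((1 - t) * x + t * y) \<le> (1 - t) * logm (1 / Suc n) x + t * logm (1 / Suc n) y"
      by (intro exI allI impI convex_onD[OF logm_convex_pos, of _ t x y, simplified]) (use t xy in auto)
  qed
  then show "logm 0 ((1 - t) *\<^sub>R x + t *\<^sub>R y) \<le> (1 - t) * logm 0 x + t * logm 0 y" by simp
qed simp

end

subsection \<open>The cocycle on the strip\<close>

primrec ccocycle :: "real \<Rightarrow> (complex \<Rightarrow> mat2) \<Rightarrow> nat \<Rightarrow> complex \<Rightarrow> mat2" where
  "ccocycle \<beta> F 0 z = mat 1"
| "ccocycle \<beta> F (Suc n) z = F (z + of_real (real n * \<beta>)) ** ccocycle \<beta> F n z"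

definition cmean :: "real \<Rightarrow> (complex \<Rightarrow> mat2) \<Rightarrow> nat \<Rightarrow> real \<Rightarrow> real" where
  "cmean \<beta> F n y = integral {0..1} (\<lambda>x. ln (norm (ccocycle \<beta> F n (Complex x y))))"

definition dmean :: "(complex \<Rightarrow> mat2) \<Rightarrow> real \<Rightarrow> real" where
  "dmean F y = integral {0..1} (\<lambda>x. ln (cmod (det (F (Complex x y)))))"

definition clyap :: "real \<Rightarrow> (complex \<Rightarrow> mat2) \<Rightarrow> real \<Rightarrow> real" where
  "clyap \<beta> F y = lim (\<lambda>n. cmean \<beta> F n y / real n)"

lemma ccocycle_add:
  "ccocycle \<beta> F (m + n) z = ccocycle \<beta> F m (z + of_real (real n * \<beta>)) ** ccocycle \<beta> F n z"
proof (induction m)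
  case (Suc m)
  have "z + of_real (real n * \<beta>) + of_real (real m * \<beta>) = z + of_real (real (m + n) * \<beta>)"
    by (simp add: algebra_simps)
  with Suc show ?case by (simp only: add_Suc ccocycle.simps matrix_mul_assoc)
qed simp

lemma det_ccocycle: "det (ccocycle \<beta> F n z) = (\<Prod>j<n. det (F (z + of_real (real j * \<beta>))))"
  by (induction n) (simp_all add: det_mul mult.commute)

lemma ln_power2: "ln ((x::real)\<^sup>2) = 2 * ln \<bar>x\<bar>"
proof (cases "x = 0")
  case False
  then have "ln (\<bar>x\<bar>\<^sup>2) = real 2 * ln \<bar>x\<bar>" by (intro ln_realpow; simp)
  then show ?thesis by simp
qed simp

lemma Complex_add_of_real: "Complex x y + of_real c = Complex (x + c) y"
  by (simp add: complex_eq_iff)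

text \<open>The bound \<open>exp M\<close> is part of the data so that a cocycle and its
  perturbations share one set of constants. \<open>nondeg\<close> excludes only an identically
  vanishing determinant; single zeros are allowed.\<close>

locale qp_cocycle =
  fixes \<delta> \<beta> M :: real and F :: "complex \<Rightarrow> mat2"
  assumes \<delta>: "\<delta> > 0" and M: "M \<ge> 0"
    and hol: "\<And>i j. (\<lambda>z. F z $ i $ j) holomorphic_on {z. \<bar>Im z\<bar> < \<delta>}"
    and per: "\<And>z. \<bar>Im z\<bar> < \<delta> \<Longrightarrow> F (z + 1) = F z"
    and bnd: "\<And>z. \<bar>Im z\<bar> < \<delta> \<Longrightarrow> norm (F z) \<le> exp M"
    and nondeg: "\<exists>z. \<bar>Im z\<bar> < \<delta> \<and> det (F z) \<noteq> 0"
begin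

abbreviation "P \<equiv> ccocycle \<beta> F"

abbreviation "near d F' \<equiv> qp_cocycle \<delta> M F' \<and> (\<forall>z. \<bar>Im z\<bar> < \<delta> \<longrightarrow> norm (F' z - F z) \<le> d)"

lemma open_strip: "open {z. \<bar>Im z\<bar> < \<delta>}"
  by (intro open_Collect_less continuous_intros)

lemma connected_open_strip: "connected {z. \<bar>Im z\<bar> < \<delta>}"
proof -
  have "{z. \<bar>Im z\<bar> < \<delta>} = {z. Im z < \<delta>} \<inter> {z. Im z > - \<delta>}" by auto
  then show ?thesis
    by (simp add: convex_connected convex_Int convex_halfspace_Im_lt convex_halfspace_Im_gt)
qed

lemma hol_shift: "(\<lambda>z. F (z + of_real c) $ i $ j) holomorphic_on {z. \<bar>Im z\<bar> < \<delta>}"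
proof -
  have "((\<lambda>z. F z $ i $ j) \<circ> (\<lambda>z. z + of_real c)) holomorphic_on {z. \<bar>Im z\<bar> < \<delta>}"
    by (rule holomorphic_on_compose[OF _ holomorphic_on_subset[OF hol]]) (auto intro!: holomorphic_intros)
  then show ?thesis by (simp add: o_def)
qed

lemma hol_P: "(\<lambda>z. P n z $ i $ j) holomorphic_on {z. \<bar>Im z\<bar> < \<delta>}"
proof (induction n arbitrary: i j)
  case (Suc n)
  then show ?case by (auto simp: matrix_matrix_mult_def simp del: of_real_mult intro!: holomorphic_intros hol_shift)
qed (auto simp: mat_def)

lemma hol_det: "(\<lambda>z. det (F z)) holomorphic_on {z. \<bar>Im z\<bar> < \<delta>}"
  unfolding det_2 by (intro holomorphic_intros hol)

lemma per_P: "\<bar>Im z\<bar> < \<delta> \<Longrightarrow> P n (z + 1) = P n z"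
proof (induction n)
  case (Suc n)
  have "z + 1 + of_real (real n * \<beta>) = z + of_real (real n * \<beta>) + 1" by simp
  moreover have "F (z + of_real (real n * \<beta>) + 1) = F (z + of_real (real n * \<beta>))"
    using Suc.prems by (intro per) simp
  ultimately show ?case using Suc by (simp only: ccocycle.simps)
qed simp

lemma norm_P_le:
  assumes z: "\<bar>Im z\<bar> < \<delta>" and n: "1 \<le> n"
  shows "norm (P n z) \<le> exp (real n * M)"
  using n
proof (induction n rule: nat_induct_at_least)
  case base
  then show ?case using bnd[OF z] by simp
next
  case (Suc n)
  have "norm (P (Suc n) z) \<le> norm (F (z + of_real (real n * \<beta>))) * norm (P n z)"
    by (simp add: norm_matrix_mult_le)
  also have "\<dots> \<le> exp M * exp (real n * M)"
    using Suc bnd[of "z + of_real (real n * \<beta>)"] z by (intro mult_mono) auto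
  finally show ?case by (simp add: algebra_simps flip: exp_add)
qed

text \<open>Exhaustion by closed strips. It serves the countability of the zeros of the determinant,
  which is obtained on an F-sigma domain.\<close>

lemma fsigma_strip: "fsigma {z. \<bar>Im z\<bar> < \<delta>}"
proof -
  have "closed {z. \<bar>Im z\<bar> \<le> \<delta> - inverse (real (Suc n))}" for n
    by (intro closed_Collect_le continuous_intros)
  then have "fsigma (\<Union>n. {z. \<bar>Im z\<bar> \<le> \<delta> - inverse (real (Suc n))})"
    by (rule fsigma.intros)
  also have "(\<Union>n. {z. \<bar>Im z\<bar> \<le> \<delta> - inverse (real (Suc n))}) = {z. \<bar>Im z\<bar> < \<delta>}"
  proof (intro equalityI subsetI)
    fix z assume "z \<in> {z. \<bar>Im z\<bar> < \<delta>}"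
    then obtain n where "inverse (real (Suc n)) < \<delta> - \<bar>Im z\<bar>"
      using reals_Archimedean[of "\<delta> - \<bar>Im z\<bar>"] by auto
    then have "\<bar>Im z\<bar> \<le> \<delta> - inverse (real (Suc n))" by linarith
    then show "z \<in> (\<Union>n. {z. \<bar>Im z\<bar> \<le> \<delta> - inverse (real (Suc n))})" by blast
  next
    fix z assume "z \<in> (\<Union>n. {z. \<bar>Im z\<bar> \<le> \<delta> - inverse (real (Suc n))})"
    then obtain n where "\<bar>Im z\<bar> \<le> \<delta> - inverse (real (Suc n))" by blast
    moreover have "inverse (real (Suc n)) > 0" by simp
    ultimately have "\<bar>Im z\<bar> < \<delta>" by linarith
    then show "z \<in> {z. \<bar>Im z\<bar> < \<delta>}" by simp
  qed
  finally show ?thesis .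
qed

lemma countable_det_zeros: "countable {z. \<bar>Im z\<bar> < \<delta> \<and> det (F z) = 0}"
proof (cases "(\<lambda>z. det (F z)) constant_on {z. \<bar>Im z\<bar> < \<delta>}")
  case True
  then obtain c where "\<And>z. \<bar>Im z\<bar> < \<delta> \<Longrightarrow> det (F z) = c" unfolding constant_on_def by auto
  with nondeg have "{z. \<bar>Im z\<bar> < \<delta> \<and> det (F z) = 0} = {}" by auto
  then show ?thesis by (simp only: countable_empty)
next
  case False
  have "countable {z \<in> {z. \<bar>Im z\<bar> < \<delta>}. det (F z) = 0}"
    by (rule holomorphic_countable_zeros[OF hol_det open_strip connected_open_strip fsigma_strip False])
  then show ?thesis by simp
qed

text \<open>The points whose forward orbit meets a zero of the determinant. Off \<open>Z\<close> the
  products of all lengths are invertible, so every logarithm is a genuine one.\<close>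

definition Z :: "complex set" where
  "Z = {z. \<bar>Im z\<bar> < \<delta> \<and> (\<exists>j::nat. det (F (z + of_real (real j * \<beta>))) = 0)}"

lemma countable_Z: "countable Z"
proof -
  have "Z \<subseteq> (\<Union>j::nat. (\<lambda>z. z - of_real (real j * \<beta>)) ` {z. \<bar>Im z\<bar> < \<delta> \<and> det (F z) = 0})"
  proof
    fix z assume "z \<in> Z"
    then obtain j :: nat where "\<bar>Im z\<bar> < \<delta>" "det (F (z + of_real (real j * \<beta>))) = 0"
      unfolding Z_def by auto
    then have "z \<in> (\<lambda>z. z - of_real (real j * \<beta>)) ` {z. \<bar>Im z\<bar> < \<delta> \<and> det (F z) = 0}"
      by (intro image_eqI[of _ _ "z + of_real (real j * \<beta>)"]) auto
    then show "z \<in> (\<Union>j::nat. (\<lambda>z. z - of_real (real j * \<beta>)) ` {z. \<bar>Im z\<bar> < \<delta> \<and> det (F z) = 0})" by blast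
  qed
  then show ?thesis
    by (rule countable_subset) (intro countable_UN countable_image countable_det_zeros uncountable_def; simp)
qed

lemma negligible_Z_line: "negligible {x. Complex x y \<in> Z}"
proof -
  have "{x. Complex x y \<in> Z} \<subseteq> Re ` Z" by (force simp: image_iff)
  then have "countable {x. Complex x y \<in> Z}"
    by (rule countable_subset[OF _ countable_image[OF countable_Z]])
  then show ?thesis by (rule countable_imp_negligible)
qed

lemma det_P_nonzero: "\<bar>Im z\<bar> < \<delta> \<Longrightarrow> z \<notin> Z \<Longrightarrow> det (P n z) \<noteq> 0"
  unfolding det_ccocycle Z_def by auto

lemma P_nonzero: "\<bar>Im z\<bar> < \<delta> \<Longrightarrow> z \<notin> Z \<Longrightarrow> P n z \<noteq> 0"
  using det_P_nonzero[of z n] by (auto simp: det_2)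

lemma family_normsq: "hol_family.normsq UNIV (\<lambda>(i, j) z. P n z $ i $ j) z = (norm (P n z))\<^sup>2"
  if "hol_family \<delta> UNIV (\<lambda>(i, j) z. P n z $ i $ j)"
  unfolding hol_family.normsq_def[OF that] unfolding norm_mat2_sq UNIV_Times_UNIV[symmetric] sum.cartesian_product
  by (simp add: case_prod_unfold)

lemma hol_family_P: "hol_family \<delta> UNIV (\<lambda>(i, j) z. P n z $ i $ j)"
  by unfold_locales (auto simp: \<delta> hol_P per_P)

lemma nondeg_family_P: "nondeg_hol_family \<delta> UNIV (\<lambda>(i, j) z. P n z $ i $ j)"
proof -
  interpret hol_family \<delta> UNIV "\<lambda>(i, j) z. P n z $ i $ j" by (rule hol_family_P)
  show ?thesis
  proof unfold_locales
    have "{z. \<bar>Im z\<bar> < \<delta> \<and> normsq z = 0} \<subseteq> Z"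
      using P_nonzero[of _ n] by (auto simp: family_normsq[OF hol_family_P])
    then show "countable {z. \<bar>Im z\<bar> < \<delta> \<and> normsq z = 0}" by (rule countable_subset[OF _ countable_Z])
  qed
qed

lemma hol_family_det: "hol_family \<delta> UNIV (\<lambda>_::unit. \<lambda>z. det (F z))"
  by unfold_locales (auto simp: \<delta> hol_det per)

lemma family_normsq_det: "hol_family.normsq UNIV (\<lambda>_::unit. \<lambda>z. det (F z)) z = (cmod (det (F z)))\<^sup>2"
  unfolding hol_family.normsq_def[OF hol_family_det] by simp

lemma nondeg_family_det: "nondeg_hol_family \<delta> UNIV (\<lambda>_::unit. \<lambda>z. det (F z))"
proof -
  interpret hol_family \<delta> UNIV "\<lambda>_::unit. \<lambda>z. det (F z)" by (rule hol_family_det)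
  show ?thesis
    by unfold_locales (use countable_det_zeros in \<open>simp add: family_normsq_det\<close>)
qed

lemma cmean_logm: "hol_family.logm UNIV (\<lambda>(i, j) z. P n z $ i $ j) 0 y = 2 * cmean \<beta> F n y"
  unfolding hol_family.logm_def[OF hol_family_P] cmean_def family_normsq[OF hol_family_P]
  by (simp add: ln_power2)

lemma dmean_logm: "hol_family.logm UNIV (\<lambda>_::unit. \<lambda>z. det (F z)) 0 y = 2 * dmean F y"
  unfolding hol_family.logm_def[OF hol_family_det] dmean_def family_normsq_det
  by (simp add: ln_power2)

lemma cmean_integrable: "\<bar>y\<bar> < \<delta> \<Longrightarrow> (\<lambda>x. ln (norm (P n (Complex x y)))) integrable_on {0..1}"
  using nondeg_hol_family.logm_limit(1)[OF nondeg_family_P, of y n]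
  unfolding family_normsq[OF hol_family_P] ln_power2
  using integrable_cmul[of "\<lambda>x. 2 * ln \<bar>norm (P n (Complex x y))\<bar>" "{0..1}" "1/2"] by simp

lemma dmean_integrable: "\<bar>y\<bar> < \<delta> \<Longrightarrow> (\<lambda>x. ln (cmod (det (F (Complex x y))))) integrable_on {0..1}"
  using nondeg_hol_family.logm_limit(1)[OF nondeg_family_det, of y]
  unfolding family_normsq_det ln_power2
  using integrable_cmul[of "\<lambda>x. 2 * ln \<bar>cmod (det (F (Complex x y)))\<bar>" "{0..1}" "1/2"] by simp

lemma convex_on_half:
  fixes g h :: "real \<Rightarrow> real"
  assumes "convex_on S g" "\<And>y. g y = 2 * h y"
  shows "convex_on S h"
proof -
  have "convex_on S (\<lambda>y. (1/2) * g y)" using assms(1) by (intro convex_on_cmul) auto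
  then show ?thesis by (simp add: assms(2))
qed

lemma cmean_convex: "convex_on {-\<delta><..<\<delta>} (cmean \<beta> F n)"
  by (rule convex_on_half[OF nondeg_hol_family.logm_convex[OF nondeg_family_P] cmean_logm])

lemma dmean_convex: "convex_on {-\<delta><..<\<delta>} (dmean F)"
  by (rule convex_on_half[OF nondeg_hol_family.logm_convex[OF nondeg_family_det] dmean_logm])

text \<open>With \<open>ln 0 = 0\<close> the pointwise inequalities between logarithms may fail on
  \<open>Z\<close>; as \<open>Z\<close> meets each line in a negligible set, they still
  integrate.\<close>

lemma integral_le_off_Z:
  fixes g h :: "real \<Rightarrow> real"
  assumes "\<bar>y\<bar> < \<delta>" "g integrable_on {0..1}" "h integrable_on {0..1}"
    and le: "\<And>x. Complex x y \<notin> Z \<Longrightarrow> g x \<le> h x"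
  shows "integral {0..1} g \<le> integral {0..1} h"
proof -
  let ?N = "{x. Complex x y \<in> Z}"
  have "integral {0..1} g = integral {0..1} (\<lambda>x. if x \<in> ?N then 0 else g x)"
    by (rule integral_spike[OF negligible_Z_line[of y]]) auto
  also have "\<dots> \<le> integral {0..1} (\<lambda>x. if x \<in> ?N then 0 else h x)"
    by (intro integral_le integrable_spike[OF assms(2) negligible_Z_line[of y]]
        integrable_spike[OF assms(3) negligible_Z_line[of y]]) (use le in auto)
  also have "\<dots> = integral {0..1} h"
    by (rule integral_spike[OF negligible_Z_line[of y]]) auto
  finally show ?thesis .
qed

lemma cmean_shift:
  assumes y: "\<bar>y\<bar> < \<delta>"
  shows "((\<lambda>x. ln (norm (P n (Complex (x + c) y)))) has_integral cmean \<beta> F n y) {0..1}"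
  unfolding cmean_def
  by (rule has_integral_periodic_shift[OF _ cmean_integrable[OF y]])
    (use per_P[of "Complex _ y" n] y in \<open>simp add: hol_family.Complex_add_1[OF hol_family_det]\<close>)

lemma dmean_shift:
  assumes y: "\<bar>y\<bar> < \<delta>"
  shows "((\<lambda>x. ln (cmod (det (F (Complex (x + c) y))))) has_integral dmean F y) {0..1}"
  unfolding dmean_def
  by (rule has_integral_periodic_shift[OF _ dmean_integrable[OF y]])
    (use per[of "Complex _ y"] y in \<open>simp add: hol_family.Complex_add_1[OF hol_family_det]\<close>)

lemma Z_shift:
  assumes "z \<notin> Z"
  shows "z + of_real (real n * \<beta>) \<notin> Z"
proof
  assume "z + of_real (real n * \<beta>) \<in> Z"
  then obtain j where j: "\<bar>Im z\<bar> < \<delta>" "det (F (z + of_real (real n * \<beta>) + of_real (real j * \<beta>))) = 0"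
    unfolding Z_def by auto
  have "z + of_real (real n * \<beta>) + of_real (real j * \<beta>) = z + of_real (real (n + j) * \<beta>)"
    by (simp add: algebra_simps)
  with j have "det (F (z + of_real (real (n + j) * \<beta>))) = 0" by (simp only:)
  with j(1) assms show False unfolding Z_def by blast
qed

text \<open>Submultiplicativity of the norm; the factor over the shifted orbit has the same mean
  because translation by \<open>real n * \<beta>\<close> preserves integrals of periodic functions
  over a period.\<close>

lemma cmean_add_le:
  assumes y: "\<bar>y\<bar> < \<delta>"
  shows "cmean \<beta> F (m + n) y \<le> cmean \<beta> F m y + cmean \<beta> F n y"
proof -
  have "((\<lambda>x. ln (norm (P m (Complex (x + real n * \<beta>) y))) + ln (norm (P n (Complex x y))))
      has_integral cmean \<beta> F m y + cmean \<beta> F n y) {0..1}"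
    using cmean_shift[OF y, of n 0] by (intro has_integral_add cmean_shift[OF y]) simp
  moreover have "integral {0..1} (\<lambda>x. ln (norm (P (m + n) (Complex x y)))) \<le>
      integral {0..1} (\<lambda>x. ln (norm (P m (Complex (x + real n * \<beta>) y))) + ln (norm (P n (Complex x y))))"
  proof (rule integral_le_off_Z[OF y cmean_integrable[OF y]])
    fix x assume x: "Complex x y \<notin> Z"
    have nz: "P m (Complex (x + real n * \<beta>) y) \<noteq> 0" "P n (Complex x y) \<noteq> 0" "P (m + n) (Complex x y) \<noteq> 0"
      using P_nonzero[of "Complex x y"] P_nonzero[OF _ Z_shift[OF x], of n m] x y
      by (auto simp: Complex_add_of_real simp del: of_real_mult)
    have "norm (P (m + n) (Complex x y)) \<le> norm (P m (Complex (x + real n * \<beta>) y)) * norm (P n (Complex x y))"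
      unfolding ccocycle_add Complex_add_of_real by (rule norm_matrix_mult_le)
    then have "ln (norm (P (m + n) (Complex x y))) \<le> ln (norm (P m (Complex (x + real n * \<beta>) y)) * norm (P n (Complex x y)))"
      using nz by (intro ln_mono) auto
    then show "ln (norm (P (m + n) (Complex x y))) \<le> ln (norm (P m (Complex (x + real n * \<beta>) y))) + ln (norm (P n (Complex x y)))"
      using nz by (simp add: ln_mult)
  qed (use calculation in \<open>auto simp: has_integral_integrable\<close>)
  ultimately show ?thesis by (simp add: cmean_def[of _ _ "m + n"] integral_unique)
qed

lemma half_det_le: "cmod (det (A::mat2)) \<le> (norm A)\<^sup>2"
  using det_le_norm_sq[of A] norm_ge_zero[of "det A"] by linarith

lemma ln_det_P:
  assumes "\<bar>Im z\<bar> < \<delta>" "z \<notin> Z"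
  shows "ln (cmod (det (P n z))) = (\<Sum>j<n. ln (cmod (det (F (z + of_real (real j * \<beta>))))))"
  unfolding det_ccocycle prod_norm[symmetric] by (rule ln_prod) (use assms in \<open>auto simp: Z_def\<close>)

lemma ln_norm_P_ge:
  assumes "\<bar>Im z\<bar> < \<delta>" "z \<notin> Z"
  shows "ln (cmod (det (P n z))) / 2 \<le> ln (norm (P n z))"
proof -
  have "ln (cmod (det (P n z))) \<le> ln ((norm (P n z))\<^sup>2)"
    using det_P_nonzero[OF assms, of n] P_nonzero[OF assms, of n] half_det_le by (intro ln_mono) auto
  then show ?thesis by (simp add: ln_power2)
qed

lemma sum_dmean_shift:
  assumes y: "\<bar>y\<bar> < \<delta>"
  shows "((\<lambda>x. \<Sum>j<n. ln (cmod (det (F (Complex (x + real j * \<beta>) y))))) has_integral real n * dmean F y) {0..1}"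
  using has_integral_sum[of "{..<n}" "\<lambda>j x. ln (cmod (det (F (Complex (x + real j * \<beta>) y))))" "\<lambda>_. dmean F y" "{0..1}"]
    dmean_shift[OF y] by simp

text \<open>\<open>\<bar>det A\<bar>\<close> is at most the squared norm of \<open>A\<close>, and
  the logarithm of the determinant of a product is a sum over the orbit, each summand having mean
  \<open>dmean F y\<close>.\<close>

lemma cmean_ge_dmean:
  assumes y: "\<bar>y\<bar> < \<delta>"
  shows "dmean F y / 2 * real n \<le> cmean \<beta> F n y"
proof -
  note i = has_integral_mult_right[OF sum_dmean_shift[OF y, of n], of "1/2"]
  have "integral {0..1} (\<lambda>x. 1/2 * (\<Sum>j<n. ln (cmod (det (F (Complex (x + real j * \<beta>) y)))))) \<le> cmean \<beta> F n y"
    unfolding cmean_def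
  proof (rule integral_le_off_Z[OF y _ cmean_integrable[OF y]])
    fix x assume x: "Complex x y \<notin> Z"
    show "1/2 * (\<Sum>j<n. ln (cmod (det (F (Complex (x + real j * \<beta>) y))))) \<le> ln (norm (P n (Complex x y)))"
      using ln_norm_P_ge[OF _ x, of n] ln_det_P[OF _ x, of n] y by (simp add: Complex_add_of_real del: of_real_mult)
  qed (use i in \<open>auto simp: has_integral_integrable\<close>)
  then show ?thesis using integral_unique[OF i] by (simp add: mult.commute)
qed

lemma cmean_le:
  assumes y: "\<bar>y\<bar> < \<delta>" and n: "1 \<le> n"
  shows "cmean \<beta> F n y \<le> real n * M"
proof -
  have "integral {0..1} (\<lambda>x. ln (norm (P n (Complex x y)))) \<le> integral {0..1} (\<lambda>x::real. real n * M)"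
  proof (rule integral_le_off_Z[OF y cmean_integrable[OF y]])
    fix x assume x: "Complex x y \<notin> Z"
    have "ln (norm (P n (Complex x y))) \<le> ln (exp (real n * M))"
      using P_nonzero[OF _ x, of n] norm_P_le[of "Complex x y" n] y n by (intro ln_mono) auto
    then show "ln (norm (P n (Complex x y))) \<le> real n * M" by simp
  qed auto
  then show ?thesis by (simp add: cmean_def)
qed

lemma dmean_le:
  assumes y: "\<bar>y\<bar> < \<delta>"
  shows "dmean F y \<le> 2 * M"
  using cmean_ge_dmean[OF y, of 1] cmean_le[OF y, of 1] by simp

text \<open>Fekete's lemma, with the determinant as lower bound. The second claim, that the exponent
  lies below each mean, is what later gives upper semicontinuity.\<close>

lemma clyap_limit:
  assumes y: "\<bar>y\<bar> < \<delta>"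
  shows "(\<lambda>n. cmean \<beta> F n y / real n) \<longlonglongrightarrow> clyap \<beta> F y"
    and "1 \<le> n \<Longrightarrow> clyap \<beta> F y \<le> cmean \<beta> F n y / real n"
proof -
  obtain l where l: "(\<lambda>n. cmean \<beta> F n y / real n) \<longlonglongrightarrow> l" "\<forall>n\<ge>1. l \<le> cmean \<beta> F n y / real n"
    using Fekete_subadditive[of "\<lambda>n. cmean \<beta> F n y" "dmean F y / 2"] cmean_add_le[OF y] cmean_ge_dmean[OF y]
    by blast
  moreover have "clyap \<beta> F y = l" unfolding clyap_def by (rule limI[OF l(1)])
  ultimately show "(\<lambda>n. cmean \<beta> F n y / real n) \<longlonglongrightarrow> clyap \<beta> F y"
    and "1 \<le> n \<Longrightarrow> clyap \<beta> F y \<le> cmean \<beta> F n y / real n" by auto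
qed

lemma clyap_ge:
  assumes y: "\<bar>y\<bar> < \<delta>"
  shows "dmean F y / 2 \<le> clyap \<beta> F y"
proof (rule LIMSEQ_le_const[OF clyap_limit(1)[OF y]], intro exI[of _ 1] allI impI)
  fix n :: nat assume "1 \<le> n"
  then show "dmean F y / 2 \<le> cmean \<beta> F n y / real n"
    using cmean_ge_dmean[OF y, of n] by (simp add: pos_le_divide_eq)
qed

lemma clyap_le:
  assumes y: "\<bar>y\<bar> < \<delta>"
  shows "clyap \<beta> F y \<le> M"
  using clyap_limit(2)[OF y, of 1] cmean_le[OF y, of 1] by simp

lemma clyap_convex: "convex_on {-\<delta><..<\<delta>} (clyap \<beta> F)"
proof (rule convex_onI)
  fix t x y :: real assume t: "0 < t" "t < 1" and xy: "x \<in> {-\<delta><..<\<delta>}" "y \<in> {-\<delta><..<\<delta>}"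
  have mem: "(1 - t) * x + t * y \<in> {-\<delta><..<\<delta>}"
    using convexD_alt[OF convex_real_interval(8) xy, of t] t by simp
  have "(\<lambda>n. cmean \<beta> F n ((1 - t) * x + t * y) / real n) \<longlonglongrightarrow> clyap \<beta> F ((1 - t) * x + t * y)"
    by (rule clyap_limit(1)) (use mem in auto)
  moreover have "(\<lambda>n. (1 - t) * (cmean \<beta> F n x / real n) + t * (cmean \<beta> F n y / real n)) \<longlonglongrightarrow>
      (1 - t) * clyap \<beta> F x + t * clyap \<beta> F y"
    by (intro tendsto_intros clyap_limit(1)) (use xy in auto)
  ultimately have "clyap \<beta> F ((1 - t) * x + t * y) \<le> (1 - t) * clyap \<beta> F x + t * clyap \<beta> F y"
  proof (rule LIMSEQ_le, intro exI[of _ 1] allI impI)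
    fix n :: nat assume "1 \<le> n"
    have "cmean \<beta> F n ((1 - t) * x + t * y) \<le> (1 - t) * cmean \<beta> F n x + t * cmean \<beta> F n y"
      using convex_onD[OF cmean_convex[of n], of t x y] t xy by simp
    then have "cmean \<beta> F n ((1 - t) * x + t * y) / real n \<le> ((1 - t) * cmean \<beta> F n x + t * cmean \<beta> F n y) / real n"
      by (rule divide_right_mono) simp
    then show "cmean \<beta> F n ((1 - t) * x + t * y) / real n \<le> (1 - t) * (cmean \<beta> F n x / real n) + t * (cmean \<beta> F n y / real n)"
      by (simp add: add_divide_distrib)
  qed
  then show "clyap \<beta> F ((1 - t) *\<^sub>R x + t *\<^sub>R y) \<le> (1 - t) * clyap \<beta> F x + t * clyap \<beta> F y" by simp
qed simp

end

subsection \<open>Lines without zeros of the determinant\<close>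

text \<open>The hypotheses put \<open>b\<close> between \<open>a * exp (- \<epsilon>)\<close> and
  \<open>a * (2 - exp (- \<epsilon>))\<close>, and the latter is at most
  \<open>a * exp \<epsilon>\<close> because
  \<open>exp \<epsilon> + exp (- \<epsilon>) \<ge> 2\<close>.\<close>

lemma abs_ln_diff_le:
  fixes a b :: real
  assumes "0 < m" "m \<le> a" "\<bar>b - a\<bar> \<le> m * (1 - exp (- \<epsilon>))" "0 < \<epsilon>"
  shows "0 < b" and "\<bar>ln b - ln a\<bar> \<le> \<epsilon>"
proof -
  have e: "0 < 1 - exp (- \<epsilon>)" using assms(4) by simp
  have "m * (1 - exp (- \<epsilon>)) \<le> a * (1 - exp (- \<epsilon>))" using assms e by (intro mult_right_mono) auto
  then have *: "\<bar>b - a\<bar> \<le> a * (1 - exp (- \<epsilon>))" using assms(3) by linarith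
  have lo: "a * exp (- \<epsilon>) \<le> b" using * by (simp add: algebra_simps abs_le_iff)
  have a: "a > 0" using assms by linarith
  show b: "0 < b" using lo a by (meson exp_gt_zero less_le_trans mult_pos_pos)
  have "2 \<le> exp \<epsilon> + exp (- \<epsilon>)"
    using exp_ge_add_one_self[of \<epsilon>] exp_ge_add_one_self[of "- \<epsilon>"] by linarith
  then have "a * (2 - exp (- \<epsilon>)) \<le> a * exp \<epsilon>" using a by (intro mult_left_mono) auto
  then have hi: "b \<le> a * exp \<epsilon>" using * by (simp add: algebra_simps abs_le_iff)
  have "ln (a * exp (- \<epsilon>)) \<le> ln b" using lo a by (intro ln_mono) auto
  moreover have "ln b \<le> ln (a * exp \<epsilon>)" using hi b by (intro ln_mono) auto
  ultimately show "\<bar>ln b - ln a\<bar> \<le> \<epsilon>" using a by (simp add: ln_mult abs_le_iff)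
qed

lemma integral_near_value:
  fixes w :: "real \<Rightarrow> real"
  assumes "w integrable_on {0..1}" "\<And>x x'. \<bar>w x - w x'\<bar> \<le> \<eta>"
  shows "\<bar>w x - integral {0..1} w\<bar> \<le> \<eta>"
proof -
  have *: "w x - \<eta> \<le> w t \<and> w t \<le> w x + \<eta>" for t
    using assms(2)[of x t] unfolding abs_le_iff by linarith
  have "integral {0..1} (\<lambda>t::real. w x - \<eta>) \<le> integral {0..1} w"
    by (rule integral_le) (use assms(1) * in auto)
  moreover have "integral {0..1} w \<le> integral {0..1} (\<lambda>t::real. w x + \<eta>)"
    by (rule integral_le) (use assms(1) * in auto)
  ultimately show ?thesis by simp
qed

context qp_cocycle
begin

text \<open>Unlike \<open>norm_P_le\<close> this covers \<open>n = 0\<close>, where the Frobenius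
  norm of the identity is \<open>sqrt 2\<close>.\<close>

lemma norm_P_le': "\<bar>Im z\<bar> < \<delta> \<Longrightarrow> norm (P n z) \<le> sqrt 2 * exp (real n * M)"
proof (cases "n = 0")
  case False
  assume z: "\<bar>Im z\<bar> < \<delta>"
  have "norm (P n z) \<le> exp (real n * M)" using norm_P_le[OF z] False by simp
  also have "\<dots> \<le> sqrt 2 * exp (real n * M)" by simp
  finally show ?thesis .
qed (simp add: norm_mat_1)

text \<open>Telescoping: in each step either the new factor or the old product is exchanged, and all
  the other factors are bounded by powers of \<open>exp M\<close>.\<close>

lemma P_close:
  assumes F': "qp_cocycle \<delta> M F'" and d: "\<And>z. \<bar>Im z\<bar> < \<delta> \<Longrightarrow> norm (F' z - F z) \<le> d"
    and z: "\<bar>Im z\<bar> < \<delta>"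
  shows "norm (ccocycle \<beta> F' k z - P k z) \<le> real k * (sqrt 2 * exp (real k * M)) * d"
proof (induction k)
  case (Suc k)
  let ?P = "P k z" and ?P' = "ccocycle \<beta> F' k z"
  let ?A = "F (z + of_real (real k * \<beta>))" and ?A' = "F' (z + of_real (real k * \<beta>))"
  let ?s = "sqrt 2 * exp (real k * M)"
  have d0: "0 \<le> d" using d[OF z] norm_ge_zero order_trans by blast
  have "?A' ** ?P' - ?A ** ?P = ?A' ** (?P' - ?P) + (?A' - ?A) ** ?P"
    by (simp add: vec_eq_iff matrix_matrix_mult_def sum_2 algebra_simps)
  then have "norm (?A' ** ?P' - ?A ** ?P) \<le> norm ?A' * norm (?P' - ?P) + norm (?A' - ?A) * norm ?P"
    by (metis norm_triangle_le add_mono norm_matrix_mult_le)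
  also have "\<dots> \<le> exp M * (real k * ?s * d) + d * ?s"
    using Suc z d d0 norm_P_le'[OF z, of k] qp_cocycle.bnd[OF F']
    by (intro add_mono mult_mono) auto
  also have "d * ?s \<le> exp M * (d * ?s)"
    using mult_right_mono[of 1 "exp M" "d * ?s"] M d0 by simp
  finally show ?case
    by (simp add: algebra_simps exp_add del: of_real_mult)
qed simp

text \<open>Compactness of one period of the line gives a zero-free rectangle around it, on which
  the determinant attains a positive minimum; periodicity extends the bound to the whole
  tube.\<close>

lemma det_tube:
  assumes y0: "\<bar>y0\<bar> < \<delta>" and nz: "\<And>x. det (F (Complex x y0)) \<noteq> 0"
  shows "\<exists>r c. 0 < r \<and> 0 < c \<and> \<bar>y0\<bar> + r < \<delta> \<and> (\<forall>x y. \<bar>y - y0\<bar> \<le> r \<longrightarrow> c \<le> cmod (det (F (Complex x y))))"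
proof -
  let ?S = "{z. \<bar>Im z\<bar> < \<delta>}"
  have cont: "continuous_on ?S (\<lambda>z. det (F z))" by (rule holomorphic_on_imp_continuous_on[OF hol_det])
  define G where "G = ?S \<inter> (\<lambda>z. det (F z)) -` (- {0})"
  have G: "open G" unfolding G_def
    by (rule continuous_open_preimage[OF cont open_strip]) auto
  have line: "(\<lambda>x. Complex x y0) ` {0..1} \<subseteq> G" unfolding G_def using y0 nz by auto
  have "compact ((\<lambda>x. Complex x y0) ` {0..1})"
    by (intro compact_continuous_image) (auto simp: Complex_eq intro!: continuous_intros)
  from compact_subset_open_imp_cball_epsilon_subset[OF this G line]
  obtain e where e: "e > 0" "(\<Union>x\<in>(\<lambda>x. Complex x y0) ` {0..1}. cball x e) \<subseteq> G" by blast
  define r where "r = min e ((\<delta> - \<bar>y0\<bar>) / 2)"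
  have "r \<le> (\<delta> - \<bar>y0\<bar>) / 2" unfolding r_def by (rule min.cobounded2)
  then have r: "0 < r" "r \<le> e" "\<bar>y0\<bar> + r < \<delta>" using e y0 unfolding r_def by (auto simp: field_simps)
  let ?K = "cbox (Complex 0 (y0 - r)) (Complex 1 (y0 + r))"
  have KG: "?K \<subseteq> G"
  proof
    fix z assume z: "z \<in> ?K"
    then have m: "0 \<le> Re z" "Re z \<le> 1" "\<bar>Im z - y0\<bar> \<le> r" by (auto simp: in_cbox_complex_iff)
    have "z \<in> cball (Complex (Re z) y0) e"
      using m r by (simp add: dist_norm cmod_def abs_minus_commute)
    moreover have "Complex (Re z) y0 \<in> (\<lambda>x. Complex x y0) ` {0..1}" using m by simp
    ultimately show "z \<in> G" using e(2) by blast
  qed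
  have KS: "?K \<subseteq> ?S" using KG unfolding G_def by auto
  have c: "continuous_on ?K (\<lambda>z. cmod (det (F z)))"
    by (intro continuous_on_norm continuous_on_subset[OF cont KS])
  have "Complex 0 y0 \<in> ?K" using r by (simp add: in_cbox_complex_iff)
  then have "?K \<noteq> {}" by blast
  from continuous_attains_inf[OF compact_cbox this c] obtain z0 where z0: "z0 \<in> ?K" "\<And>z. z \<in> ?K \<Longrightarrow> cmod (det (F z0)) \<le> cmod (det (F z))"
    by blast
  have c: "0 < cmod (det (F z0))" using z0(1) KG unfolding G_def by auto
  have "cmod (det (F z0)) \<le> cmod (det (F (Complex x y)))" if y: "\<bar>y - y0\<bar> \<le> r" for x y
  proof -
    have y': "\<bar>y\<bar> < \<delta>" using y r by linarith
    have "F (Complex (frac x + real_of_int \<lfloor>x\<rfloor>) y) = F (Complex (frac x) y)"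
      by (rule periodic_add_of_int[of "\<lambda>x. F (Complex x y)"])
        (use per[of "Complex _ y"] y' in \<open>simp add: hol_family.Complex_add_1[OF hol_family_det]\<close>)
    then have "F (Complex x y) = F (Complex (frac x) y)" by (simp add: frac_def)
    moreover have "Complex (frac x) y \<in> ?K"
      using y frac_lt_1[of x] frac_ge_0[of x] by (auto simp: in_cbox_complex_iff abs_le_iff)
    ultimately show ?thesis using z0(2) by simp
  qed
  with r c show ?thesis by blast
qed

lemma det_le_exp: "\<bar>Im z\<bar> < \<delta> \<Longrightarrow> cmod (det (F z)) \<le> exp (2 * M)"
  using order_trans[OF half_det_le[of "F z"] power_mono[OF bnd[of z], of 2]]
  by (simp add: exp_double)

lemma det_P_ge:
  assumes c: "0 < c" and lb: "\<And>x. c \<le> cmod (det (F (Complex x y)))"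
  shows "c ^ n \<le> cmod (det (P n (Complex x y)))"
proof -
  have "(\<Prod>j<n. c) \<le> (\<Prod>j<n. cmod (det (F (Complex x y + of_real (real j * \<beta>)))))"
    unfolding Complex_add_of_real using c lb by (intro prod_mono) (auto intro: less_imp_le)
  then show ?thesis by (simp add: det_ccocycle prod_norm)
qed

lemma norm_P_ge:
  assumes c: "0 < c" and lb: "\<And>x. c \<le> cmod (det (F (Complex x y)))"
  shows "sqrt (c ^ n) \<le> norm (P n (Complex x y))"
  using det_P_ge[OF c lb, of n x] half_det_le[of "P n (Complex x y)"]
  by (intro real_le_lsqrt) auto

abbreviation "log_close F' k z \<epsilon> \<equiv> ccocycle \<beta> F' k z \<noteq> 0 \<and> det (ccocycle \<beta> F' k z) \<noteq> 0 \<and>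
  \<bar>ln (norm (ccocycle \<beta> F' k z)) - ln (norm (P k z))\<bar> \<le> \<epsilon> \<and>
  \<bar>ln (cmod (det (ccocycle \<beta> F' k z))) - ln (cmod (det (P k z)))\<bar> \<le> \<epsilon>"

text \<open>The neighbourhood depends on the length \<open>k\<close>. This suffices, since
  \<open>F\<close> and \<open>F'\<close> are compared only for finitely many lengths at a
  time.\<close>

lemma near_imp_log_close:
  assumes y: "\<bar>y\<bar> < \<delta>" and c: "0 < c" and lb: "\<And>x. c \<le> cmod (det (F (Complex x y)))" and \<epsilon>: "0 < \<epsilon>"
  shows "\<exists>d>0. \<forall>F'. near d F' \<longrightarrow>
    (\<forall>x. log_close F' k (Complex x y) \<epsilon>)"
proof -
  define s where "s = sqrt 2 * exp (real k * M)"
  \<comment> \<open>The sum of the Lipschitz constants for the norm and for the determinant of the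
    product of length \<open>k\<close>; \<open>m\<close> below bounds both quantities of
    \<open>F\<close> from below along the line.\<close>
  define C where "C = real k * s + 2 * (s + s) * (real k * s)"
  define m where "m = min (sqrt (c ^ k)) (c ^ k)"
  define t where "t = m * (1 - exp (- \<epsilon>))"
  have m: "m > 0" "m \<le> sqrt (c ^ k)" "m \<le> c ^ k" using c unfolding m_def by auto
  have t: "t > 0" unfolding t_def using m \<epsilon> by (intro mult_pos_pos) auto
  have s: "0 \<le> s" unfolding s_def by simp
  have C: "0 \<le> C" unfolding C_def using s by (intro add_nonneg_nonneg mult_nonneg_nonneg) auto
  define d where "d = t / (C + 1)"
  have d: "d > 0" "C * d \<le> t" using t C unfolding d_def by (auto simp: field_simps)
  show ?thesis
  proof (intro exI[of _ d] conjI allI impI d(1))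
    fix F' x assume "near d F'"
    then have F': "qp_cocycle \<delta> M F'"
      and cl: "\<forall>z. \<bar>Im z\<bar> < \<delta> \<longrightarrow> norm (F' z - F z) \<le> d" by auto
    let ?z = "Complex x y"
    let ?A = "P k ?z" and ?B = "ccocycle \<beta> F' k ?z"
    have z: "\<bar>Im ?z\<bar> < \<delta>" using y by simp
    have diff: "norm (?B - ?A) \<le> real k * s * d"
      unfolding s_def using P_close[OF F' _ z, of d k] cl by simp
    have "real k * s * d \<le> C * d" unfolding C_def using s d(1) by (intro mult_right_mono) auto
    then have 1: "\<bar>norm ?B - norm ?A\<bar> \<le> m * (1 - exp (- \<epsilon>))"
      using diff norm_triangle_ineq3[of ?B ?A] d(2) unfolding t_def by linarith
    have mA: "m \<le> norm ?A" using norm_P_ge[OF c lb, of k x] m(2) by linarith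
    have "cmod (det ?B - det ?A) \<le> 2 * (norm ?B + norm ?A) * norm (?B - ?A)" by (rule norm_det_diff_le)
    also have "\<dots> \<le> 2 * (s + s) * (real k * s * d)"
      using norm_P_le'[OF z, of k] qp_cocycle.norm_P_le'[OF F' z, of \<beta> k] diff s unfolding s_def[symmetric]
      by (intro mult_mono) auto
    also have "\<dots> \<le> C * d" unfolding C_def using s d(1) by (simp add: algebra_simps)
    finally have 2: "\<bar>cmod (det ?B) - cmod (det ?A)\<bar> \<le> m * (1 - exp (- \<epsilon>))"
      using norm_triangle_ineq3[of "det ?B" "det ?A"] d(2) unfolding t_def by linarith
    have mD: "m \<le> cmod (det ?A)" using det_P_ge[OF c lb, of k x] m(3) by linarith
    show "?B \<noteq> 0" using abs_ln_diff_le(1)[OF m(1) mA 1 \<epsilon>] by auto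
    show "det ?B \<noteq> 0" using abs_ln_diff_le(1)[OF m(1) mD 2 \<epsilon>] by auto
    show "\<bar>ln (norm ?B) - ln (norm ?A)\<bar> \<le> \<epsilon>" by (rule abs_ln_diff_le(2)[OF m(1) mA 1 \<epsilon>])
    show "\<bar>ln (cmod (det ?B)) - ln (cmod (det ?A))\<bar> \<le> \<epsilon>" by (rule abs_ln_diff_le(2)[OF m(1) mD 2 \<epsilon>])
  qed
qed

text \<open>\<open>P (Suc n) z\<close> is both \<open>P n (z + \<beta>) ** F z\<close> and
  \<open>F (z + n * \<beta>) ** P n z\<close>. Since \<open>F\<close> has norm at most
  \<open>exp M\<close> and determinant at least \<open>c\<close>, removing one factor and adding
  another changes the norm at most by the factor \<open>exp (2 * M) / c\<close>, whatever
  \<open>n\<close> is.\<close>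

lemma almost_invariant:
  assumes y: "\<bar>y\<bar> < \<delta>" and c: "0 < c" and lb: "\<And>x. c \<le> cmod (det (F (Complex x y)))"
  shows "\<bar>ln (norm (P n (Complex (x + \<beta>) y))) - ln (norm (P n (Complex x y)))\<bar> \<le> 2 * M - ln c"
    and "\<bar>ln (cmod (det (P n (Complex (x + \<beta>) y)))) - ln (cmod (det (P n (Complex x y))))\<bar> \<le> 2 * M - ln c"
proof -
  let ?z = "Complex x y" and ?z' = "Complex (x + \<beta>) y" and ?zn = "Complex (x + real n * \<beta>) y"
  have pos: "norm (P n z) > 0" if "Im z = y" for z
  proof -
    have "0 < c ^ n" using c by simp
    also have "\<dots> \<le> cmod (det (P n (Complex (Re z) y)))" by (rule det_P_ge[OF c lb])
    finally have "det (P n z) \<noteq> 0" using that by (auto simp: complex_eq_iff)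
    then have "P n z \<noteq> 0" by (auto simp: det_2)
    then show ?thesis by simp
  qed
  have e1: "P (Suc n) ?z = P n ?z' ** F ?z"
    using ccocycle_add[of \<beta> F n 1 ?z] Complex_add_of_real[of x y \<beta>] by (simp add: add.commute)
  have e2: "P (Suc n) ?z = F ?zn ** P n ?z"
    using Complex_add_of_real[of x y "real n * \<beta>"] by (simp del: of_real_mult)
  have b: "norm (F ?z) \<le> exp M" "norm (F ?zn) \<le> exp M" using bnd y by auto
  have "norm (P n ?z') * c \<le> norm (P n ?z') * cmod (det (F ?z))" using lb by (intro mult_left_mono) auto
  also have "\<dots> \<le> norm (P (Suc n) ?z) * norm (F ?z)" unfolding e1 by (rule norm_mult_det_right_le)
  also have "\<dots> \<le> (norm (F ?zn) * norm (P n ?z)) * norm (F ?z)"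
    unfolding e2 by (intro mult_right_mono norm_matrix_mult_le) auto
  also have "\<dots> \<le> (exp M * norm (P n ?z)) * exp M" using b by (intro mult_mono) auto
  finally have "ln (norm (P n ?z') * c) \<le> ln (exp M * norm (P n ?z) * exp M)"
    using pos[of ?z'] c by (intro ln_mono) auto
  then have A: "ln (norm (P n ?z')) + ln c \<le> 2 * M + ln (norm (P n ?z))"
    using pos[of ?z] pos[of ?z'] c by (simp add: ln_mult)
  have "c * norm (P n ?z) \<le> cmod (det (F ?zn)) * norm (P n ?z)" using lb by (intro mult_right_mono) auto
  also have "\<dots> \<le> norm (F ?zn) * norm (P (Suc n) ?z)" unfolding e2 by (rule norm_mult_det_left_le)
  also have "\<dots> \<le> norm (F ?zn) * (norm (P n ?z') * norm (F ?z))"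
    unfolding e1 by (intro mult_left_mono norm_matrix_mult_le) auto
  also have "\<dots> \<le> exp M * (norm (P n ?z') * exp M)" using b by (intro mult_mono) auto
  finally have "ln (c * norm (P n ?z)) \<le> ln (exp M * (norm (P n ?z') * exp M))"
    using pos[of ?z] c by (intro ln_mono) auto
  then have B: "ln c + ln (norm (P n ?z)) \<le> 2 * M + ln (norm (P n ?z'))"
    using pos[of ?z] pos[of ?z'] c by (simp add: ln_mult)
  from A B show "\<bar>ln (norm (P n ?z')) - ln (norm (P n ?z))\<bar> \<le> 2 * M - ln c" by linarith
  have nz: "det (F (Complex x y)) \<noteq> 0" "det (P n (Complex x y)) \<noteq> 0" for x
    using less_le_trans[OF c lb[of x]] less_le_trans[OF zero_less_power[OF c, of n] det_P_ge[OF c lb, of n x]]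
    by (simp_all only: zero_less_norm_iff not_False_eq_True)
  have "det (P n ?z') * det (F ?z) = det (F ?zn) * det (P n ?z)"
    using arg_cong[OF trans[OF e1[symmetric] e2], of det] by (simp only: det_mul)
  then have "ln (cmod (det (P n ?z')) * cmod (det (F ?z))) = ln (cmod (det (F ?zn)) * cmod (det (P n ?z)))"
    by (simp only: flip: norm_mult)
  then have eq: "ln (cmod (det (P n ?z'))) + ln (cmod (det (F ?z))) = ln (cmod (det (F ?zn))) + ln (cmod (det (P n ?z)))"
    using nz by (simp add: ln_mult)
  have lnb: "ln c \<le> ln (cmod (det (F (Complex x y)))) \<and> ln (cmod (det (F (Complex x y)))) \<le> 2 * M" for x
  proof
    show "ln c \<le> ln (cmod (det (F (Complex x y))))" using c lb by (intro ln_mono) auto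
    have "ln (cmod (det (F (Complex x y)))) \<le> ln (exp (2 * M))"
      using nz det_le_exp[of "Complex x y"] y by (intro ln_mono) auto
    then show "ln (cmod (det (F (Complex x y)))) \<le> 2 * M" by simp
  qed
  show "\<bar>ln (cmod (det (P n ?z'))) - ln (cmod (det (P n ?z)))\<bar> \<le> 2 * M - ln c"
    using eq lnb[of x] lnb[of "x + real n * \<beta>"] by linarith
qed

lemma hol_family_det_P: "hol_family \<delta> UNIV (\<lambda>_::unit. \<lambda>z. det (P n z))"
  by unfold_locales (auto simp: \<delta> det_2 per_P intro!: holomorphic_intros hol_P)

lemma family_normsq_det_P: "hol_family.normsq UNIV (\<lambda>_::unit. \<lambda>z. det (P n z)) z = (cmod (det (P n z)))\<^sup>2"
  unfolding hol_family.normsq_def[OF hol_family_det_P] by simp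

end

section \<open>Selecting a line of near-constancy\<close>

context qp_cocycle
begin

lemma ln_det_ge:
  assumes c: "0 < c" and lb: "\<And>x. c \<le> cmod (det (F (Complex x y)))" and n: "1 \<le> n"
  shows "real n * ln c \<le> ln (cmod (det (P n (Complex x y))))"
proof -
  have "ln (c ^ n) \<le> ln (cmod (det (P n (Complex x y))))"
    using det_P_ge[OF c lb, of n x] c by (intro ln_mono) auto
  then show ?thesis using c by (simp add: ln_realpow)
qed

text \<open>After division by \<open>n\<close> both logarithms lie in ranges that do not depend on
  \<open>n\<close>; the energy estimate relies on this uniformity.\<close>

lemma ln_P_bounds:
  assumes y: "\<bar>y\<bar> < \<delta>" and c: "0 < c" and lb: "\<And>x. c \<le> cmod (det (F (Complex x y)))" and n: "1 \<le> n"
  shows "P n (Complex x y) \<noteq> 0" and "det (P n (Complex x y)) \<noteq> 0"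
    and "ln c \<le> (1 / real n) * ln ((norm (P n (Complex x y)))\<^sup>2)"
    and "(1 / real n) * ln ((norm (P n (Complex x y)))\<^sup>2) \<le> 2 * M"
    and "2 * ln c \<le> (1 / real n) * ln ((cmod (det (P n (Complex x y))))\<^sup>2)"
    and "(1 / real n) * ln ((cmod (det (P n (Complex x y))))\<^sup>2) \<le> 4 * M"
proof -
  let ?P = "P n (Complex x y)"
  have d: "0 < cmod (det ?P)" using det_P_ge[OF c lb, of n x] zero_less_power[OF c, of n] by linarith
  then show dn: "det ?P \<noteq> 0" by simp
  then show pn: "?P \<noteq> 0" by (auto simp: det_2)
  have 1: "real n * ln c \<le> ln (cmod (det ?P))" by (rule ln_det_ge[OF c lb n])
  have 2: "ln (cmod (det ?P)) \<le> 2 * ln (norm ?P)"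
  proof -
    have "ln (cmod (det ?P)) \<le> ln ((norm ?P)\<^sup>2)" using d half_det_le[of ?P] by (intro ln_mono) auto
    then show ?thesis by (simp add: ln_power2)
  qed
  have 3: "ln (norm ?P) \<le> real n * M"
  proof -
    have "ln (norm ?P) \<le> ln (exp (real n * M))"
      using pn norm_P_le[of "Complex x y" n] y n by (intro ln_mono) auto
    then show ?thesis by simp
  qed
  have n0: "real n > 0" using n by simp
  show "ln c \<le> (1 / real n) * ln ((norm ?P)\<^sup>2)" "(1 / real n) * ln ((norm ?P)\<^sup>2) \<le> 2 * M"
    "2 * ln c \<le> (1 / real n) * ln ((cmod (det ?P))\<^sup>2)" "(1 / real n) * ln ((cmod (det ?P))\<^sup>2) \<le> 4 * M"
    unfolding ln_power2 using 1 2 3 n0 by (simp_all add: field_simps)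
qed

text \<open>One common line has to serve three functions: the growth of the norm at the lengths
  \<open>n\<close> and \<open>2 * n\<close>, for almost multiplicativity, and of the determinant at
  length \<open>n\<close>, for the dichotomy.\<close>

abbreviation "flat n y \<eta> \<equiv> (\<forall>x x'.
    \<bar>ln (norm (P n (Complex x y))) / real n - ln (norm (P n (Complex x' y))) / real n\<bar> \<le> \<eta> \<and>
    \<bar>ln (norm (P (2 * n) (Complex x y))) / real (2 * n) - ln (norm (P (2 * n) (Complex x' y))) / real (2 * n)\<bar> \<le> \<eta> \<and>
    \<bar>ln (cmod (det (P n (Complex x y)))) / real n - ln (cmod (det (P n (Complex x' y)))) / real n\<bar> \<le> \<eta>)"

text \<open>In \<open>E\<close> the first summand pays for at most \<open>K\<close> steps along the
  orbit, each costing \<open>2 * R / real n\<close>; the rest is the energy part of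
  \<open>oscillation_le\<close>, with the energy bound for 3 functions with values between 0 and
  \<open>2 * R\<close>. The final \<open>E / 2\<close> appears because \<open>w\<close> is built
  from logarithms of squares.\<close>

lemma exists_line_near_constant:
  assumes y0: "\<bar>y0\<bar> + r < \<delta>" and c: "0 < c" and lb: "\<And>x y. \<bar>y - y0\<bar> \<le> r \<Longrightarrow> c \<le> cmod (det (F (Complex x y)))"
    and ab: "a < b" "y0 - r \<le> a" "b \<le> y0 + r" and n: "1 \<le> n"
    and \<theta>: "\<theta> > 0" and s: "s \<le> 1" and K: "\<And>t. \<exists>k\<le>K. \<exists>h::int. \<bar>real k * \<beta> - real_of_int h - t\<bar> \<le> s"
  defines "R \<equiv> 2 * M - ln c"
  defines "E \<equiv> real K * (2 * R / real n) + (\<theta> * (2 * (16 * (3 * (2 * R)\<^sup>2) / (b - a)\<^sup>2 + 1)) + s / \<theta>)"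
  shows "\<exists>y. a < y \<and> y < b \<and> flat n y (E / 2)"
proof -
  have ys: "\<bar>y\<bar> < \<delta>" and lb': "\<And>x. c \<le> cmod (det (F (Complex x y)))" if "a < y" "y < b" for y
    using that ab y0 lb[of y] by auto
  have abs: "- \<delta> \<le> a" "b \<le> \<delta>" using ab y0 by auto
  \<comment> \<open>The additive constants make all three functions nonnegative. The determinant has
    the widest range, of length \<open>4 * M - 2 * ln c = 2 * R\<close>.\<close>
  define w where "w i x y = (if i = 0 then (1 / real n) * ln ((norm (P n (Complex x y)))\<^sup>2) + (- ln c)
     else if i = 1 then (1 / real (2 * n)) * ln ((norm (P (2 * n) (Complex x y)))\<^sup>2) + (- ln c)
     else (1 / real n) * ln ((cmod (det (P n (Complex x y))))\<^sup>2) + (- 2 * ln c))" for i :: nat and x y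
  have n2: "1 \<le> 2 * n" using n by simp
  note B = ln_P_bounds[OF ys c lb' n] and B2 = ln_P_bounds[OF ys c lb' n2]
  have R: "0 \<le> R"
  proof -
    have m: "a < (a + b) / 2" "(a + b) / 2 < b" using ab(1) by auto
    show ?thesis using B(3)[OF m m, of 0] B(4)[OF m m, of 0] unfolding R_def by linarith
  qed
  have Pn: "\<exists>wx wxx wy wyy. smooth_strip a b (\<lambda>x y. (1 / real k) * ln ((norm (P k (Complex x y)))\<^sup>2) + e) wx wxx wy wyy \<and>
      (\<forall>x y. a < y \<longrightarrow> y < b \<longrightarrow> wxx x y + wyy x y \<ge> 0)" if k: "1 \<le> k" for k e
    using hol_family.smooth_strip_scaled_ln_normsq[OF hol_family_P[of k] abs, of "1 / real k" e]
      ln_P_bounds(1)[OF ys c lb' k]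
    by (simp add: family_normsq[OF hol_family_P])
  have Dn: "\<exists>wx wxx wy wyy. smooth_strip a b (\<lambda>x y. (1 / real n) * ln ((cmod (det (P n (Complex x y))))\<^sup>2) + e) wx wxx wy wyy \<and>
      (\<forall>x y. a < y \<longrightarrow> y < b \<longrightarrow> wxx x y + wyy x y \<ge> 0)" for e
    using hol_family.smooth_strip_scaled_ln_normsq[OF hol_family_det_P[of n] abs, of "1 / real n" e] B(2)
    by (simp add: family_normsq_det_P)
  have "\<forall>i\<in>{0,1,2::nat}. \<exists>wx wxx wy wyy. smooth_strip a b (w i) wx wxx wy wyy \<and>
      (\<forall>x y. a < y \<longrightarrow> y < b \<longrightarrow> wxx x y + wyy x y \<ge> 0)"
    unfolding w_def using Pn[OF n, of "- ln c"] Pn[OF n2, of "- ln c"] Dn[of "- 2 * ln c"] by auto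
  then obtain wx wxx wy wyy where sm: "\<And>i. i \<in> {0,1,2::nat} \<Longrightarrow> smooth_strip a b (w i) (wx i) (wxx i) (wy i) (wyy i)"
    and lap: "\<And>i x y. i \<in> {0,1,2::nat} \<Longrightarrow> a < y \<Longrightarrow> y < b \<Longrightarrow> wxx i x y + wyy i x y \<ge> 0"
    by metis
  have bnd: "0 \<le> w i x y \<and> w i x y \<le> 2 * R" if y: "a < y" "y < b" for i x y
    using B(3)[OF y y, of x] B(4)[OF y y, of x] B2(3)[OF y y, of x] B2(4)[OF y y, of x] B(5)[OF y y, of x] B(6)[OF y y, of x] R
    unfolding w_def R_def by auto
  obtain y where y: "a < y" "y < b" and
    V: "\<And>i. i \<in> {0,1,2::nat} \<Longrightarrow> integral {0..1} (\<lambda>x. (wx i x y)\<^sup>2) \<le> 16 * (3 * (2 * R)\<^sup>2) / (b - a)\<^sup>2 + 1"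
  proof -
    have "\<exists>y. a < y \<and> y < b \<and> (\<forall>i\<in>{0,1,2::nat}. integral {0..1} (\<lambda>x. (wx i x y)\<^sup>2) \<le>
        16 * (real (card {0,1,2::nat}) * (2 * R)\<^sup>2) / (b - a)\<^sup>2 + 1)"
      by (rule exists_line_bounded_energy[OF _ ab(1) sm lap bnd]) auto
    moreover have "card {0,1,2::nat} = 3" by simp
    ultimately show ?thesis using that by (metis of_nat_numeral)
  qed
  have inv: "\<bar>w i (x + \<beta>) y - w i x y\<bar> \<le> 2 * R / real n" for i x
  proof -
    note A = almost_invariant[OF ys[OF y] c lb'[OF y]]
    have q: "\<bar>(1 / real k) * (2 * u) - (1 / real k) * (2 * v)\<bar> \<le> 2 * R / real n"
      if "\<bar>u - v\<bar> \<le> 2 * M - ln c" "n \<le> k" for u v k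
    proof -
      have k: "real k > 0" "real n > 0" using that n by auto
      have "\<bar>(1 / real k) * (2 * u) - (1 / real k) * (2 * v)\<bar> = 2 * \<bar>u - v\<bar> / real k"
      proof -
        have "(1 / real k) * (2 * u) - (1 / real k) * (2 * v) = 2 * (u - v) / real k"
          using k by (simp add: field_simps)
        then show ?thesis by (simp only: abs_mult abs_divide abs_numeral abs_of_nat)
      qed
      also have "\<dots> \<le> 2 * R / real k" unfolding R_def using that(1) k by (intro divide_right_mono) auto
      also have "\<dots> \<le> 2 * R / real n" using that(2) k R by (intro divide_left_mono) auto
      finally show ?thesis .
    qed
    show ?thesis
      using q[OF A(1)[where n = n and x = x], of n] q[OF A(1)[where n = "2 * n" and x = x], of "2 * n"]
        q[OF A(2)[where n = n and x = x], of n]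
      unfolding w_def ln_power2 by auto
  qed
  have osc: "\<bar>w i x y - w i x' y\<bar> \<le> E" if i: "i \<in> {0,1,2::nat}" for i x x'
    unfolding E_def
  proof (rule oscillation_le[where w = "\<lambda>x. w i x y" and w' = "\<lambda>x. wx i x y" and \<beta> = \<beta>])
    note d = smooth_stripD[OF sm[OF i]]
    show "((\<lambda>x. w i x y) has_real_derivative wx i x y) (at x)" for x by (rule d(1)[OF y])
    show "continuous_on UNIV (\<lambda>x. wx i x y)" by (rule smooth_strip_slice_continuous[OF d(8) y])
    show "w i (x + 1) y = w i x y" "wx i (x + 1) y = wx i x y" for x using d(5,6) y by auto
  qed (use V[OF i] \<theta> inv s K in auto)
  have h: "\<bar>(1 / k) * (2 * u) - (1 / k) * (2 * v)\<bar> \<le> E \<Longrightarrow> \<bar>u / k - v / k\<bar> \<le> E / 2" for u v k :: real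
  proof -
    have "(1 / k) * (2 * u) - (1 / k) * (2 * v) = 2 * (u / k - v / k)" by simp
    then show "\<bar>(1 / k) * (2 * u) - (1 / k) * (2 * v)\<bar> \<le> E \<Longrightarrow> ?thesis" by (simp only: abs_mult) simp
  qed
  have "flat n y (E / 2)"
    using osc[of 0] osc[of 1] osc[of 2] by (intro allI conjI h) (simp_all add: w_def ln_power2)
  with y show ?thesis by blast
qed

text \<open>The parameters are chosen in the order forced by \<open>E\<close>:
  \<open>\<theta>\<close> against the energy bound \<open>C\<close>, then the distance
  \<open>s\<close> against \<open>\<theta>\<close>, then \<open>K\<close> from \<open>s\<close>, and
  last \<open>n\<close> against \<open>K\<close>. The three summands are at most
  \<open>\<eta> / 2\<close>, \<open>\<eta> / 2\<close> and \<open>\<eta>\<close>, so that half of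
  their sum is at most \<open>\<eta>\<close>.\<close>

lemma eventually_exists_line_near_constant:
  assumes \<beta>: "\<beta> \<notin> \<rat>" and y0: "\<bar>y0\<bar> + r < \<delta>" and c: "0 < c"
    and lb: "\<And>x y. \<bar>y - y0\<bar> \<le> r \<Longrightarrow> c \<le> cmod (det (F (Complex x y)))"
    and ab: "a < b" "y0 - r \<le> a" "b \<le> y0 + r" and \<eta>: "\<eta> > 0"
  shows "\<exists>N. \<forall>n\<ge>N. \<exists>y. a < y \<and> y < b \<and> flat n y \<eta>"
proof -
  define R where "R = 2 * M - ln c"
  define C where "C = 16 * (3 * (2 * R)\<^sup>2) / (b - a)\<^sup>2 + 1"
  have C: "C \<ge> 1" unfolding C_def by simp
  define \<theta> where "\<theta> = \<eta> / (4 * C)"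
  have \<theta>: "\<theta> > 0" "\<theta> * (2 * C) = \<eta> / 2" unfolding \<theta>_def using \<eta> C by (auto simp: field_simps)
  define s where "s = min 1 (\<theta> * \<eta>)"
  have s: "s > 0" "s \<le> 1" "s / \<theta> \<le> \<eta>" using \<theta> \<eta> unfolding s_def by (auto simp: pos_divide_le_eq mult.commute min_le_iff_disj)
  obtain K :: nat where K: "\<And>t. \<exists>k\<le>K. \<exists>h::int. \<bar>real k * \<beta> - real_of_int h - t\<bar> \<le> s"
    using irrational_orbit_dense[OF \<beta> s(1)] by blast
  obtain N0 :: nat where N0: "real N0 > 4 * (real K * \<bar>R\<bar>) / \<eta>" using reals_Archimedean2 by blast
  show ?thesis
  proof (intro exI[of _ "Suc N0"] allI impI)
    fix n assume n: "Suc N0 \<le> n"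
    then have n1: "1 \<le> n" and n0: "real n > 0" by auto
    have "4 * (real K * \<bar>R\<bar>) \<le> \<eta> * real N0" using N0 \<eta> by (simp add: field_simps)
    also have "\<dots> \<le> \<eta> * real n" using n \<eta> by (intro mult_left_mono) auto
    finally have KR: "4 * (real K * \<bar>R\<bar>) \<le> \<eta> * real n" .
    have "real K * (2 * R / real n) \<le> \<eta> / 2"
    proof -
      have "real K * R \<le> real K * \<bar>R\<bar>" by (intro mult_left_mono) auto
      then show ?thesis using KR n0 by (simp add: field_simps)
    qed
    with \<theta> s have "real K * (2 * R / real n) + (\<theta> * (2 * C) + s / \<theta>) \<le> 2 * \<eta>" by linarith
    moreover have "t / 2 \<le> \<eta>" if "t \<le> 2 * \<eta>" for t using that by simp
    ultimately have E: "(real K * (2 * R / real n) + (\<theta> * (2 * C) + s / \<theta>)) / 2 \<le> \<eta>" by blast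
    show "\<exists>y. a < y \<and> y < b \<and> flat n y \<eta>"
      using exists_line_near_constant[OF y0 c lb ab n1 \<theta>(1) s(2) K, folded R_def, folded C_def] E
      by (meson order_trans)
  qed
qed

end

section \<open>Lower semicontinuity on lines without zeros\<close>

context qp_cocycle
begin

text \<open>The limit over all lengths exists already, so multiples of \<open>n\<close> suffice to
  bound it.\<close>

lemma clyap_ge_pointwise:
  assumes y: "\<bar>y\<bar> < \<delta>" and n: "1 \<le> n"
    and le: "\<And>m x. real (n * Suc m) * g \<le> ln (norm (P (n * Suc m) (Complex x y)))"
  shows "g \<le> clyap \<beta> F y"
proof -
  have sm: "strict_mono (\<lambda>m. n * Suc m)" using n by (auto simp: strict_mono_Suc_iff)
  have "(\<lambda>m. cmean \<beta> F (n * Suc m) y / real (n * Suc m)) \<longlonglongrightarrow> clyap \<beta> F y"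
    using LIMSEQ_subseq_LIMSEQ[OF clyap_limit(1)[OF y] sm] by (simp add: o_def)
  then show ?thesis
  proof (rule LIMSEQ_le_const, intro exI[of _ 0] allI impI)
    fix m
    have "integral {0..1} (\<lambda>x::real. real (n * Suc m) * g) \<le> cmean \<beta> F (n * Suc m) y"
      unfolding cmean_def by (intro integral_le cmean_integrable[OF y] le) auto
    then have "real (n * Suc m) * g \<le> cmean \<beta> F (n * Suc m) y" by simp
    moreover have "real (n * Suc m) > 0" using n by (simp del: of_nat_mult of_nat_Suc)
    ultimately show "g \<le> cmean \<beta> F (n * Suc m) y / real (n * Suc m)"
      by (simp only: pos_le_divide_eq mult.commute)
  qed
qed

text \<open>The logarithmic form of \<open>norm_product_ge\<close> for blocks of length
  \<open>n\<close>, with \<open>\<sigma> = exp (- (k * \<eta> * real n))\<close>. In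
  \<open>gap\<close>, \<open>2 * k\<close> accounts for \<open>\<sigma>\<^sup>2\<close> and the
  extra 1 absorbs the factor 4, by \<open>ln 4 \<le> \<eta> * real n\<close>. Each joint loses
  \<open>- ln (\<sigma> / 2)\<close>, at most \<open>(k + 1) * \<eta> * real n\<close>. All
  hypotheses concern the lengths \<open>n\<close> and \<open>2 * n\<close> only, hence survive
  perturbation.\<close>

lemma clyap_ge_of_uniform_growth:
  assumes y: "\<bar>y\<bar> < \<delta>" and n: "1 \<le> n" and \<eta>: "ln 4 \<le> \<eta> * real n"
    and nz: "\<And>x. P n (Complex x y) \<noteq> 0" "\<And>x. det (P n (Complex x y)) \<noteq> 0"
    and pair: "\<And>x. ln (norm (P n (Complex x y))) + ln (norm (P n (Complex (x + real n * \<beta>) y))) - k * \<eta> * real n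
      \<le> ln (norm (P (2 * n) (Complex x y)))"
    and nz2: "\<And>x. P (2 * n) (Complex x y) \<noteq> 0"
    and gap: "\<And>x. ln (cmod (det (P n (Complex x y)))) \<le> 2 * ln (norm (P n (Complex x y))) - (2 * k + 1) * \<eta> * real n"
    and lb: "\<And>x. real n * g \<le> ln (norm (P n (Complex x y)))" and k: "0 \<le> k"
  shows "g - (k + 1) * \<eta> \<le> clyap \<beta> F y"
proof (rule clyap_ge_pointwise[OF y n])
  fix m x
  define \<sigma> where "\<sigma> = exp (- (k * \<eta> * real n))"
  define B where "B j = P n (Complex (x + real (j * n) * \<beta>) y)" for j
  define Q where "Q j = P (n * Suc j) (Complex x y)" for j
  have \<sigma>: "0 < \<sigma>" unfolding \<sigma>_def by simp
  have B0: "B j \<noteq> 0" for j unfolding B_def by (rule nz)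
  have BB: "B (Suc j) ** B j = P (2 * n) (Complex (x + real (j * n) * \<beta>) y)" for j
  proof -
    have "P (n + n) (Complex (x + real (j * n) * \<beta>) y) = P n (Complex (x + real (j * n) * \<beta> + real n * \<beta>) y) ** B j"
      unfolding ccocycle_add Complex_add_of_real B_def ..
    moreover have "x + real (j * n) * \<beta> + real n * \<beta> = x + real (Suc j * n) * \<beta>" by (simp add: algebra_simps)
    ultimately show ?thesis unfolding B_def mult_2 by (simp only:)
  qed
  have "(\<sigma> / 2) ^ m * (\<Prod>j\<le>m. norm (B j)) \<le> norm (Q m)"
  proof (rule norm_product_ge[OF _ _ \<sigma> B0])
    show "Q 0 = B 0" unfolding Q_def B_def by simp
    show "Q (Suc j) = B (Suc j) ** Q j" for j
    proof -
      have "n * Suc (Suc j) = n + n * Suc j" by simp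
      then have "Q (Suc j) = P (n + n * Suc j) (Complex x y)" unfolding Q_def by (simp only:)
      also have "\<dots> = P n (Complex (x + real (n * Suc j) * \<beta>) y) ** P (n * Suc j) (Complex x y)"
        unfolding ccocycle_add Complex_add_of_real ..
      finally show ?thesis unfolding Q_def B_def by (simp only: mult.commute)
    qed
    show "\<sigma> * (norm (B (Suc j)) * norm (B j)) \<le> norm (B (Suc j) ** B j)" for j
    proof -
      have e: "x + real (j * n) * \<beta> + real n * \<beta> = x + real (Suc j * n) * \<beta>" by (simp add: algebra_simps)
      have "ln (\<sigma> * (norm (B (Suc j)) * norm (B j))) = ln (norm (B j)) + ln (norm (B (Suc j))) - k * \<eta> * real n"
        using \<sigma> B0 by (simp add: ln_mult \<sigma>_def)
      also have "\<dots> \<le> ln (norm (B (Suc j) ** B j))"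
        using pair[of "x + real (j * n) * \<beta>"] unfolding BB unfolding e B_def .
      finally show ?thesis
        using \<sigma> B0 nz2 by (subst (asm) ln_le_cancel_iff) (auto simp: BB)
    qed
    show "4 * cmod (det (B j)) \<le> \<sigma>\<^sup>2 * (norm (B j))\<^sup>2" for j
    proof -
      have d: "cmod (det (B j)) > 0" unfolding B_def using nz(2) by simp
      have "ln (4 * cmod (det (B j))) = ln 4 + ln (cmod (det (B j)))" using d by (subst ln_mult) auto
      also have "\<dots> \<le> \<eta> * real n + (2 * ln (norm (B j)) - (2 * k + 1) * \<eta> * real n)"
        using \<eta> gap[of "x + real (j * n) * \<beta>"] unfolding B_def by (intro add_mono)
      also have "\<dots> = ln (\<sigma>\<^sup>2 * (norm (B j))\<^sup>2)"
        using \<sigma> B0 by (simp add: ln_mult ln_power2) (simp add: \<sigma>_def algebra_simps)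
      finally show ?thesis
        using \<sigma> B0 d by (subst (asm) ln_le_cancel_iff) auto
    qed
  qed
  moreover have pos: "(\<sigma> / 2) ^ m > 0" "(\<Prod>j\<le>m. norm (B j)) > 0" using \<sigma> B0 by (auto intro: prod_pos)
  ultimately have "ln ((\<sigma> / 2) ^ m * (\<Prod>j\<le>m. norm (B j))) \<le> ln (norm (Q m))" 
    by (intro ln_mono) (auto intro: less_le_trans mult_pos_pos)
  then have le: "real m * ln (\<sigma> / 2) + (\<Sum>j\<le>m. ln (norm (B j))) \<le> ln (norm (Q m))"
    using pos \<sigma> B0 by (simp add: ln_mult ln_realpow ln_prod)
  have ln2: "ln (2::real) \<le> \<eta> * real n"
  proof -
    have "ln (2::real) \<le> ln 4" by (intro ln_mono) auto
    with \<eta> show ?thesis by linarith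
  qed
  then have En: "0 \<le> \<eta> * real n" using ln_ge_zero[of 2] by linarith
  have "- ((k + 1) * \<eta> * real n) \<le> ln (\<sigma> / 2)"
    using \<sigma> ln2 by (simp add: ln_div \<sigma>_def algebra_simps)
  then have "real m * (- ((k + 1) * \<eta> * real n)) \<le> real m * ln (\<sigma> / 2)" by (intro mult_left_mono) auto
  \<comment> \<open>There are \<open>Suc m\<close> blocks but only \<open>m\<close> joints; counting
    one more nonnegative loss makes the bound proportional to the total length.\<close>
  moreover have "real (Suc m) * (- ((k + 1) * \<eta> * real n)) \<le> real m * (- ((k + 1) * \<eta> * real n))"
    using k En by (intro mult_right_mono_neg) (auto simp: mult.assoc)
  moreover have "real (Suc m) * (real n * g) \<le> (\<Sum>j\<le>m. ln (norm (B j)))"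
    using sum_mono[of "{..m}" "\<lambda>_. real n * g" "\<lambda>j. ln (norm (B j))"] lb unfolding B_def by simp
  ultimately have "real (Suc m) * (- ((k + 1) * \<eta> * real n)) + real (Suc m) * (real n * g) \<le> ln (norm (Q m))"
    using le by linarith
  then show "real (n * Suc m) * (g - (k + 1) * \<eta>) \<le> ln (norm (P (n * Suc m) (Complex x y)))"
    unfolding Q_def by (simp add: algebra_simps)
qed

lemma dmean_P:
  assumes y: "\<bar>y\<bar> < \<delta>" and n: "1 \<le> n" and nz: "\<And>x. det (F (Complex x y)) \<noteq> 0"
  shows "((\<lambda>x. ln (cmod (det (P n (Complex x y)))) / real n) has_integral dmean F y) {0..1}"
proof -
  have "Complex x y \<notin> Z" for x using nz unfolding Z_def mem_Collect_eq Complex_add_of_real by blast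
  then have "ln (cmod (det (P n (Complex x y)))) = (\<Sum>j<n. ln (cmod (det (F (Complex (x + real j * \<beta>) y)))))" for x
    using ln_det_P[of "Complex x y" n] y unfolding Complex_add_of_real by simp
  then show ?thesis
    using has_integral_divide[OF sum_dmean_shift[OF y, of n], of "real n"] n by simp
qed

lemma dmean_lsc_on_line:
  assumes y: "\<bar>y\<bar> < \<delta>" and nz: "\<And>x. det (F (Complex x y)) \<noteq> 0" and e: "e > 0"
  shows "\<exists>d>0. \<forall>F'. near d F' \<longrightarrow>
    dmean F y - e \<le> dmean F' y"
proof -
  obtain r c where r: "0 < r" and c: "0 < c"
    and lb': "\<And>x y'. \<bar>y' - y\<bar> \<le> r \<Longrightarrow> c \<le> cmod (det (F (Complex x y')))"
    using det_tube[OF y nz] by blast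
  have lb: "c \<le> cmod (det (F (Complex x y)))" for x using lb'[of y] r by simp
  obtain d where d: "d > 0" "\<And>F' x. near d F' \<Longrightarrow>
      \<bar>ln (cmod (det (ccocycle \<beta> F' 1 (Complex x y)))) - ln (cmod (det (P 1 (Complex x y))))\<bar> \<le> e"
    using near_imp_log_close[OF y c lb e, of 1] by blast
  show ?thesis
  proof (intro exI[of _ d] conjI allI impI d(1))
    fix F' assume "near d F'"
    then have F': "qp_cocycle \<delta> M F'"
      and cl: "\<forall>z. \<bar>Im z\<bar> < \<delta> \<longrightarrow> norm (F' z - F z) \<le> d" by auto
    have "integral {0..1} (\<lambda>x. ln (cmod (det (F (Complex x y)))) - e) \<le> dmean F' y"
      unfolding dmean_def
    proof (rule integral_le)
      show "(\<lambda>x. ln (cmod (det (F (Complex x y)))) - e) integrable_on {0..1}"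
        by (intro integrable_diff dmean_integrable[OF y]) auto
      show "(\<lambda>x. ln (cmod (det (F' (Complex x y))))) integrable_on {0..1}"
        by (rule qp_cocycle.dmean_integrable[OF F' y])
      show "ln (cmod (det (F (Complex x y)))) - e \<le> ln (cmod (det (F' (Complex x y))))" for x
        using d(2)[OF conjI[OF F' cl], of x] by (simp add: abs_le_iff)
    qed
    moreover have "integral {0..1} (\<lambda>x. ln (cmod (det (F (Complex x y)))) - e) = dmean F y - e"
      unfolding dmean_def by (subst integral_diff) (auto intro: dmean_integrable[OF y])
    ultimately show "dmean F y - e \<le> dmean F' y" by simp
  qed
qed

text \<open>The height \<open>y\<close> cannot be prescribed, because it is produced by the energy
  estimate for one large \<open>n\<close>; it can only be kept within \<open>\<rho>\<close> of
  \<open>y0\<close>. Both exponents are then compared at this same \<open>y\<close>.\<close>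

lemma clyap_lsc_on_line:
  assumes \<beta>: "\<beta> \<notin> \<rat>" and y0: "\<bar>y0\<bar> < \<delta>" and nz: "\<And>x. det (F (Complex x y0)) \<noteq> 0"
    and e: "e > 0" and \<rho>: "\<rho> > 0"
  shows "\<exists>y. \<bar>y - y0\<bar> < \<rho> \<and> \<bar>y\<bar> < \<delta> \<and> (\<exists>d>0. \<forall>F'. near d F' \<longrightarrow> clyap \<beta> F y - e \<le> clyap \<beta> F' y)"
proof -
  \<comment> \<open>The two cases below lose at most \<open>16 * \<eta>\<close> and
    \<open>17 * \<eta>\<close>, so \<open>20 * \<eta>\<close> leaves room.\<close>
  define \<eta> where "\<eta> = e / 20"
  have \<eta>: "\<eta> > 0" "e = 20 * \<eta>" unfolding \<eta>_def using e by auto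
  obtain r c where r: "0 < r" "\<bar>y0\<bar> + r < \<delta>" and c: "0 < c"
    and lb: "\<And>x y. \<bar>y - y0\<bar> \<le> r \<Longrightarrow> c \<le> cmod (det (F (Complex x y)))"
    using det_tube[OF y0 nz] by blast
  have ys: "\<bar>y\<bar> < \<delta>" if "\<bar>y - y0\<bar> \<le> r" for y using that r by linarith
  define M0 where "M0 = M + \<bar>ln c\<bar>"
  have M0: "\<bar>cmean \<beta> F n y / real n\<bar> \<le> M0" if y: "\<bar>y - y0\<bar> \<le> r" and n: "1 \<le> n" for n y
  proof -
    have "ln c \<le> dmean F y"
    proof -
      have "integral {0..1} (\<lambda>x::real. ln c) \<le> dmean F y"
        unfolding dmean_def using lb[OF y] c
        by (intro integral_le dmean_integrable[OF ys[OF y]] ln_mono) auto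
      then show ?thesis by simp
    qed
    moreover have "dmean F y / 2 \<le> cmean \<beta> F n y / real n"
      using cmean_ge_dmean[OF ys[OF y], of n] n by (simp add: pos_le_divide_eq)
    moreover have "cmean \<beta> F n y / real n \<le> M"
      using cmean_le[OF ys[OF y] n] n by (simp add: pos_divide_le_eq mult.commute)
    ultimately show ?thesis unfolding M0_def using M by linarith
  qed
  have M0pos: "0 \<le> M0" unfolding M0_def using M by simp
  have lip: "\<bar>cmean \<beta> F n y / real n - cmean \<beta> F n y0 / real n\<bar> \<le> 2 * M0 / r * \<bar>y - y0\<bar>"
    if y: "\<bar>y - y0\<bar> \<le> r" and n: "1 \<le> n" for n y
  proof (rule convex_bound_lipschitz[OF _ r(1) _ y])
    have "convex_on {y0 - r..y0 + r} (cmean \<beta> F n)"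
      by (rule convex_on_subset[OF cmean_convex]) (use r in auto)
    then have "convex_on {y0 - r..y0 + r} (\<lambda>y. (1 / real n) * cmean \<beta> F n y)"
      by (intro convex_on_cmul) auto
    then show "convex_on {y0 - r..y0 + r} (\<lambda>y. cmean \<beta> F n y / real n)" by simp
    show "\<bar>cmean \<beta> F n y / real n\<bar> \<le> M0" if "y \<in> {y0 - r..y0 + r}" for y
      using M0[OF _ n, of y] that by (simp add: abs_le_iff)
  qed
  \<comment> \<open>So narrow that, by the Lipschitz bound, the means of all lengths change by at
    most \<open>\<eta>\<close> between \<open>y0\<close> and \<open>y\<close>. The summand 1 keeps
    the denominator positive when \<open>M0 = 0\<close>.\<close>
  define r2 where "r2 = min (min r \<rho>) (\<eta> * r / (2 * M0 + 1))"
  have r2: "0 < r2" "r2 \<le> r" "r2 \<le> \<rho>" "2 * M0 / r * r2 \<le> \<eta>"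
  proof -
    show "0 < r2" unfolding r2_def using r \<rho> \<eta> M0pos by simp
    show "r2 \<le> r" "r2 \<le> \<rho>" unfolding r2_def by auto
    have "2 * M0 / r * r2 \<le> 2 * M0 / r * (\<eta> * r / (2 * M0 + 1))"
      unfolding r2_def using M0pos r by (intro mult_left_mono) auto
    also have "\<dots> = \<eta> * (2 * M0 / (2 * M0 + 1))" using r by simp
    also have "\<dots> \<le> \<eta> * 1" using \<eta> M0pos by (intro mult_left_mono) auto
    finally show "2 * M0 / r * r2 \<le> \<eta>" by simp
  qed
  obtain N1 where N1: "\<And>n. N1 \<le> n \<Longrightarrow> \<bar>cmean \<beta> F n y0 / real n - clyap \<beta> F y0\<bar> < \<eta> / 2"
    using LIMSEQ_D[OF clyap_limit(1)[OF y0], of "\<eta> / 2"] \<eta> by auto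
  obtain N2 where N2: "\<And>n. N2 \<le> n \<Longrightarrow> \<exists>y. y0 - r2 < y \<and> y < y0 + r2 \<and> flat n y \<eta>"
    using eventually_exists_line_near_constant[OF \<beta> r(2) c lb, of "y0 - r2" "y0 + r2" \<eta>] r2 \<eta> by auto
  obtain N3 :: nat where N3: "real N3 > ln 4 / \<eta>" using reals_Archimedean2 by blast
  define n where "n = Suc (N1 + N2 + N3)"
  have n: "N1 \<le> n" "N1 \<le> 2 * n" "N2 \<le> n" "1 \<le> n" "1 \<le> 2 * n" unfolding n_def by auto
  have n0: "real n > 0" using n by simp
  have "ln 4 \<le> \<eta> * real N3" using N3 \<eta> by (simp add: field_simps)
  also have "\<dots> \<le> \<eta> * real n" using \<eta> unfolding n_def by (intro mult_left_mono) auto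
  finally have ln4: "ln 4 \<le> \<eta> * real n" .
  obtain y where y: "y0 - r2 < y" "y < y0 + r2" and osc: "flat n y \<eta>"
    using N2[OF n(3)] by blast
  have yr: "\<bar>y - y0\<bar> \<le> r2" "\<bar>y - y0\<bar> \<le> r" "\<bar>y - y0\<bar> < \<rho>" using y r2 by auto
  have yd: "\<bar>y\<bar> < \<delta>" by (rule ys[OF yr(2)])
  have lby: "c \<le> cmod (det (F (Complex x y)))" for x by (rule lb[OF yr(2)])
  have nzy: "det (F (Complex x y)) \<noteq> 0" for x using lby[of x] c by auto
  define g where "g = cmean \<beta> F n y / real n"
  have lipy: "\<bar>cmean \<beta> F k y / real k - cmean \<beta> F k y0 / real k\<bar> \<le> \<eta>" if "1 \<le> k" for k
  proof -
    have "2 * M0 / r * \<bar>y - y0\<bar> \<le> 2 * M0 / r * r2" using yr(1) M0pos r by (intro mult_left_mono) auto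
    then show ?thesis using lip[OF yr(2) that] r2(4) by linarith
  qed
  have mean_near: "\<bar>ln (norm (P k (Complex x y))) / real k - cmean \<beta> F k y / real k\<bar> \<le> \<eta>"
    if "\<And>x x'. \<bar>ln (norm (P k (Complex x y))) / real k - ln (norm (P k (Complex x' y))) / real k\<bar> \<le> \<eta>" for k x
  proof -
    have i: "((\<lambda>x. ln (norm (P k (Complex x y))) / real k) has_integral cmean \<beta> F k y / real k) {0..1}"
      unfolding cmean_def by (intro has_integral_divide integrable_integral cmean_integrable[OF yd])
    show ?thesis
      using integral_near_value[OF has_integral_integrable[OF i] that, of x] unfolding integral_unique[OF i] .
  qed
  have v1: "\<bar>ln (norm (P n (Complex x y))) / real n - g\<bar> \<le> \<eta>" for x
    unfolding g_def using osc by (intro mean_near) blast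
  have v2: "\<bar>ln (norm (P (2 * n) (Complex x y))) / real (2 * n) - cmean \<beta> F (2 * n) y / real (2 * n)\<bar> \<le> \<eta>" for x
    using osc by (intro mean_near) blast
  have d1: "\<bar>ln (cmod (det (P n (Complex x y)))) / real n - dmean F y\<bar> \<le> \<eta>" for x
    using integral_near_value[OF has_integral_integrable[OF dmean_P[OF yd n(4) nzy]], of \<eta> x] osc
      integral_unique[OF dmean_P[OF yd n(4) nzy]] by simp
  \<comment> \<open>From length \<open>n\<close> at \<open>y\<close> to length \<open>n\<close> at
    \<open>y0\<close>, on to length \<open>2 * n\<close> at \<open>y0\<close>, and back to
    \<open>y\<close>: each passage costs at most \<open>\<eta>\<close>.\<close>
  have g2: "g - 3 * \<eta> \<le> cmean \<beta> F (2 * n) y / real (2 * n)"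
    using lipy[OF n(4)] lipy[OF n(5)] N1[OF n(1)] N1[OF n(2)] unfolding g_def by linarith
  have gn: "clyap \<beta> F y \<le> g" unfolding g_def by (rule clyap_limit(2)[OF yd n(4)])
  have v1': "real n * (g - \<eta>) \<le> ln (norm (P n (Complex x y))) \<and> ln (norm (P n (Complex x y))) \<le> real n * (g + \<eta>)" for x
    using v1[of x] n0 by (simp add: abs_le_iff field_simps)
  have v2': "2 * (real n * (g - 4 * \<eta>)) \<le> ln (norm (P (2 * n) (Complex x y)))" for x
  proof -
    have "g - 4 * \<eta> \<le> ln (norm (P (2 * n) (Complex x y))) / real (2 * n)" using v2[of x] g2 by linarith
    then show ?thesis using n0 by (simp add: field_simps)
  qed
  \<comment> \<open>The two upper bounds lose \<open>\<eta> * real n\<close> each, and the lower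
    bound at length \<open>2 * n\<close> loses \<open>8 * \<eta> * real n\<close>. Near-constancy on
    the line is what allows arbitrary \<open>x\<close> and \<open>x'\<close>.\<close>
  have pair: "ln (norm (P n (Complex x y))) + ln (norm (P n (Complex x' y))) - 10 * \<eta> * real n \<le> ln (norm (P (2 * n) (Complex x y)))" for x x'
    using v1'[of x] v1'[of x'] v2'[of x] by (simp add: algebra_simps)
  obtain d1 where d1: "d1 > 0" "\<And>F'. near d1 F' \<Longrightarrow> dmean F y - \<eta> \<le> dmean F' y"
    using dmean_lsc_on_line[OF yd nzy \<eta>(1)] by blast
  have \<eta>n: "0 < \<eta> * real n" using \<eta> n0 by simp
  obtain d2 where d2: "d2 > 0" "\<And>F' x. near d2 F' \<Longrightarrow>
      log_close F' n (Complex x y) (\<eta> * real n)"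
    using near_imp_log_close[OF yd c lby \<eta>n, of n] by blast
  obtain d3 where d3: "d3 > 0" "\<And>F' x. near d3 F' \<Longrightarrow>
      log_close F' (2 * n) (Complex x y) (\<eta> * real n)"
    using near_imp_log_close[OF yd c lby \<eta>n, of "2 * n"] by blast
  have main: "clyap \<beta> F y - e \<le> clyap \<beta> F' y" if "near (min d1 (min d2 d3)) F'" for F'
  proof -
    have F': "qp_cocycle \<delta> M F'" using that by blast
    have D1: "dmean F y - \<eta> \<le> dmean F' y" by (rule d1(2)) (use that in auto)
    have "near d2 F'" "near d3 F'" using that by auto
    note D2 = d2(2)[OF this(1)] and D3 = d3(2)[OF this(2)]
    show ?thesis
    \<comment> \<open>The threshold 30 is fixed by the perturbed cocycle. There the three logarithms
      in \<open>pair\<close> move by \<open>\<eta> * real n\<close> each, turning 10 into 13; the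
      determinant gap shrinks by \<open>3 * \<eta> * real n\<close> to 27, which is the required
      \<open>2 * 13 + 1\<close>.\<close>
    proof (cases "\<forall>x. ln (cmod (det (P n (Complex x y)))) \<le> 2 * ln (norm (P n (Complex x y))) - 30 * \<eta> * real n")
      case True
      have "(g - 2 * \<eta>) - (13 + 1) * \<eta> \<le> clyap \<beta> F' y"
      proof (rule qp_cocycle.clyap_ge_of_uniform_growth[OF F' yd n(4) ln4])
        fix x
        show "ln (norm (ccocycle \<beta> F' n (Complex x y))) + ln (norm (ccocycle \<beta> F' n (Complex (x + real n * \<beta>) y)))
            - 13 * \<eta> * real n \<le> ln (norm (ccocycle \<beta> F' (2 * n) (Complex x y)))"
          using D2[of x] D2[of "x + real n * \<beta>"] D3[of x] pair[of x "x + real n * \<beta>"]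
          unfolding abs_le_iff by (simp add: algebra_simps)
        show "ln (cmod (det (ccocycle \<beta> F' n (Complex x y)))) \<le>
            2 * ln (norm (ccocycle \<beta> F' n (Complex x y))) - (2 * 13 + 1) * \<eta> * real n"
          using D2[of x] True[rule_format, of x] unfolding abs_le_iff by (simp add: algebra_simps)
        show "real n * (g - 2 * \<eta>) \<le> ln (norm (ccocycle \<beta> F' n (Complex x y)))"
          using D2[of x] v1'[of x] unfolding abs_le_iff by (simp add: algebra_simps)
      qed (use D2 D3 in auto)
      then have "g - 16 * \<eta> \<le> clyap \<beta> F' y" by (simp add: algebra_simps)
      then show ?thesis using gn \<eta> by linarith
    next
      \<comment> \<open>At one point the determinant is comparable with the squared norm. As both
        are nearly constant on the line, \<open>g\<close> exceeds \<open>dmean F y / 2\<close> by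
        less than \<open>33 * \<eta> / 2\<close>, and this lower bound of the exponent is stable
        under perturbation.\<close>
      case False
      then obtain x0 where x0: "2 * ln (norm (P n (Complex x0 y))) - 30 * \<eta> * real n < ln (cmod (det (P n (Complex x0 y))))"
        by (auto simp: not_le)
      then have "2 * (real n * (g - \<eta>)) - 30 * \<eta> * real n < ln (cmod (det (P n (Complex x0 y))))"
        using v1'[of x0] by linarith
      also have "\<dots> \<le> real n * (dmean F y + \<eta>)"
        using \<open>\<And>x. \<bar>ln (cmod (det (P n (Complex x y)))) / real n - dmean F y\<bar> \<le> \<eta>\<close>[of x0] n0
        by (simp add: abs_le_iff field_simps)
      finally have "real n * (2 * g - 33 * \<eta>) < real n * dmean F y" by (simp add: algebra_simps)
      then have A: "2 * g - 33 * \<eta> < dmean F y" using n0 by simp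
      moreover have "dmean F' y / 2 \<le> clyap \<beta> F' y" by (rule qp_cocycle.clyap_ge[OF F' yd])
      ultimately show ?thesis using A D1 gn \<eta> by linarith
    qed
  qed
  show ?thesis
    by (intro exI[of _ y] conjI yr(3) yd exI[of _ "min d1 (min d2 d3)"] allI impI main)
      (use d1(1) d2(1) d3(1) in auto)
qed

end

subsection \<open>Continuity at height zero\<close>

lemma (in nondeg_hol_family) logm_0_le:
  assumes y: "\<bar>y\<bar> < \<delta>" and s: "s > 0"
  shows "logm 0 y \<le> logm s y"
proof (rule LIMSEQ_le_const2[OF logm_limit(2)[OF y]])
  obtain N :: nat where N: "real N > 1 / s" using reals_Archimedean2 by blast
  have "logm (1 / Suc n) y \<le> logm s y" if n: "n \<ge> N" for n
  proof (rule logm_mono[OF y])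
    show "normsq z + 1 / real (Suc n) > 0" for z using normsq_nonneg[of z] by (simp add: add_nonneg_pos)
    have "1 / s < real (Suc n)" using N n by simp
    then show "1 / real (Suc n) \<le> s" using s by (simp add: field_simps)
  qed
  then show "\<exists>N. \<forall>n\<ge>N. logm (1 / Suc n) y \<le> logm s y" by blast
qed

text \<open>Regularization makes the logarithm Lipschitz: its argument is at least \<open>s\<close>,
  so increasing it by \<open>\<eta>\<close> raises the logarithm by at most
  \<open>\<eta> / s\<close>.\<close>

lemma logm_le_add:
  assumes "hol_family \<delta> J f" "hol_family \<delta> J f'" and y: "\<bar>y\<bar> < \<delta>" and s: "s > 0" and \<eta>: "\<eta> \<ge> 0"
    and le: "\<And>x. hol_family.normsq J f' (Complex x y) \<le> hol_family.normsq J f (Complex x y) + \<eta>"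
  shows "hol_family.logm J f' s y \<le> hol_family.logm J f s y + \<eta> / s"
proof -
  interpret A: hol_family \<delta> J f by fact
  interpret B: hol_family \<delta> J f' by fact
  have pA: "A.normsq z + s > 0" and pB: "B.normsq z + s > 0" for z
    using A.normsq_nonneg[of z] B.normsq_nonneg[of z] s by auto
  have iA: "(\<lambda>x. ln (A.normsq (Complex x y) + s)) integrable_on {0..1}"
    by (rule A.ln_normsq_integrable_pos[OF y pA])
  have "B.logm s y \<le> integral {0..1} (\<lambda>x. ln (A.normsq (Complex x y) + s) + \<eta> / s)"
    unfolding B.logm_def
  proof (rule integral_le)
    show "(\<lambda>x. ln (B.normsq (Complex x y) + s)) integrable_on {0..1}"
      by (rule B.ln_normsq_integrable_pos[OF y pB])
    show "(\<lambda>x. ln (A.normsq (Complex x y) + s) + \<eta> / s) integrable_on {0..1}"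
      by (intro integrable_add iA) auto
    fix x
    let ?a = "A.normsq (Complex x y) + s" and ?b = "B.normsq (Complex x y) + s"
    have "ln ?b \<le> ln (?a * (1 + \<eta> / ?a))"
    proof (rule ln_mono)
      show "0 < ?b" by (rule pB)
      have "?a * (1 + \<eta> / ?a) = ?a + \<eta>" using pA[of "Complex x y"] by (simp add: distrib_left)
      then show "?b \<le> ?a * (1 + \<eta> / ?a)" using le[of x] by simp
    qed
    also have "\<dots> = ln ?a + ln (1 + \<eta> / ?a)"
      using pA[of "Complex x y"] \<eta> by (intro ln_mult_pos) (auto intro: add_pos_nonneg)
    also have "ln (1 + \<eta> / ?a) \<le> \<eta> / ?a"
      using pA[of "Complex x y"] \<eta> by (intro ln_add_one_self_le_self) auto
    also have "\<eta> / ?a \<le> \<eta> / s"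
      using A.normsq_nonneg[of "Complex x y"] s \<eta> by (intro divide_left_mono) auto
    finally show "ln ?b \<le> ln ?a + \<eta> / s" by simp
  qed
  also have "\<dots> = A.logm s y + \<eta> / s"
    unfolding A.logm_def using iA by (subst integral_add) auto
  finally show ?thesis .
qed

text \<open>Choose \<open>s\<close> with \<open>logm s y\<close> close to \<open>logm 0 y\<close>,
  perturb the regularized mean, and use that \<open>logm 0\<close> lies below \<open>logm s\<close>
  for the perturbed family. The inequality goes in this direction only, so zeros can spoil just the
  lower bound.\<close>

lemma logm_usc:
  assumes f: "nondeg_hol_family \<delta> J f" and y: "\<bar>y\<bar> < \<delta>" and e: "e > 0"
  shows "\<exists>\<eta>>0. \<forall>f'. nondeg_hol_family \<delta> J f' \<longrightarrow>
    (\<forall>x. hol_family.normsq J f' (Complex x y) \<le> hol_family.normsq J f (Complex x y) + \<eta>) \<longrightarrow>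
    hol_family.logm J f' 0 y \<le> hol_family.logm J f 0 y + e"
proof -
  interpret A: nondeg_hol_family \<delta> J f by fact
  obtain n :: nat where n: "A.logm (1 / Suc n) y < A.logm 0 y + e / 2"
    using order_tendstoD(2)[OF A.logm_limit(2)[OF y], of "A.logm 0 y + e / 2"] e
    by (auto simp: eventually_sequentially)
  define s where "s = 1 / real (Suc n)"
  have s: "s > 0" unfolding s_def by simp
  show ?thesis
  proof (intro exI[of _ "s * (e / 2)"] conjI allI impI)
    show "0 < s * (e / 2)" using s e by simp
    fix f' assume f': "nondeg_hol_family \<delta> J f'"
      and le: "\<forall>x. hol_family.normsq J f' (Complex x y) \<le> A.normsq (Complex x y) + s * (e / 2)"
    interpret B: nondeg_hol_family \<delta> J f' by fact
    have "B.logm 0 y \<le> B.logm s y" by (rule B.logm_0_le[OF y s])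
    also have "\<dots> \<le> A.logm s y + s * (e / 2) / s"
      by (rule logm_le_add[OF A.hol_family_axioms B.hol_family_axioms y s]) (use s e le in auto)
    also have "s * (e / 2) / s = e / 2" using s by simp
    also have "A.logm s y + e / 2 \<le> A.logm 0 y + e" using n unfolding s_def by linarith
    finally show "B.logm 0 y \<le> A.logm 0 y + e" .
  qed
qed

context qp_cocycle
begin

lemma norm_P_sq_close:
  assumes F': "qp_cocycle \<delta> M F'" and d: "\<And>z. \<bar>Im z\<bar> < \<delta> \<Longrightarrow> norm (F' z - F z) \<le> d"
    and z: "\<bar>Im z\<bar> < \<delta>"
  shows "(norm (ccocycle \<beta> F' k z))\<^sup>2 \<le> (norm (P k z))\<^sup>2 + 2 * (sqrt 2 * exp (real k * M)) * (real k * (sqrt 2 * exp (real k * M)) * d)"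
proof -
  let ?s = "sqrt 2 * exp (real k * M)" and ?B = "ccocycle \<beta> F' k z" and ?A = "P k z"
  have "(norm ?B)\<^sup>2 - (norm ?A)\<^sup>2 = (norm ?B + norm ?A) * (norm ?B - norm ?A)"
    by (simp add: power2_eq_square algebra_simps)
  also have "\<dots> \<le> (norm ?B + norm ?A) * norm (?B - ?A)"
    by (intro mult_left_mono norm_triangle_ineq2) auto
  also have "\<dots> \<le> (2 * ?s) * (real k * ?s * d)"
    using norm_P_le'[OF z, of k] qp_cocycle.norm_P_le'[OF F' z, of \<beta> k] P_close[OF F' d z, of k]
    by (intro mult_mono) auto
  finally show ?thesis by simp
qed

lemma cmean_usc:
  assumes y: "\<bar>y\<bar> < \<delta>" and e: "e > 0"
  shows "\<exists>d>0. \<forall>F'. near d F' \<longrightarrow>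
    cmean \<beta> F' n y \<le> cmean \<beta> F n y + e"
proof -
  let ?f = "\<lambda>F. (\<lambda>(i, j) z. ccocycle \<beta> F n z $ i $ j)"
  \<comment> \<open>\<open>logm\<close> is formed with squared norms and equals twice
    \<open>cmean\<close>, whence \<open>2 * e\<close>.\<close>
  obtain \<eta> where \<eta>: "\<eta> > 0" "\<And>f' :: 2 \<times> 2 \<Rightarrow> complex \<Rightarrow> complex. nondeg_hol_family \<delta> UNIV f' \<Longrightarrow>
      (\<And>x. hol_family.normsq UNIV f' (Complex x y) \<le> hol_family.normsq UNIV (?f F) (Complex x y) + \<eta>) \<Longrightarrow>
      hol_family.logm UNIV f' 0 y \<le> hol_family.logm UNIV (?f F) 0 y + 2 * e"
    using logm_usc[OF nondeg_family_P[of n] y, of "2 * e"] e by auto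
  define C where "C = 2 * (sqrt 2 * exp (real n * M)) * (real n * (sqrt 2 * exp (real n * M)))"
  have C: "0 \<le> C" unfolding C_def by simp
  define d where "d = \<eta> / (C + 1)"
  have d: "d > 0" "C * d \<le> \<eta>" using \<eta>(1) C unfolding d_def by (auto simp: field_simps)
  show ?thesis
  proof (intro exI[of _ d] conjI allI impI d(1))
    fix F' assume "near d F'"
    then have F': "qp_cocycle \<delta> M F'"
      and cl: "\<forall>z. \<bar>Im z\<bar> < \<delta> \<longrightarrow> norm (F' z - F z) \<le> d" by auto
    have "hol_family.logm UNIV (?f F') 0 y \<le> hol_family.logm UNIV (?f F) 0 y + 2 * e"
    proof (rule \<eta>(2)[OF qp_cocycle.nondeg_family_P[OF F']])
      fix x
      have "(norm (ccocycle \<beta> F' n (Complex x y)))\<^sup>2 \<le> (norm (P n (Complex x y)))\<^sup>2 + C * d"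
        using norm_P_sq_close[OF F', of d "Complex x y" n] cl y unfolding C_def by (simp add: mult.assoc)
      then show "hol_family.normsq UNIV (?f F') (Complex x y) \<le> hol_family.normsq UNIV (?f F) (Complex x y) + \<eta>"
        unfolding family_normsq[OF hol_family_P] qp_cocycle.family_normsq[OF F' qp_cocycle.hol_family_P[OF F']]
        using d(2) by linarith
    qed
    then show "cmean \<beta> F' n y \<le> cmean \<beta> F n y + e"
      unfolding cmean_logm qp_cocycle.cmean_logm[OF F'] by simp
  qed
qed

text \<open>The exponent is bounded by every mean, so a single \<open>n\<close> whose mean for
  \<open>F\<close> is close to the exponent of \<open>F\<close> controls the exponents of all nearby
  \<open>F'\<close>.\<close>

lemma clyap_usc:
  assumes y: "\<bar>y\<bar> < \<delta>" and e: "e > 0"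
  shows "\<exists>d>0. \<forall>F'. near d F' \<longrightarrow>
    clyap \<beta> F' y \<le> clyap \<beta> F y + e"
proof -
  obtain N where N: "\<And>n. N \<le> n \<Longrightarrow> \<bar>cmean \<beta> F n y / real n - clyap \<beta> F y\<bar> < e / 2"
    using LIMSEQ_D[OF clyap_limit(1)[OF y], of "e / 2"] e by auto
  define n where "n = Suc N"
  have n: "N \<le> n" "1 \<le> n" "real n > 0" unfolding n_def by auto
  have "e / 2 * real n > 0" using e n by simp
  from cmean_usc[OF y this, of n]
  obtain d where d: "d > 0" "\<And>F'. near d F' \<Longrightarrow>
    cmean \<beta> F' n y \<le> cmean \<beta> F n y + e / 2 * real n" by blast
  show ?thesis
  proof (intro exI[of _ d] conjI allI impI d(1))
    fix F' assume "near d F'"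
    then have F': "qp_cocycle \<delta> M F'"
      and cl: "\<forall>z. \<bar>Im z\<bar> < \<delta> \<longrightarrow> norm (F' z - F z) \<le> d" by auto
    have "clyap \<beta> F' y \<le> cmean \<beta> F' n y / real n" by (rule qp_cocycle.clyap_limit(2)[OF F' y n(2)])
    also have "\<dots> \<le> (cmean \<beta> F n y + e / 2 * real n) / real n"
      using d(2)[OF conjI[OF F' cl]] n by (intro divide_right_mono) auto
    also have "\<dots> = cmean \<beta> F n y / real n + e / 2" using n by (simp add: add_divide_distrib)
    also have "\<dots> \<le> clyap \<beta> F y + e" using N[OF n(1)] by linarith
    finally show "clyap \<beta> F' y \<le> clyap \<beta> F y + e" .
  qed
qed

lemma dmean_usc:
  assumes y: "\<bar>y\<bar> < \<delta>" and e: "e > 0"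
  shows "\<exists>d>0. \<forall>F'. near d F' \<longrightarrow>
    dmean F' y \<le> dmean F y + e"
proof -
  let ?f = "\<lambda>F (_::unit) z. det (F z :: mat2)"
  obtain \<eta> where \<eta>: "\<eta> > 0" "\<And>f' :: unit \<Rightarrow> complex \<Rightarrow> complex. nondeg_hol_family \<delta> UNIV f' \<Longrightarrow>
      (\<And>x. hol_family.normsq UNIV f' (Complex x y) \<le> hol_family.normsq UNIV (?f F) (Complex x y) + \<eta>) \<Longrightarrow>
      hol_family.logm UNIV f' 0 y \<le> hol_family.logm UNIV (?f F) 0 y + 2 * e"
    using logm_usc[OF nondeg_family_det y, of "2 * e"] e by auto
  define C where "C = 2 * exp (2 * M) * (2 * (exp M + exp M))"
  have C: "0 \<le> C" unfolding C_def by simp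
  define d where "d = \<eta> / (C + 1)"
  have d: "d > 0" "C * d \<le> \<eta>" using \<eta>(1) C unfolding d_def by (auto simp: field_simps)
  show ?thesis
  proof (intro exI[of _ d] conjI allI impI d(1))
    fix F' assume "near d F'"
    then have F': "qp_cocycle \<delta> M F'"
      and cl: "\<forall>z. \<bar>Im z\<bar> < \<delta> \<longrightarrow> norm (F' z - F z) \<le> d" by auto
    have "hol_family.logm UNIV (?f F') 0 y \<le> hol_family.logm UNIV (?f F) 0 y + 2 * e"
    proof (rule \<eta>(2)[OF qp_cocycle.nondeg_family_det[OF F']])
      fix x
      let ?z = "Complex x y"
      let ?a = "cmod (det (F ?z))" and ?b = "cmod (det (F' ?z))"
      have z: "\<bar>Im ?z\<bar> < \<delta>" using y by simp
      have "cmod (det (F' ?z) - det (F ?z)) \<le> 2 * (norm (F' ?z) + norm (F ?z)) * norm (F' ?z - F ?z)"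
        by (rule norm_det_diff_le)
      also have "\<dots> \<le> 2 * (exp M + exp M) * d"
        using bnd[OF z] qp_cocycle.bnd[OF F' z] cl z by (intro mult_mono add_mono) auto
      finally have diff: "cmod (det (F' ?z) - det (F ?z)) \<le> 2 * (exp M + exp M) * d" .
      have "?b\<^sup>2 - ?a\<^sup>2 = (?b + ?a) * (?b - ?a)" by (simp add: power2_eq_square algebra_simps)
      also have "\<dots> \<le> (?b + ?a) * cmod (det (F' ?z) - det (F ?z))"
        by (intro mult_left_mono norm_triangle_ineq2) auto
      also have "\<dots> \<le> (2 * exp (2 * M)) * (2 * (exp M + exp M) * d)"
        using diff det_le_exp[OF z] qp_cocycle.det_le_exp[OF F' z] by (intro mult_mono) auto
      also have "\<dots> = C * d" unfolding C_def by simp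
      finally show "hol_family.normsq UNIV (?f F') ?z \<le> hol_family.normsq UNIV (?f F) ?z + \<eta>"
        unfolding family_normsq_det qp_cocycle.family_normsq_det[OF F'] using d(2) by linarith
    qed
    then show "dmean F' y \<le> dmean F y + e"
      unfolding dmean_logm qp_cocycle.dmean_logm[OF F'] by simp
  qed
qed

text \<open>Stated for an abstract functional \<open>G\<close> so that it serves both
  \<open>clyap\<close> and \<open>dmean\<close>. In \<open>lsc\<close> the height may move by less
  than \<open>\<rho>\<close>, because for \<open>clyap\<close> it is not free to choose.\<close>

lemma continuous_at_0:
  fixes G :: "(complex \<Rightarrow> mat2) \<Rightarrow> real \<Rightarrow> real"
  assumes conv: "\<And>F'. qp_cocycle \<delta> M F' \<Longrightarrow> convex_on {-\<delta><..<\<delta>} (G F')"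
    and bound: "\<And>F' y. qp_cocycle \<delta> M F' \<Longrightarrow> \<bar>y\<bar> < \<delta> \<Longrightarrow> G F' y \<le> B"
    and lsc: "\<And>y0 e \<rho>. \<bar>y0\<bar> < \<delta> \<Longrightarrow> (\<And>x. det (F (Complex x y0)) \<noteq> 0) \<Longrightarrow> e > 0 \<Longrightarrow> \<rho> > 0 \<Longrightarrow>
      \<exists>y. \<bar>y - y0\<bar> < \<rho> \<and> \<bar>y\<bar> < \<delta> \<and> (\<exists>d>0. \<forall>F'. near d F' \<longrightarrow> G F y - e \<le> G F' y)"
    and usc: "\<And>e. e > 0 \<Longrightarrow> \<exists>d>0. \<forall>F'. near d F' \<longrightarrow> G F' 0 \<le> G F 0 + e"
    and e: "e > 0"
  shows "\<exists>d>0. \<forall>F'. near d F' \<longrightarrow> \<bar>G F' 0 - G F 0\<bar> \<le> e"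
proof -
  define b where "b = \<delta> / 2"
  have b: "b > 0" "b < \<delta>" using \<delta> unfolding b_def by auto
  have sub: "{-b..b} \<subseteq> {-\<delta><..<\<delta>}" using b by auto
  have conv': "convex_on {-b..b} (G F')" if "qp_cocycle \<delta> M F'" for F'
    by (rule convex_on_subset[OF conv[OF that] sub convex_real_interval(5)])
  have ax: "qp_cocycle \<delta> M F" by unfold_locales
  have "0 < e / 2" using e by simp
  from convex_lower_bound_at_0[OF conv'[OF ax] b(1) _ this, of B]
  obtain \<rho> where \<rho>: "\<rho> > 0" "\<rho> < b" "\<And>y h. 0 < y \<Longrightarrow> y < \<rho> \<Longrightarrow> convex_on {-b..b} h \<Longrightarrow> h b \<le> B \<Longrightarrow>
      G F y - e / 2 \<le> h y \<Longrightarrow> G F 0 - 2 * (e / 2) \<le> h 0"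
    using bound[OF ax] b by (auto simp: abs_less_iff)
  obtain y0 where y0: "0 < y0" "y0 < \<rho>" "\<And>x. Complex x y0 \<notin> {z. \<bar>Im z\<bar> < \<delta> \<and> det (F z) = 0}"
    using countable_avoid_height[OF countable_det_zeros \<rho>(1)] by blast
  have y0d: "\<bar>y0\<bar> < \<delta>" using y0 \<rho> b by auto
  have nz: "det (F (Complex x y0)) \<noteq> 0" for x using y0(3)[of x] y0d by simp
  \<comment> \<open>Moving by less than this amount keeps the new height strictly between 0 and
    \<open>\<rho>\<close>, where the convexity argument applies.\<close>
  have m: "0 < min y0 (\<rho> - y0)" using y0 by simp
  obtain y d1 where y: "\<bar>y - y0\<bar> < min y0 (\<rho> - y0)" and d1: "d1 > 0" "\<And>F'. near d1 F' \<Longrightarrow> G F y - e / 2 \<le> G F' y"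
    using lsc[OF y0d nz \<open>0 < e / 2\<close> m] by blast
  have y': "0 < y" "y < \<rho>" using y by (auto simp: abs_less_iff)
  obtain d2 where d2: "d2 > 0" "\<And>F'. near d2 F' \<Longrightarrow> G F' 0 \<le> G F 0 + e"
    using usc[OF e] by blast
  show ?thesis
  proof (intro exI[of _ "min d1 d2"] conjI allI impI)
    fix F' assume F': "near (min d1 d2) F'"
    have "G F 0 - 2 * (e / 2) \<le> G F' 0"
      using \<rho>(3)[OF y' conv' _ d1(2), of F'] bound[of F' b] b F' by auto
    moreover have "G F' 0 \<le> G F 0 + e" using d2(2)[of F'] F' by auto
    ultimately show "\<bar>G F' 0 - G F 0\<bar> \<le> e" by (simp add: abs_le_iff)
  qed (use d1 d2 in auto)
qed

lemma clyap_continuous_at_0: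
  assumes \<beta>: "\<beta> \<notin> \<rat>" and e: "e > 0"
  shows "\<exists>d>0. \<forall>F'. near d F' \<longrightarrow> \<bar>clyap \<beta> F' 0 - clyap \<beta> F 0\<bar> \<le> e"
  by (rule continuous_at_0[OF qp_cocycle.clyap_convex qp_cocycle.clyap_le clyap_lsc_on_line[OF \<beta>] clyap_usc e])
    (use \<delta> in auto)

lemma dmean_continuous_at_0:
  assumes e: "e > 0"
  shows "\<exists>d>0. \<forall>F'. near d F' \<longrightarrow> \<bar>dmean F' 0 - dmean F 0\<bar> \<le> e"
proof (rule continuous_at_0[OF qp_cocycle.dmean_convex qp_cocycle.dmean_le _ dmean_usc e])
  fix y0 e \<rho> :: real assume "\<bar>y0\<bar> < \<delta>" "\<And>x. det (F (Complex x y0)) \<noteq> 0" "e > 0" "\<rho> > 0"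
  then show "\<exists>y. \<bar>y - y0\<bar> < \<rho> \<and> \<bar>y\<bar> < \<delta> \<and> (\<exists>d>0. \<forall>F'. near d F' \<longrightarrow> dmean F y - e \<le> dmean F' y)"
    using dmean_lsc_on_line[of y0 e] by (intro exI[of _ y0]) simp
qed (use \<delta> in auto)

end

subsection \<open>The Lyapunov exponents\<close>

lemma borel_measurable_mat_norm: "mat_norm \<in> borel_measurable borel"
proof (rule borel_measurable_continuous_onI, rule continuous_onI)
  fix A :: mat2 and e :: real assume e: "e > 0"
  have "dist (mat_norm B) (mat_norm A) \<le> dist B A" for B
  proof -
    have "mat_norm B \<le> mat_norm A + mat_norm (B - A)" using mat_norm_triangle[of A "B - A"] by simp
    moreover have "mat_norm A \<le> mat_norm B + mat_norm (B - A)"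
      using mat_norm_triangle[of B "A - B"] mat_norm_minus[of "A - B"] by simp
    ultimately show ?thesis
      using mat_norm_le_norm[of "B - A"] unfolding dist_norm real_norm_def by linarith
  qed
  then show "\<exists>d>0. \<forall>B\<in>UNIV. dist B A < d \<longrightarrow> dist (mat_norm B) (mat_norm A) \<le> e"
    using e by (intro exI[of _ e]) (meson less_imp_le order_trans)
qed

lemma mat_norm_scaleR: "mat_norm (c *\<^sub>R A) = \<bar>c\<bar> * mat_norm A"
proof -
  have "(\<lambda>v. (c *\<^sub>R A) *v v) = (\<lambda>v. c *\<^sub>R (A *v v))"
    by (auto simp: matrix_vector_mult_def vec_eq_iff scaleR_sum_right)
  then show ?thesis
    unfolding mat_norm_def by (simp add: onorm_scaleR[OF bounded_linear_matrix_vector_mult])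
qed

lemma scaleR_mult_mat2: "(a *\<^sub>R (A::mat2)) ** (b *\<^sub>R (B::mat2)) = (a * b) *\<^sub>R (A ** B)"
  by (simp add: vec_eq_iff matrix_matrix_mult_def sum_2 scaleR_add_right mult.commute)

lemma cocycle_normalized:
  "cocycle \<beta> (normalized D) n x =
    (\<Prod>j<n. 1 / sqrt (cmod (det (D (x + real j * \<beta>))))) *\<^sub>R cocycle \<beta> D n x"
proof (induction n)
  case (Suc n)
  then show ?case by (simp add: normalized_def scaleR_mult_mat2 mult.commute)
qed simp

text \<open>For \<open>A = 0\<close> both logarithms are \<open>ln 0 = 0\<close>, so the bounds hold
  for every matrix and integrate without an exceptional set.\<close>

lemma ln_mat_norm_bounds:
  "ln (norm A) - ln (sqrt 2) \<le> ln (mat_norm A)" "ln (mat_norm A) \<le> ln (norm A)"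
proof -
  have "ln (norm A) \<le> ln (sqrt 2 * mat_norm A) \<and> ln (mat_norm A) \<le> ln (norm A)" if "A \<noteq> 0"
  proof -
    have "mat_norm A > 0" using that mat_norm_nonneg[of A] mat_norm_eq_0_iff[of A] by simp
    then show ?thesis using that norm_le_mat_norm[of A] mat_norm_le_norm[of A] by (auto intro!: ln_mono)
  qed
  moreover have "ln (sqrt 2 * mat_norm A) = ln (sqrt 2) + ln (mat_norm A)" if "A \<noteq> 0"
    using that mat_norm_nonneg[of A] mat_norm_eq_0_iff[of A] by (intro ln_mult_pos) auto
  moreover have "mat_norm 0 = 0" using mat_norm_eq_0_iff[of 0] by simp
  ultimately show "ln (norm A) - ln (sqrt 2) \<le> ln (mat_norm A)" "ln (mat_norm A) \<le> ln (norm A)"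
    by (cases "A = 0"; simp)+
qed

text \<open>The means so far are gauge integrals, the exponent is a Lebesgue integral. A function
  bounded above bridges the two, since \<open>B - g\<close> is nonnegative and hence absolutely
  integrable.\<close>

lemma set_integrable_lborel_bounded_above:
  fixes g :: "real \<Rightarrow> real"
  assumes int: "g integrable_on {0..1}" and meas: "g \<in> borel_measurable borel" and B: "\<And>x. g x \<le> B"
  shows "set_integrable lborel {0..1} g"
proof -
  have d: "(\<lambda>x. B - g x) absolutely_integrable_on {0..1}"
    by (rule nonnegative_absolutely_integrable_1) (use int B in \<open>auto intro!: integrable_diff\<close>)
  have "(\<lambda>x::real. B) absolutely_integrable_on {0..1}"
    by (rule absolutely_integrable_on_const) simp
  from set_integral_diff(1)[OF this d]
  have "integrable lebesgue (\<lambda>x. indicator {0..1} x *\<^sub>R g x)" by (simp add: set_integrable_def)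
  moreover have "(\<lambda>x. indicator {0..1} x *\<^sub>R g x) \<in> borel_measurable lborel" using meas by simp
  ultimately show ?thesis unfolding set_integrable_def using integrable_completion by blast
qed

section \<open>Lebesgue integrability and identification of the exponents\<close>

context qp_cocycle
begin

lemma continuous_P_line:
  assumes y: "\<bar>y\<bar> < \<delta>"
  shows "continuous_on UNIV (\<lambda>x. P n (Complex x y))"
proof -
  have "continuous_on UNIV (\<lambda>x. P n (Complex x y) $ i $ j)" for i j
    by (rule continuous_on_compose2[OF holomorphic_on_imp_continuous_on[OF hol_P]])
      (use y in \<open>auto simp: Complex_eq intro!: continuous_intros\<close>)
  then have "continuous_on UNIV (\<lambda>x. \<chi> i j. P n (Complex x y) $ i $ j)"
    by (intro continuous_on_vec_lambda)
  then show ?thesis by simp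
qed

lemma borel_P_line: "\<bar>y\<bar> < \<delta> \<Longrightarrow> (\<lambda>x. P n (Complex x y)) \<in> borel_measurable borel"
  by (rule borel_measurable_continuous_onI[OF continuous_P_line])

lemma borel_det_line: 
  assumes y: "\<bar>y\<bar> < \<delta>"
  shows "(\<lambda>x. cmod (det (F (Complex (x + c) y)))) \<in> borel_measurable borel"
proof (rule borel_measurable_continuous_onI)
  show "continuous_on UNIV (\<lambda>x. cmod (det (F (Complex (x + c) y))))"
    by (intro continuous_on_norm continuous_on_compose2[OF holomorphic_on_imp_continuous_on[OF hol_det]])
      (use y in \<open>auto simp: Complex_eq intro!: continuous_intros\<close>)
qed

lemma set_integrable_ln_norm:
  assumes y: "\<bar>y\<bar> < \<delta>"
  shows "set_integrable lborel {0..1} (\<lambda>x. ln (norm (P n (Complex x y))))"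
proof (rule set_integrable_lborel_bounded_above[OF cmean_integrable[OF y]])
  show "(\<lambda>x. ln (norm (P n (Complex x y)))) \<in> borel_measurable borel"
    using borel_P_line[OF y, of n] by measurable
  fix x
  show "ln (norm (P n (Complex x y))) \<le> ln (sqrt 2 * exp (real n * M))"
  proof (cases "P n (Complex x y) = 0")
    case True
    have "1 * 1 \<le> sqrt 2 * exp (real n * M)" using M by (intro mult_mono) auto
    then have "0 \<le> ln (sqrt 2 * exp (real n * M))" by (intro ln_ge_zero) simp
    then show ?thesis using True by simp
  next
    case False
    then show ?thesis using norm_P_le'[of "Complex x y" n] y by (intro ln_mono) auto
  qed
qed

lemma set_integrable_ln_det:
  assumes y: "\<bar>y\<bar> < \<delta>"
  shows "set_integrable lborel {0..1} (\<lambda>x. ln (cmod (det (F (Complex (x + c) y)))))"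
proof (rule set_integrable_lborel_bounded_above[OF has_integral_integrable[OF dmean_shift[OF y]]])
  show "(\<lambda>x. ln (cmod (det (F (Complex (x + c) y))))) \<in> borel_measurable borel"
    using borel_det_line[OF y, of c] by measurable
  fix x
  show "ln (cmod (det (F (Complex (x + c) y)))) \<le> 2 * M"
  proof (cases "det (F (Complex (x + c) y)) = 0")
    case False
    then have "ln (cmod (det (F (Complex (x + c) y)))) \<le> ln (exp (2 * M))"
      using det_le_exp[of "Complex (x + c) y"] y by (intro ln_mono) auto
    then show ?thesis by simp
  qed (use M in simp)
qed

lemma set_integrable_ln_mat_norm:
  assumes y: "\<bar>y\<bar> < \<delta>"
  shows "set_integrable lborel {0..1} (\<lambda>x. ln (mat_norm (P n (Complex x y))))"
proof -
  have m: "(\<lambda>x. mat_norm (P n (Complex x y))) \<in> borel_measurable borel"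
    by (rule measurable_compose[OF borel_P_line[OF y] borel_measurable_mat_norm])
  have "integrable lborel (\<lambda>x. indicator {0..1} x *\<^sub>R (\<bar>ln (norm (P n (Complex x y)))\<bar> + ln (sqrt 2)))"
  proof -
    have 1: "set_integrable lborel {0..1} (\<lambda>x. \<bar>ln (norm (P n (Complex x y)))\<bar>)"
      using set_integrable_ln_norm[OF y] by (rule set_integrable_abs)
    have 2: "set_integrable lborel {0..1} (\<lambda>x::real. ln (sqrt 2))"
      unfolding set_integrable_def by simp
    show ?thesis using set_integral_add(1)[OF 1 2] unfolding set_integrable_def .
  qed
  then show ?thesis
    unfolding set_integrable_def
  proof (rule Bochner_Integration.integrable_bound)
    show "(\<lambda>x. indicator {0..1} x *\<^sub>R ln (mat_norm (P n (Complex x y)))) \<in> borel_measurable lborel"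
      using m by simp
    have le: "\<bar>ln (mat_norm A)\<bar> \<le> \<bar>ln (norm A)\<bar> + ln (sqrt 2)" for A
    proof -
      have "0 \<le> ln (sqrt 2)" by (intro ln_ge_zero) simp
      then show ?thesis using ln_mat_norm_bounds[of A] by linarith
    qed
    show "AE x in lborel. norm (indicator {0..1} x *\<^sub>R ln (mat_norm (P n (Complex x y)))) \<le>
        norm (indicator {0..1} x *\<^sub>R (\<bar>ln (norm (P n (Complex x y)))\<bar> + ln (sqrt 2)))"
    proof (rule AE_I2)
      fix x :: real
      show "norm (indicator {0..1} x *\<^sub>R ln (mat_norm (P n (Complex x y)))) \<le>
        norm (indicator {0..1} x *\<^sub>R (\<bar>ln (norm (P n (Complex x y)))\<bar> + ln (sqrt 2)))"
        using order_trans[OF le abs_ge_self, of "P n (Complex x y)"]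
        by (auto simp: indicator_def)
    qed
  qed
qed

text \<open>Operator and Frobenius norm differ by a factor of at most \<open>sqrt 2\<close>, whose
  logarithm disappears after division by \<open>n\<close>.\<close>

lemma mat_norm_mean_limit:
  assumes y: "\<bar>y\<bar> < \<delta>"
  shows "(\<lambda>n. (1 / real n) * (LINT x:{0..1}|lborel. ln (mat_norm (P n (Complex x y))))) \<longlonglongrightarrow> clyap \<beta> F y"
proof (rule tendsto_sandwich)
  note I = set_borel_integral_eq_integral[OF set_integrable_ln_mat_norm[OF y]]
  have up: "(LINT x:{0..1}|lborel. ln (mat_norm (P n (Complex x y)))) \<le> cmean \<beta> F n y" for n
    unfolding I(2) cmean_def by (intro integral_le I(1) cmean_integrable[OF y] ln_mat_norm_bounds)
  have lo: "cmean \<beta> F n y - ln (sqrt 2) \<le> (LINT x:{0..1}|lborel. ln (mat_norm (P n (Complex x y))))" for n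
  proof -
    have "integral {0..1} (\<lambda>x. ln (norm (P n (Complex x y))) - ln (sqrt 2)) \<le>
        integral {0..1} (\<lambda>x. ln (mat_norm (P n (Complex x y))))"
      by (intro integral_le I(1) integrable_diff cmean_integrable[OF y] ln_mat_norm_bounds) auto
    moreover have "integral {0..1} (\<lambda>x. ln (norm (P n (Complex x y))) - ln (sqrt 2)) = cmean \<beta> F n y - ln (sqrt 2)"
      unfolding cmean_def by (subst integral_diff) (auto intro: cmean_integrable[OF y])
    ultimately show ?thesis unfolding I(2) by simp
  qed
  show "\<forall>\<^sub>F n in sequentially. (1 / real n) * (LINT x:{0..1}|lborel. ln (mat_norm (P n (Complex x y)))) \<le> cmean \<beta> F n y / real n"
    using up by (intro always_eventually allI) (simp add: divide_right_mono)
  show "\<forall>\<^sub>F n in sequentially. cmean \<beta> F n y / real n - ln (sqrt 2) / real n \<le>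
      (1 / real n) * (LINT x:{0..1}|lborel. ln (mat_norm (P n (Complex x y))))"
    using lo by (intro always_eventually allI) (simp add: divide_right_mono flip: diff_divide_distrib)
  have "(\<lambda>n. cmean \<beta> F n y / real n - ln (sqrt 2) / real n) \<longlonglongrightarrow> clyap \<beta> F y - 0"
    by (intro tendsto_diff clyap_limit(1)[OF y] lim_const_over_n)
  then show "(\<lambda>n. cmean \<beta> F n y / real n - ln (sqrt 2) / real n) \<longlonglongrightarrow> clyap \<beta> F y" by simp
qed (rule clyap_limit(1)[OF y])

text \<open>A normalized product is a scalar times the original one, the scalar being the product of
  the inverse square roots of the determinants along the orbit. Off the countable set of points in
  \<open>Z\<close> the logarithm splits, so the integrals differ by exactly
  \<open>real n * dmean F 0 / 2\<close>.\<close>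

lemma lyapunov_eq_clyap:
  assumes D: "\<And>x. F (Complex x 0) = D x"
  shows "lyapunov \<beta> D = clyap \<beta> F 0" and "lyapunov' \<beta> D = clyap \<beta> F 0 - dmean F 0 / 2"
proof -
  have y: "\<bar>0::real\<bar> < \<delta>" using \<delta> by simp
  have P: "P n (Complex x 0) = cocycle \<beta> D n x" for n x
    by (induction n) (simp_all add: Complex_add_of_real D mat_def del: of_real_mult)
  have lim: "(\<lambda>n. (1 / real n) * (LINT x:{0..1}|lborel. ln (mat_norm (cocycle \<beta> D n x)))) \<longlonglongrightarrow> clyap \<beta> F 0"
    using mat_norm_mean_limit[OF y] unfolding P .
  then show "lyapunov \<beta> D = clyap \<beta> F 0" unfolding lyapunov_def by (rule limI)
  let ?s = "\<lambda>n x. \<Prod>j<n. 1 / sqrt (cmod (det (D (x + real j * \<beta>))))"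
  have eq: "(LINT x:{0..1}|lborel. ln (mat_norm (cocycle \<beta> (normalized D) n x))) =
      (LINT x:{0..1}|lborel. ln (mat_norm (cocycle \<beta> D n x))) - real n * dmean F 0 / 2" for n
  proof -
    define k where "k x = ln (mat_norm (cocycle \<beta> D n x)) - (1/2) * (\<Sum>j<n. ln (cmod (det (D (x + real j * \<beta>)))))" for x
    have mc: "(\<lambda>x. mat_norm (cocycle \<beta> D n x)) \<in> borel_measurable borel"
      using measurable_compose[OF borel_P_line[OF y, of n] borel_measurable_mat_norm] unfolding P .
    have md: "(\<lambda>x. cmod (det (D (x + c)))) \<in> borel_measurable borel" for c
      using borel_det_line[OF y, of c] unfolding D .
    have sk: "set_integrable lborel {0..1} k"
    proof -
      have "set_integrable lborel {0..1} (\<lambda>x. \<Sum>j<n. ln (cmod (det (D (x + real j * \<beta>)))))"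
        unfolding set_integrable_def scaleR_sum_right
        using set_integrable_ln_det[OF y] unfolding set_integrable_def D
        by (intro Bochner_Integration.integrable_sum)
      then show ?thesis unfolding k_def[abs_def]
        using set_integrable_ln_mat_norm[OF y, of n] unfolding P
        by (intro set_integral_diff(1) set_integrable_mult_right)
    qed
    have "(LINT x:{0..1}|lborel. ln (mat_norm (cocycle \<beta> (normalized D) n x))) = (LINT x:{0..1}|lborel. k x)"
    proof (rule set_lebesgue_integral_cong_AE)
      show "(\<lambda>x. ln (mat_norm (cocycle \<beta> (normalized D) n x))) \<in> borel_measurable lborel"
        unfolding cocycle_normalized mat_norm_scaleR using mc md by measurable
      show "k \<in> borel_measurable lborel"
        unfolding k_def[abs_def] using mc md by measurable
      have "countable {x. Complex x 0 \<in> Z}"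
        by (rule countable_subset[OF _ countable_image[OF countable_Z, of Re]]) (force simp: image_iff)
      then have "AE x in lborel. x \<notin> {x. Complex x 0 \<in> Z}"
        by (intro AE_not_in countable_imp_null_set_lborel)
      then show "AE x\<in>{0..1} in lborel. ln (mat_norm (cocycle \<beta> (normalized D) n x)) = k x"
      proof (rule AE_mp, intro AE_I2 impI)
        fix x assume x: "x \<notin> {x. Complex x 0 \<in> Z}"
        have d: "det (D (x + real j * \<beta>)) \<noteq> 0" for j
          using x y unfolding Z_def mem_Collect_eq Complex_add_of_real D by auto
        have c: "mat_norm (cocycle \<beta> D n x) > 0"
          using P_nonzero[of "Complex x 0" n] x y mat_norm_nonneg[of "cocycle \<beta> D n x"] mat_norm_eq_0_iff[of "cocycle \<beta> D n x"]
          unfolding P by simp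
        have s: "?s n x > 0" using d by (intro prod_pos) simp
        have "ln (mat_norm (cocycle \<beta> (normalized D) n x)) = ln (?s n x) + ln (mat_norm (cocycle \<beta> D n x))"
          unfolding cocycle_normalized mat_norm_scaleR abs_of_pos[OF s] by (rule ln_mult_pos[OF s c])
        also have "ln (?s n x) = (\<Sum>j<n. ln (1 / sqrt (cmod (det (D (x + real j * \<beta>))))))"
          using d by (intro ln_prod) simp_all
        also have "\<dots> = (\<Sum>j<n. - (1/2) * ln (cmod (det (D (x + real j * \<beta>)))))"
          using d by (intro sum.cong refl) (simp add: ln_div ln_sqrt)
        finally show "ln (mat_norm (cocycle \<beta> (normalized D) n x)) = k x"
          unfolding k_def by (simp add: sum_distrib_left sum_negf)
      qed
    qed simp
    also have "\<dots> = integral {0..1} k" by (rule set_borel_integral_eq_integral(2)[OF sk])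
    also have "\<dots> = (LINT x:{0..1}|lborel. ln (mat_norm (cocycle \<beta> D n x))) - (1/2) * (real n * dmean F 0)"
    proof -
      have "((\<lambda>x. ln (mat_norm (cocycle \<beta> D n x))) has_integral
          (LINT x:{0..1}|lborel. ln (mat_norm (cocycle \<beta> D n x)))) {0..1}"
        using set_borel_integral_eq_integral[OF set_integrable_ln_mat_norm[OF y, of n]] unfolding P
        by (simp add: has_integral_integral)
      moreover have "((\<lambda>x. (1/2) * (\<Sum>j<n. ln (cmod (det (D (x + real j * \<beta>)))))) has_integral (1/2) * (real n * dmean F 0)) {0..1}"
        using has_integral_mult_right[OF sum_dmean_shift[OF y, of n], of "1/2"] unfolding D .
      ultimately show ?thesis unfolding k_def[abs_def] by (intro integral_unique has_integral_diff)
    qed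
    finally show ?thesis by simp
  qed
  have "(\<lambda>n. (1 / real n) * (LINT x:{0..1}|lborel. ln (mat_norm (cocycle \<beta> (normalized D) n x)))) \<longlonglongrightarrow> clyap \<beta> F 0 - dmean F 0 / 2"
  proof (rule Lim_transform_eventually)
    show "(\<lambda>n. (1 / real n) * (LINT x:{0..1}|lborel. ln (mat_norm (cocycle \<beta> D n x))) - dmean F 0 / 2) \<longlonglongrightarrow> clyap \<beta> F 0 - dmean F 0 / 2"
      by (intro tendsto_diff lim tendsto_const)
    \<comment> \<open>Only for \<open>n > 0\<close>: at \<open>n = 0\<close> the convention
      \<open>1 / 0 = 0\<close> makes the right side 0.\<close>
    show "\<forall>\<^sub>F n in sequentially. (1 / real n) * (LINT x:{0..1}|lborel. ln (mat_norm (cocycle \<beta> D n x))) - dmean F 0 / 2 =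
        (1 / real n) * (LINT x:{0..1}|lborel. ln (mat_norm (cocycle \<beta> (normalized D) n x)))"
      using eventually_gt_at_top[of 0] by eventually_elim (simp add: eq field_simps)
  qed
  then show "lyapunov' \<beta> D = clyap \<beta> F 0 - dmean F 0 / 2"
    unfolding lyapunov'_def lyapunov_def by (rule limI)
qed

end

section \<open>From strip-norm neighbourhoods to continuity\<close>

lemma qp_cocycle_strip_extension:
  assumes \<delta>: "\<delta> > 0" and D: "D \<in> C_omega \<delta>" and nz: "det (D x0) \<noteq> 0" and M: "M \<ge> 0"
    and bnd: "\<And>z. z \<in> strip \<delta> \<Longrightarrow> sqrt 2 * mat_norm (strip_extension \<delta> D z) \<le> exp M"
  shows "qp_cocycle \<delta> M (strip_extension \<delta> D)"
proof
  let ?F = "strip_extension \<delta> D"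
  have F: "is_strip_extension \<delta> D ?F" by (rule is_strip_extension_strip_extension[OF D])
  have sub: "{z. \<bar>Im z\<bar> < \<delta>} \<subseteq> strip \<delta>" by (auto simp: strip_def)
  show "(\<lambda>z. ?F z $ i $ j) holomorphic_on {z. \<bar>Im z\<bar> < \<delta>}" for i j
    using F sub unfolding is_strip_extension_def
    by (meson analytic_imp_holomorphic analytic_on_subset)
  show "?F (z + 1) = ?F z" if "\<bar>Im z\<bar> < \<delta>" for z
    by (rule strip_extension_periodic[OF \<delta> F]) (use D that in \<open>auto simp: C_omega_def strip_def\<close>)
  show "norm (?F z) \<le> exp M" if "\<bar>Im z\<bar> < \<delta>" for z
    using norm_le_mat_norm[of "?F z"] bnd[of z] that by (auto simp: strip_def)
  show "\<exists>z. \<bar>Im z\<bar> < \<delta> \<and> det (?F z) \<noteq> 0"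
    using F nz \<delta> unfolding is_strip_extension_def by (intro exI[of _ "of_real x0"]) simp
qed (fact \<delta> M)+

lemma strip_dist_continuity:
  assumes \<delta>: "\<delta> > 0" and \<beta>: "\<beta> \<notin> \<rat>" and D: "D \<in> C_omega \<delta>" "\<exists>x. det (D x) \<noteq> 0" and e: "e > 0"
  shows "\<exists>d>0. \<forall>E. E \<in> C_omega \<delta> \<longrightarrow> (\<exists>x. det (E x) \<noteq> 0) \<longrightarrow> strip_dist \<delta> D E < d \<longrightarrow>
    \<bar>lyapunov \<beta> E - lyapunov \<beta> D\<bar> \<le> e \<and> \<bar>lyapunov' \<beta> E - lyapunov' \<beta> D\<bar> \<le> 2 * e"
proof -
  let ?X = "strip_extension \<delta>"
  interpret Metric_space "C_omega \<delta>" "strip_dist \<delta>" by (rule Metric_space_C_omega[OF \<delta>])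
  \<comment> \<open>Large enough for the whole unit ball around \<open>D\<close>, which is why
    \<open>d \<le> 1\<close> is imposed below; \<open>sqrt 2\<close> converts to the Frobenius norm,
    and the leading 1 ensures \<open>M \<ge> 0\<close>.\<close>
  define M where "M = ln (1 + sqrt 2 * (\<bar>strip_norm \<delta> D\<bar> + 1))"
  have ge: "0 \<le> sqrt 2 * (\<bar>strip_norm \<delta> D\<bar> + 1)" by simp
  have M: "M \<ge> 0" unfolding M_def using ge by (intro ln_ge_zero) linarith
  have eM: "exp M = 1 + sqrt 2 * (\<bar>strip_norm \<delta> D\<bar> + 1)"
    unfolding M_def using ge by (intro exp_ln) linarith
  have bD: "sqrt 2 * mat_norm (?X D z) \<le> exp M" if "z \<in> strip \<delta>" for z
  proof -
    have "mat_norm (?X D z) \<le> \<bar>strip_norm \<delta> D\<bar> + 1" using mat_norm_le_strip_norm[OF \<delta> D(1) that] by linarith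
    then have "sqrt 2 * mat_norm (?X D z) \<le> sqrt 2 * (\<bar>strip_norm \<delta> D\<bar> + 1)" by (intro mult_left_mono) auto
    then show ?thesis unfolding eM by linarith
  qed
  obtain x0 where x0: "det (D x0) \<noteq> 0" using D(2) by blast
  interpret qp_cocycle \<delta> \<beta> M "?X D" by (rule qp_cocycle_strip_extension[OF \<delta> D(1) x0 M bD])
  have real: "?X E (Complex x 0) = E x" if "E \<in> C_omega \<delta>" for E x
    using is_strip_extension_strip_extension[OF that] unfolding is_strip_extension_def complex_of_real_def by blast
  obtain d1 where d1: "d1 > 0" "\<And>F'. near d1 F' \<Longrightarrow>
      \<bar>clyap \<beta> F' 0 - clyap \<beta> (?X D) 0\<bar> \<le> e"
    using clyap_continuous_at_0[OF \<beta> e] by blast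
  obtain d2 where d2: "d2 > 0" "\<And>F'. near d2 F' \<Longrightarrow>
      \<bar>dmean F' 0 - dmean (?X D) 0\<bar> \<le> e"
    using dmean_continuous_at_0[OF e] by blast
  \<comment> \<open>The distance bounds operator norms, whereas \<open>near\<close> measures
    Frobenius norms; hence the division by \<open>sqrt 2\<close>.\<close>
  define d where "d = min 1 (min d1 d2 / sqrt 2)"
  have d: "d > 0" "d \<le> 1" "sqrt 2 * d \<le> min d1 d2"
  proof -
    show "d > 0" "d \<le> 1" unfolding d_def using d1 d2 by auto
    have "sqrt 2 * d \<le> sqrt 2 * (min d1 d2 / sqrt 2)" unfolding d_def by (intro mult_left_mono) auto
    then show "sqrt 2 * d \<le> min d1 d2" by simp
  qed
  show ?thesis
  proof (rule exI[of _ d], intro conjI d(1), intro allI impI)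
    fix E assume E: "E \<in> C_omega \<delta>" "\<exists>x. det (E x) \<noteq> 0" "strip_dist \<delta> D E < d"
    have diff: "mat_norm (?X E z - ?X D z) \<le> d" if z: "z \<in> strip \<delta>" for z
    proof -
      have "mat_norm (?X E z - ?X D z) = mat_norm (?X (\<lambda>x. E x - D x) z)"
        by (simp add: strip_extension_diff[OF \<delta> E(1) D(1) z])
      also have "\<dots> \<le> strip_norm \<delta> (\<lambda>x. E x - D x)"
        by (rule mat_norm_le_strip_norm[OF \<delta> C_omega_diff[OF E(1) D(1)] z])
      also have "\<dots> = strip_dist \<delta> E D" using E D by (simp add: strip_dist_def)
      also have "\<dots> = strip_dist \<delta> D E" by (rule commute)
      finally show ?thesis using E(3) by linarith
    qed
    have bE: "sqrt 2 * mat_norm (?X E z) \<le> exp M" if z: "z \<in> strip \<delta>" for z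
    proof -
      have "mat_norm (?X E z) \<le> mat_norm (?X D z) + mat_norm (?X E z - ?X D z)"
        using mat_norm_triangle[of "?X D z" "?X E z - ?X D z"] by simp
      then have "mat_norm (?X E z) \<le> \<bar>strip_norm \<delta> D\<bar> + 1"
        using mat_norm_le_strip_norm[OF \<delta> D(1) z] diff[OF z] d(2) by linarith
      then have "sqrt 2 * mat_norm (?X E z) \<le> sqrt 2 * (\<bar>strip_norm \<delta> D\<bar> + 1)" by (intro mult_left_mono) auto
      then show ?thesis unfolding eM by linarith
    qed
    obtain x1 where "det (E x1) \<noteq> 0" using E(2) by blast
    then have Q: "qp_cocycle \<delta> M (?X E)" by (rule qp_cocycle_strip_extension[OF \<delta> E(1) _ M bE])
    have cl: "norm (?X E z - ?X D z) \<le> min d1 d2" if "\<bar>Im z\<bar> < \<delta>" for z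
    proof -
      have "norm (?X E z - ?X D z) \<le> sqrt 2 * mat_norm (?X E z - ?X D z)" by (rule norm_le_mat_norm)
      also have "\<dots> \<le> sqrt 2 * d" using diff[of z] that by (intro mult_left_mono) (auto simp: strip_def)
      finally show ?thesis using d(3) by linarith
    qed
    have A: "\<bar>clyap \<beta> (?X E) 0 - clyap \<beta> (?X D) 0\<bar> \<le> e" by (rule d1(2)) (use Q cl in auto)
    have B: "\<bar>dmean (?X E) 0 - dmean (?X D) 0\<bar> \<le> e" by (rule d2(2)) (use Q cl in auto)
    show "\<bar>lyapunov \<beta> E - lyapunov \<beta> D\<bar> \<le> e \<and> \<bar>lyapunov' \<beta> E - lyapunov' \<beta> D\<bar> \<le> 2 * e"
      unfolding lyapunov_eq_clyap[OF real[OF D(1)]] qp_cocycle.lyapunov_eq_clyap[OF Q real[OF E(1)]]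
      using A B by linarith
  qed
qed

lemma continuous_map_strip_topologyI:
  assumes \<delta>: "\<delta> > 0" and S: "S \<subseteq> C_omega \<delta>"
    and cont: "\<And>D e. D \<in> S \<Longrightarrow> e > 0 \<Longrightarrow> \<exists>d>0. \<forall>E\<in>S. strip_dist \<delta> D E < d \<longrightarrow> \<bar>f E - f D\<bar> < e"
  shows "continuous_map (subtopology (strip_topology \<delta>) S) euclideanreal f"
proof -
  interpret Metric_space "C_omega \<delta>" "strip_dist \<delta>" by (rule Metric_space_C_omega[OF \<delta>])
  interpret Submetric "C_omega \<delta>" "strip_dist \<delta>" S by unfold_locales (rule S)
  have "continuous_map sub.mtopology euclideanreal f"
    unfolding continuous_map_def
  proof (intro conjI allI impI)
    fix U :: "real set" assume "openin euclideanreal U"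
    then have U: "open U" by simp
    show "openin sub.mtopology {D \<in> topspace sub.mtopology. f D \<in> U}"
      unfolding sub.openin_mtopology sub.topspace_mtopology
    proof (intro conjI allI impI)
      fix D assume D: "D \<in> {D \<in> S. f D \<in> U}"
      then obtain e where e: "e > 0" "\<And>t. \<bar>t - f D\<bar> < e \<Longrightarrow> t \<in> U"
        using U unfolding open_dist by (auto simp: dist_real_def)
      obtain d where d: "d > 0" "\<forall>E\<in>S. strip_dist \<delta> D E < d \<longrightarrow> \<bar>f E - f D\<bar> < e"
        using cont[of D e] D e by blast
      then have "sub.mball D d \<subseteq> {D \<in> S. f D \<in> U}" using e(2) by (auto simp: sub.in_mball)
      with d(1) show "\<exists>r>0. sub.mball D r \<subseteq> {D \<in> S. f D \<in> U}" by blast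
    qed auto
  qed simp
  then show ?thesis unfolding mtopology_submetric strip_topology_def .
qed

theorem theorem1p2:
  fixes \<delta> \<beta> :: real
  assumes "\<delta> > 0"
    and "diophantine \<beta>"
  shows "continuous_map
           (subtopology (strip_topology \<delta>) {D \<in> C_omega \<delta>. \<exists>x. det (D x) \<noteq> 0})
           euclideanreal (lyapunov \<beta>) \<and>
         continuous_map
           (subtopology (strip_topology \<delta>) {D \<in> C_omega \<delta>. \<exists>x. det (D x) \<noteq> 0})
           euclideanreal (lyapunov' \<beta>)"
proof -
  let ?S = "{D \<in> C_omega \<delta>. \<exists>x. det (D x) \<noteq> 0}"
  have *: "\<exists>d>0. \<forall>E\<in>?S. strip_dist \<delta> D E < d \<longrightarrow>
      \<bar>lyapunov \<beta> E - lyapunov \<beta> D\<bar> < e \<and> \<bar>lyapunov' \<beta> E - lyapunov' \<beta> D\<bar> < e"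
    if D: "D \<in> ?S" and e: "e > 0" for D e
  proof -
    obtain d where d: "d > 0" "\<And>E. E \<in> C_omega \<delta> \<Longrightarrow> (\<exists>x. det (E x) \<noteq> 0) \<Longrightarrow> strip_dist \<delta> D E < d \<Longrightarrow>
        \<bar>lyapunov \<beta> E - lyapunov \<beta> D\<bar> \<le> e / 3 \<and> \<bar>lyapunov' \<beta> E - lyapunov' \<beta> D\<bar> \<le> 2 * (e / 3)"
      using strip_dist_continuity[OF assms(1) diophantine_irrational[OF assms(2)], of D "e / 3"] D e by auto
    show ?thesis
    proof (rule exI[of _ d], intro conjI d(1), intro ballI impI)
      fix E assume "E \<in> ?S" "strip_dist \<delta> D E < d"
      then have "\<bar>lyapunov \<beta> E - lyapunov \<beta> D\<bar> \<le> e / 3 \<and> \<bar>lyapunov' \<beta> E - lyapunov' \<beta> D\<bar> \<le> 2 * (e / 3)"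
        by (intro d(2)) auto
      with e show "\<bar>lyapunov \<beta> E - lyapunov \<beta> D\<bar> < e \<and> \<bar>lyapunov' \<beta> E - lyapunov' \<beta> D\<bar> < e"
        by linarith
    qed
  qed
  show ?thesis
  proof
    show "continuous_map (subtopology (strip_topology \<delta>) ?S) euclideanreal (lyapunov \<beta>)"
    proof (rule continuous_map_strip_topologyI[OF assms(1)])
      fix D and e :: real assume "D \<in> ?S" "e > 0"
      from *[OF this] show "\<exists>d>0. \<forall>E\<in>?S. strip_dist \<delta> D E < d \<longrightarrow> \<bar>lyapunov \<beta> E - lyapunov \<beta> D\<bar> < e"
        by meson
    qed simp
    show "continuous_map (subtopology (strip_topology \<delta>) ?S) euclideanreal (lyapunov' \<beta>)"
    proof (rule continuous_map_strip_topologyI[OF assms(1)])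
      fix D and e :: real assume "D \<in> ?S" "e > 0"
      from *[OF this] show "\<exists>d>0. \<forall>E\<in>?S. strip_dist \<delta> D E < d \<longrightarrow> \<bar>lyapunov' \<beta> E - lyapunov' \<beta> D\<bar> < e"
        by meson
    qed simp
  qed
qed

end
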